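(* Let $f,\sigma:[0,1]\to\mathbb{R}$ with $f',\sigma'\in BV$, let $a:\mathbb{R}\to\mathbb{R}$ be integrable, and let $X_0=F(I(f))=\sum_{k\ge 0}a_k I(f)^{\diamond k}$ be a Wick-analytic functional of the single Wiener integral $I(f)$ (i.e. $\sup_{k\ge1}\sqrt[k]{k!\,|a_k|}<\infty$). Let $(X_t)_{t\in[0,1]}$ be the solution of the linear Skorohod SDE $$dX_t=a(t)X_t\,dt+\sigma(t)X_t\,dW_t,\qquad X_0=F(I(f)),\quad t\in[0,1].$$ Then, with $\widehat{X_1}^n=\mathbb{E}[X_1\mid W_{1/n},W_{2/n},\ldots,W_1]$, $$\lim_{n\to\infty}n^2\,\mathbb{E}\big[(X_1-\widehat{X_1}^n)^2\big]=\frac{e^{2\int_0^1a(s)\,ds}}{12}\int_0^1\mathbb{E}\Big[\Big(\big(f'(s)F'(I(f))+\sigma'(s)F(I(f))\big)\diamond e^{\diamond I(\sigma)}\Big)^2\Big]\,ds .$$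
   Context: Setting: $(W_t)_{t\in[0,1]}$ is a Brownian motion on $(\Omega,\mathcal{F},P)$, where $\mathcal{F}$ is generated by $W$ and completed by null sets. $L^2=L^2([0,1];\mathbb{R})$ has norm $\|\cdot\|$ and inner product $\langle\cdot,\cdot\rangle$; $L^2(\Omega)=L^2(\Omega,\mathcal{F},P)$. For $f\in L^2$, $I(f)=\int_0^1 f(s)\,dW_s$ is the Wiener integral. "$f'\in BV$" means: $f\in L^2$ is differentiable on $[0,1]$ and $f':[0,1]\to\mathbb{R}$ is of bounded variation. Optimal approximation: for $X\in L^2(\Omega)$, $\widehat{X}^n:=\mathbb{E}[X\mid W_{1/n},W_{2/n},\ldots,W_1]$. Wick exponential: $e^{\diamond I(g)}=\exp^{\diamond}(I(g)):=\exp(I(g)-\|g\|^2/2)$, $g\in L^2$. A random variable $X\in L^2(\Omega)$ is determined by the values $\mathbb{E}[Xe^{\diamond I(g)}]$, $g\in L^2$. Wick product: $X\diamond Y$ is the element of $L^2(\Omega)$ (when it exists) with $\mathbb{E}[(X\diamond Y)e^{\diamond I(g)}]=\mathbb{E}[Xe^{\diamond I(g)}]\,\mathbb{E}[Ye^{\diamond I(g)}]$ for all $g\in L^2$. $X^{\diamond k}$ is the $k$-fold Wick power, $X^{\diamond 0}=1$. One has $I(f)^{\diamond k}=h^k_{\|f\|^2}(I(f))$ with $h^k_{\|f\|^2}$ the monic Hermite polynomial of degree $k$ with variance parameter $\|f\|^2$, and $e^{\diamond I(f)}=\sum_{k\ge0}\frac1{k!}I(f)^{\diamond k}$. Wick-analytic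 functionals: the class $\mathcal{WA}\subset L^2(\Omega)$ consists of all $F(I(f_1),\ldots,I(f_K))=\big(\sum_{k\ge0}a_{1,k}I(f_1)^{\diamond k}\big)\diamond\cdots\diamond\big(\sum_{k\ge0}a_{K,k}I(f_K)^{\diamond k}\big)$ with $K\in\mathbb{N}$, $f_1,\ldots,f_K\in L^2$, and real coefficients with $\sup\{\sqrt[k]{k!\,|a_{i,k}|}:i\le K,k\ge1\}<\infty$. Derivative: for $F(I(f))=\sum_{k\ge0}a_kI(f)^{\diamond k}\in\mathcal{WA}$, $F'(I(f))=\sum_{k\ge0}(k+1)a_{k+1}I(f)^{\diamond k}$ (the ordinary derivative of $F$ evaluated at $I(f)$), which is again in $\mathcal{WA}$. Skorohod integral: for a (possibly nonadapted) square integrable process $u=(u_s)_{s\in[0,1]}$, $\int_0^1u_s\,dW_s=Y$ for $Y\in L^2(\Omega)$ if $\mathbb{E}[Ye^{\diamond I(g)}]=\int_0^1\mathbb{E}[u_se^{\diamond I(g)}]g(s)\,ds$ for all $g\in L^2$. Skorohod SDE: the equation $dX_t=a(t)X_t\,dt+\sigma(t)X_t\,dW_t$ with (possibly nonadapted) initial value $X_0$ means $X_t=X_0+\int_0^ta(s)X_s\,ds+\int_0^1\mathbf{1}_{[0,t]}(s)\sigma(s)X_s\,dW_s$ with the stochastic integral in the Skorohod sense. Its unique solution in $L^2(\Omega\times[0,1])$ is $X_t=X_0\diamond\exp\big(\int_0^t\sigma(s)\,dW_s+\int_0^t(a(s)-\sigma^2(s)/2)\,ds\big)$, and $X_1$ denotes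 the value of this process at $t=1$. *)

theory Defs
  imports "HOL-Probability.Probability"
begin

text \<open>
  Elements of \<open>L\<^sup>2\<close> spaces are represented by functions; \<open>L\<^sup>2([0,1])\<close> is taken with respect to
  \<open>lebesgue_on {0..1}\<close>. Wiener integrals, Wick products and \<open>L\<^sup>2\<close> limits are determined only up to
  null sets, so each is given as a relation, together with a function that selects a version.
\<close>

definition square_integrable :: "'b measure \<Rightarrow> ('b \<Rightarrow> real) \<Rightarrow> bool" where
  "square_integrable M f \<longleftrightarrow> f \<in> borel_measurable M \<and> integrable M (\<lambda>x. (f x)\<^sup>2)"

text \<open>Membership in \<open>L\<^sup>2\<close> is required explicitly because the Bochner integral of a non-integrable
  function is 0.\<close>

definition L2_tendsto :: "'b measure \<Rightarrow> (nat \<Rightarrow> 'b \<Rightarrow> real) \<Rightarrow> ('b \<Rightarrow> real) \<Rightarrow> bool" where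
  "L2_tendsto M F f \<longleftrightarrow>
     (\<forall>n. square_integrable M (F n)) \<and> square_integrable M f \<and>
     (\<lambda>n. \<integral>x. (F n x - f x)\<^sup>2 \<partial>M) \<longlonglongrightarrow> 0"

definition bounded_variation_on :: "real \<Rightarrow> real \<Rightarrow> (real \<Rightarrow> real) \<Rightarrow> bool" where
  "bounded_variation_on x y f \<longleftrightarrow>
     (\<exists>C. \<forall>n t. mono_on {..n} t \<longrightarrow> t ` {..n} \<subseteq> {x..y} \<longrightarrow>
        (\<Sum>i<n. \<bar>f (t (Suc i)) - f (t i)\<bar>) \<le> C)"

definition BV_derivative :: "(real \<Rightarrow> real) \<Rightarrow> (real \<Rightarrow> real) \<Rightarrow> bool" where
  "BV_derivative f f' \<longleftrightarrow>
     square_integrable (lebesgue_on {0..1}) f \<and>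
     (\<forall>s\<in>{0..1}. (f has_real_derivative f' s) (at s within {0..1})) \<and>
     bounded_variation_on 0 1 f'"

definition generated_algebra :: "'a measure \<Rightarrow> (real \<Rightarrow> 'a \<Rightarrow> real) \<Rightarrow> real set \<Rightarrow> 'a measure" where
  "generated_algebra P W T =
     sigma (space P) (\<Union>t\<in>T. {W t -` A \<inter> space P | A. A \<in> sets borel})"

locale brownian_motion = prob_space P for P :: "'a measure" +
  fixes W :: "real \<Rightarrow> 'a \<Rightarrow> real"
  assumes measurable_W: "\<And>t. t \<in> {0..1} \<Longrightarrow> W t \<in> borel_measurable P"
    and start_zero: "AE \<omega> in P. W 0 \<omega> = 0"
    and indep_increments:
      "\<And>n t. mono_on {..n::nat} t \<Longrightarrow> t ` {..n} \<subseteq> {0..1} \<Longrightarrow>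
         indep_vars (\<lambda>_. borel) (\<lambda>i \<omega>. W (t (Suc i)) \<omega> - W (t i) \<omega>) {..<n}"
    and normal_increments:
      "\<And>s t. 0 \<le> s \<Longrightarrow> s < t \<Longrightarrow> t \<le> 1 \<Longrightarrow>
         distributed P lborel (\<lambda>\<omega>. W t \<omega> - W s \<omega>) (normal_density 0 (sqrt (t - s)))"
    and continuous_paths: "AE \<omega> in P. continuous_on {0..1} (\<lambda>t. W t \<omega>)"

locale brownian_space = brownian_motion +
  assumes sets_generated:
    "sets P = sets (completion (restr_to_subalg P (generated_algebra P W {0..1})))"

definition has_wiener_integral ::
    "'a measure \<Rightarrow> (real \<Rightarrow> 'a \<Rightarrow> real) \<Rightarrow> (real \<Rightarrow> real) \<Rightarrow> ('a \<Rightarrow> real) \<Rightarrow> bool" where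
  "has_wiener_integral P W f Y \<longleftrightarrow>
     (\<exists>(N :: nat \<Rightarrow> nat) (c :: nat \<Rightarrow> nat \<Rightarrow> real) (t :: nat \<Rightarrow> nat \<Rightarrow> real).
        (\<forall>m. mono_on {..N m} (t m) \<and> t m ` {..N m} \<subseteq> {0..1}) \<and>
        L2_tendsto (lebesgue_on {0..1})
          (\<lambda>m s. \<Sum>i<N m. c m i * indicator {t m i<..t m (Suc i)} s) f \<and>
        L2_tendsto P
          (\<lambda>m \<omega>. \<Sum>i<N m. c m i * (W (t m (Suc i)) \<omega> - W (t m i) \<omega>)) Y)"

definition wiener_integral ::
    "'a measure \<Rightarrow> (real \<Rightarrow> 'a \<Rightarrow> real) \<Rightarrow> (real \<Rightarrow> real) \<Rightarrow> 'a \<Rightarrow> real" where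
  "wiener_integral P W f = (SOME Y. has_wiener_integral P W f Y)"

definition wick_exp ::
    "'a measure \<Rightarrow> (real \<Rightarrow> 'a \<Rightarrow> real) \<Rightarrow> (real \<Rightarrow> real) \<Rightarrow> 'a \<Rightarrow> real" where
  "wick_exp P W g = (\<lambda>\<omega>. exp (wiener_integral P W g \<omega> - (\<integral>s. (g s)\<^sup>2 \<partial>lebesgue_on {0..1}) / 2))"

definition is_wick_prod ::
    "'a measure \<Rightarrow> (real \<Rightarrow> 'a \<Rightarrow> real) \<Rightarrow> ('a \<Rightarrow> real) \<Rightarrow> ('a \<Rightarrow> real) \<Rightarrow> ('a \<Rightarrow> real) \<Rightarrow> bool" where
  "is_wick_prod P W X Y Z \<longleftrightarrow>
     square_integrable P X \<and> square_integrable P Y \<and> square_integrable P Z \<and>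
     (\<forall>g. square_integrable (lebesgue_on {0..1}) g \<longrightarrow>
        (\<integral>\<omega>. Z \<omega> * wick_exp P W g \<omega> \<partial>P) =
        (\<integral>\<omega>. X \<omega> * wick_exp P W g \<omega> \<partial>P) * (\<integral>\<omega>. Y \<omega> * wick_exp P W g \<omega> \<partial>P))"

definition wick_prod ::
    "'a measure \<Rightarrow> (real \<Rightarrow> 'a \<Rightarrow> real) \<Rightarrow> ('a \<Rightarrow> real) \<Rightarrow> ('a \<Rightarrow> real) \<Rightarrow> 'a \<Rightarrow> real" where
  "wick_prod P W X Y = (SOME Z. is_wick_prod P W X Y Z)"

primrec wick_power ::
    "'a measure \<Rightarrow> (real \<Rightarrow> 'a \<Rightarrow> real) \<Rightarrow> ('a \<Rightarrow> real) \<Rightarrow> nat \<Rightarrow> 'a \<Rightarrow> real" where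
  "wick_power P W X 0 = (\<lambda>_. 1)"
| "wick_power P W X (Suc k) = wick_prod P W X (wick_power P W X k)"

definition wick_analytic_coeffs :: "(nat \<Rightarrow> real) \<Rightarrow> bool" where
  "wick_analytic_coeffs c \<longleftrightarrow> bdd_above ((\<lambda>k. root k (fact k * \<bar>c k\<bar>)) ` {1..})"

text \<open>\<open>wick_series P W c f\<close> is \<open>F(I(f))\<close> for the functional \<open>F\<close> with Wick coefficients \<open>c\<close>;
  \<open>wick_deriv c\<close> are the Wick coefficients of \<open>F'\<close>.\<close>

definition wick_series ::
    "'a measure \<Rightarrow> (real \<Rightarrow> 'a \<Rightarrow> real) \<Rightarrow> (nat \<Rightarrow> real) \<Rightarrow> (real \<Rightarrow> real) \<Rightarrow> 'a \<Rightarrow> real" where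
  "wick_series P W c f =
     (SOME X. L2_tendsto P
        (\<lambda>n \<omega>. \<Sum>k<n. c k * wick_power P W (wiener_integral P W f) k \<omega>) X)"

definition wick_deriv :: "(nat \<Rightarrow> real) \<Rightarrow> nat \<Rightarrow> real" where
  "wick_deriv c = (\<lambda>k. real (k + 1) * c (k + 1))"

definition square_integrable_process :: "'a measure \<Rightarrow> (real \<Rightarrow> 'a \<Rightarrow> real) \<Rightarrow> bool" where
  "square_integrable_process P u \<longleftrightarrow>
     square_integrable (lebesgue_on {0..1} \<Otimes>\<^sub>M P) (\<lambda>(s, \<omega>). u s \<omega>)"

definition has_skorohod_integral ::
    "'a measure \<Rightarrow> (real \<Rightarrow> 'a \<Rightarrow> real) \<Rightarrow> (real \<Rightarrow> 'a \<Rightarrow> real) \<Rightarrow> ('a \<Rightarrow> real) \<Rightarrow> bool" where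
  "has_skorohod_integral P W u Y \<longleftrightarrow>
     square_integrable_process P u \<and> square_integrable P Y \<and>
     (\<forall>g. square_integrable (lebesgue_on {0..1}) g \<longrightarrow>
        (\<integral>\<omega>. Y \<omega> * wick_exp P W g \<omega> \<partial>P) =
        (\<integral>s. (\<integral>\<omega>. u s \<omega> * wick_exp P W g \<omega> \<partial>P) * g s \<partial>lebesgue_on {0..1}))"

text \<open>For merely integrable \<open>a\<close>, square integrability of \<open>X\<close> on the product space does not make sense
  of the drift integral. The second conjunct says that \<open>s \<mapsto> a(s) X\<^sub>s\<close> is Bochner
  integrable in \<open>L\<^sup>2(\<Omega>)\<close>, which implies that the pathwise integral exists almost surely and lies in
  \<open>L\<^sup>2(\<Omega>)\<close>. The equation is required at every time \<open>t\<close>, so that \<open>X 1\<close> is determined up to null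
  sets.\<close>

definition skorohod_sde_solution ::
    "'a measure \<Rightarrow> (real \<Rightarrow> 'a \<Rightarrow> real) \<Rightarrow> (real \<Rightarrow> real) \<Rightarrow> (real \<Rightarrow> real) \<Rightarrow>
     ('a \<Rightarrow> real) \<Rightarrow> (real \<Rightarrow> 'a \<Rightarrow> real) \<Rightarrow> bool" where
  "skorohod_sde_solution P W a \<sigma> X0 X \<longleftrightarrow>
     square_integrable_process P X \<and>
     integrable (lebesgue_on {0..1}) (\<lambda>s. a s * sqrt (\<integral>\<omega>. (X s \<omega>)\<^sup>2 \<partial>P)) \<and>
     (\<forall>t\<in>{0..1}. \<exists>Y.
        has_skorohod_integral P W (\<lambda>s \<omega>. indicator {0..t} s * \<sigma> s * X s \<omega>) Y \<and>
        (AE \<omega> in P. X t \<omega> = X0 \<omega> + (\<integral>s. a s * X s \<omega> \<partial>lebesgue_on {0..t}) + Y \<omega>))"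

definition optimal_approx ::
    "'a measure \<Rightarrow> (real \<Rightarrow> 'a \<Rightarrow> real) \<Rightarrow> nat \<Rightarrow> ('a \<Rightarrow> real) \<Rightarrow> 'a \<Rightarrow> real" where
  "optimal_approx P W n X =
     real_cond_exp P (generated_algebra P W ((\<lambda>i. real i / real n) ` {1..n})) X"

end

theory Submission
  imports Defs
begin

text \<open>
  Everything is read off from the S-transform \<open>g \<mapsto> E[X exp\<^sup>\<diamond>(I(g))]\<close>, which determines \<open>X\<close> because the
  Wick exponentials of step functions are total in \<open>L\<^sup>2(\<Omega>)\<close>. It turns the equation into a linear integral
  equation in time, so that \<open>X\<^sub>1 = exp (\<integral> a) (F(I(f)) \<diamond> exp\<^sup>\<diamond>(I(\<sigma>)))\<close>, and it shows that conditioning on the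
  grid replaces \<open>f\<close> and \<open>\<sigma>\<close> by their averages \<open>f\<^sub>n\<close> and \<open>\<sigma>\<^sub>n\<close> over the grid intervals. With
  \<open>x = \<langle>f, f\<rangle>\<close>, \<open>y = \<langle>f, \<sigma>\<rangle>\<close>, \<open>z = \<langle>\<sigma>, \<sigma>\<rangle>\<close> and \<open>\<Phi>(u) = \<Sum>\<^sub>k a\<^sub>k u\<^sup>k\<close> the second moment of
  \<open>F(I(f)) \<diamond> exp\<^sup>\<diamond>(I(\<sigma>))\<close> is \<open>exp z * (\<Sum>\<^sub>j x\<^sup>j / j! * (\<Phi>\<^sup>(\<^sup>j\<^sup>)(y))\<^sup>2)\<close>, a smooth function of \<open>(x, y, z)\<close>. By
  orthogonality the error is the difference of its values at the inner products of \<open>f, \<sigma>\<close> and of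
  \<open>f\<^sub>n, \<sigma>\<^sub>n\<close>; these differ by \<open>1 / (12 n\<^sup>2)\<close> times the inner products of \<open>f', \<sigma>'\<close> to leading order, and the
  partial derivatives are the second moments of \<open>F'\<close> and \<open>F\<close> that appear in the limit.
\<close>

subsection \<open>Square integrable functions\<close>

text \<open>Versions are chosen by \<open>SOME\<close>, so nothing is known about a Wick product,
  Wick power or series until some explicit function satisfies its defining relation. That function
  is always a \<open>wick_functional\<close>. Its expectation against any square integrable Y needs
  no Hermite identities: E[Y \<open>WE\<close> (\<sigma> + t f)] is expanded in powers of t and its
  coefficients are paired with those of the functional. The limit has its form because
  differentiation in x raises the order of both factors and gives the second moment of F',
  differentiation in y gives twice the mixed moment of F' and F, and differentiation in z reproduces
  that of F. Weighted with <f', f'>, <f', \<sigma>'> and <\<sigma>', \<sigma>'>, these terms are the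
  expanded square of f'(s) F' + \<sigma>'(s) F, integrated over s. The constant 1/12 is the variance
  of the uniform distribution on the unit interval: it appears when a linear function is replaced by
  its average. Uniqueness of X_1 is argued with integrability against Wick exponentials only, which
  the equation yields directly.\<close>

lemma square_integrable_measurable: "square_integrable M f \<Longrightarrow> f \<in> borel_measurable M"
  by (simp add: square_integrable_def)

lemma square_integrable_integrable: "square_integrable M f \<Longrightarrow> integrable M (\<lambda>x. (f x)\<^sup>2)"
  by (simp add: square_integrable_def)

lemma square_integrable_scale:
  assumes "square_integrable M f"
  shows "square_integrable M (\<lambda>x. c * f x)"
  using assms by (auto simp: square_integrable_def power_mult_distrib)

lemma square_integrable_add:
  assumes f: "square_integrable M f" and g: "square_integrable M g"
  shows "square_integrable M (\<lambda>x. f x + g x)"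
proof -
  note [measurable] = square_integrable_measurable[OF f] square_integrable_measurable[OF g]
  have "integrable M (\<lambda>x. (f x + g x)\<^sup>2)"
  proof (rule Bochner_Integration.integrable_bound)
    show "integrable M (\<lambda>x. 2 * (f x)\<^sup>2 + 2 * (g x)\<^sup>2)"
      using square_integrable_integrable[OF f] square_integrable_integrable[OF g] by auto
    have "(a + b)\<^sup>2 \<le> 2 * a\<^sup>2 + 2 * b\<^sup>2" for a b :: real
      using zero_le_power2[of "a - b"] by (simp add: power2_sum power2_diff)
    thus "AE x in M. norm ((f x + g x)\<^sup>2) \<le> norm (2 * (f x)\<^sup>2 + 2 * (g x)\<^sup>2)"
      by (intro AE_I2) simp
  qed measurable
  thus ?thesis by (simp add: square_integrable_def)
qed

lemma square_integrable_diff: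
  assumes "square_integrable M f" "square_integrable M g"
  shows "square_integrable M (\<lambda>x. f x - g x)"
  using square_integrable_add[OF assms(1) square_integrable_scale[OF assms(2), of "-1"]] by simp

lemma square_integrable_zero: "square_integrable M (\<lambda>_. 0)"
  by (simp add: square_integrable_def)

lemma square_integrable_sum:
  assumes "\<And>i. i \<in> I \<Longrightarrow> square_integrable M (f i)"
  shows "square_integrable M (\<lambda>x. \<Sum>i\<in>I. f i x)"
  using assms
proof (induction I rule: infinite_finite_induct)
  case (insert i I)
  then show ?case using square_integrable_add[of M "f i" "\<lambda>x. \<Sum>i\<in>I. f i x"] by simp
qed (simp_all add: square_integrable_zero)

lemma square_integrable_mult_integrable:
  assumes f: "square_integrable M f" and g: "square_integrable M g"
  shows "integrable M (\<lambda>x. f x * g x)"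
proof -
  note [measurable] = square_integrable_measurable[OF f] square_integrable_measurable[OF g]
  show ?thesis
  proof (rule Bochner_Integration.integrable_bound)
    show "integrable M (\<lambda>x. (f x)\<^sup>2 + (g x)\<^sup>2)"
      using square_integrable_integrable[OF f] square_integrable_integrable[OF g] by auto
    have "\<bar>a * b\<bar> \<le> a\<^sup>2 + b\<^sup>2" for a b :: real
      using zero_le_power2[of "\<bar>a\<bar> - \<bar>b\<bar>"] zero_le_power2[of a] zero_le_power2[of b]
        mult_nonneg_nonneg[OF abs_ge_zero[of a] abs_ge_zero[of b]]
      unfolding power2_diff abs_mult power2_abs by linarith
    thus "AE x in M. norm (f x * g x) \<le> norm ((f x)\<^sup>2 + (g x)\<^sup>2)"
      by (intro AE_I2) simp
  qed measurable
qed

lemma square_integrable_cong_AE: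
  assumes "square_integrable M f" "AE x in M. f x = g x" "g \<in> borel_measurable M"
  shows "square_integrable M g"
proof -
  note [measurable] = square_integrable_measurable[OF assms(1)] assms(3)
  have "integrable M (\<lambda>x. (g x)\<^sup>2)"
    by (rule iffD1[OF integrable_cong_AE square_integrable_integrable[OF assms(1)]])
       (use assms(2) in \<open>auto elim: AE_mp\<close>)
  thus ?thesis using assms(3) by (simp add: square_integrable_def)
qed

text \<open>The integral of (s f - t g)^2 is nonnegative for all s and t, so a quadratic form is
  positive semidefinite; its determinant is the claim.\<close>

lemma L2_Cauchy_Schwarz:
  assumes f: "square_integrable M f" and g: "square_integrable M g"
  shows "(\<integral>x. f x * g x \<partial>M)\<^sup>2 \<le> (\<integral>x. (f x)\<^sup>2 \<partial>M) * (\<integral>x. (g x)\<^sup>2 \<partial>M)"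
proof -
  note i = square_integrable_mult_integrable[OF f g] square_integrable_integrable[OF f] square_integrable_integrable[OF g]
  let ?a = "\<integral>x. (f x)\<^sup>2 \<partial>M" and ?b = "\<integral>x. f x * g x \<partial>M" and ?c = "\<integral>x. (g x)\<^sup>2 \<partial>M"
  have q: "0 \<le> ?a * s\<^sup>2 - 2 * s * t * ?b + ?c * t\<^sup>2" for s t
  proof -
    have "0 \<le> (\<integral>x. (s * f x - t * g x)\<^sup>2 \<partial>M)" by simp
    also have "(\<lambda>x. (s * f x - t * g x)\<^sup>2) = (\<lambda>x. s\<^sup>2 * (f x)\<^sup>2 - (2 * s * t) * (f x * g x) + t\<^sup>2 * (g x)\<^sup>2)"
      by (rule ext) (simp only: power2_diff power_mult_distrib, simp add: algebra_simps)
    also have "(\<integral>x. s\<^sup>2 * (f x)\<^sup>2 - (2 * s * t) * (f x * g x) + t\<^sup>2 * (g x)\<^sup>2 \<partial>M) =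
        s\<^sup>2 * ?a - 2 * s * t * ?b + t\<^sup>2 * ?c" using i by simp
    finally show ?thesis by (simp add: mult_ac)
  qed
  have nn: "?a \<ge> 0" "?c \<ge> 0" by simp_all
  show ?thesis
  proof (cases "?a = 0")
    case True
    have "?b = 0"
    proof (rule ccontr)
      assume b: "?b \<noteq> 0"
      \<comment> \<open>With \<open>?a = 0\<close> and t = 1 the form is affine in s; this s pushes
        it down to -1.\<close>
      have "0 \<le> ?c - 2 * ((?c + 1) / (2 * ?b)) * ?b"
        using q[of "(?c + 1) / (2 * ?b)" 1] True by simp
      also have "2 * ((?c + 1) / (2 * ?b)) * ?b = ?c + 1" using b by simp
      finally show False by simp
    qed
    thus ?thesis using True by simp
  next
    case False
    hence "?a > 0" using nn(1) by (metis order_le_less)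
    \<comment> \<open>The form at s = \<open>?b\<close>, t = \<open>?a\<close>, its minimum over s
      for this t.\<close>
    moreover have "0 \<le> ?a * (?a * ?c - ?b\<^sup>2)"
      using q[of ?b ?a] by (simp add: power2_eq_square algebra_simps)
    ultimately show ?thesis by (simp add: zero_le_mult_iff)
  qed
qed

lemma L2_Cauchy_Schwarz_abs:
  assumes f: "square_integrable M f" and g: "square_integrable M g"
  shows "\<bar>\<integral>x. f x * g x \<partial>M\<bar> \<le> sqrt (\<integral>x. (f x)\<^sup>2 \<partial>M) * sqrt (\<integral>x. (g x)\<^sup>2 \<partial>M)"
  using real_sqrt_le_mono[OF L2_Cauchy_Schwarz[OF assms]] by (simp add: real_sqrt_mult)

text \<open>A factor 2 in place of Minkowski's inequality: enough wherever the right side only has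
  to be small or bounded.\<close>

lemma L2_norm_add_le:
  assumes f: "square_integrable M f" and g: "square_integrable M g"
  shows "(\<integral>x. (f x + g x)\<^sup>2 \<partial>M) \<le> 2 * (\<integral>x. (f x)\<^sup>2 \<partial>M) + 2 * (\<integral>x. (g x)\<^sup>2 \<partial>M)"
proof -
  have "(\<integral>x. (f x + g x)\<^sup>2 \<partial>M) \<le> (\<integral>x. 2 * (f x)\<^sup>2 + 2 * (g x)\<^sup>2 \<partial>M)"
  proof (rule integral_mono)
    show "(f x + g x)\<^sup>2 \<le> 2 * (f x)\<^sup>2 + 2 * (g x)\<^sup>2" for x
      using zero_le_power2[of "f x - g x"] by (simp add: power2_sum power2_diff)
  qed (use square_integrable_integrable[OF f] square_integrable_integrable[OF g]
        square_integrable_integrable[OF square_integrable_add[OF f g]] in auto)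
  also have "\<dots> = 2 * (\<integral>x. (f x)\<^sup>2 \<partial>M) + 2 * (\<integral>x. (g x)\<^sup>2 \<partial>M)"
    using square_integrable_integrable[OF f] square_integrable_integrable[OF g] by simp
  finally show ?thesis .
qed

section \<open>Limits in L2\<close>

lemma L2_tendsto_add:
  assumes "L2_tendsto M F f" "L2_tendsto M G g"
  shows "L2_tendsto M (\<lambda>n x. F n x + G n x) (\<lambda>x. f x + g x)"
proof -
  have s: "square_integrable M (F n)" "square_integrable M f" "square_integrable M (G n)" "square_integrable M g" for n
    using assms by (auto simp: L2_tendsto_def)
  have "(\<lambda>n. \<integral>x. ((F n x - f x) + (G n x - g x))\<^sup>2 \<partial>M) \<longlonglongrightarrow> 0"
  proof (rule tendsto_sandwich[OF always_eventually always_eventually, where f = "\<lambda>_. 0"])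
    show "\<forall>n. (\<integral>x. ((F n x - f x) + (G n x - g x))\<^sup>2 \<partial>M) \<le>
       2 * (\<integral>x. (F n x - f x)\<^sup>2 \<partial>M) + 2 * (\<integral>x. (G n x - g x)\<^sup>2 \<partial>M)"
      by (intro allI L2_norm_add_le square_integrable_diff s)
    show "(\<lambda>n. 2 * (\<integral>x. (F n x - f x)\<^sup>2 \<partial>M) + 2 * (\<integral>x. (G n x - g x)\<^sup>2 \<partial>M)) \<longlonglongrightarrow> 0"
      using assms by (auto simp: L2_tendsto_def intro!: tendsto_eq_intros)
  qed auto
  moreover have "(\<lambda>x. ((F n x - f x) + (G n x - g x))\<^sup>2) = (\<lambda>x. (F n x + G n x - (f x + g x))\<^sup>2)" for n
    by (simp add: algebra_simps)
  ultimately show ?thesis by (simp add: L2_tendsto_def square_integrable_add s)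
qed

lemma L2_tendsto_scale:
  assumes "L2_tendsto M F f"
  shows "L2_tendsto M (\<lambda>n x. c * F n x) (\<lambda>x. c * f x)"
proof -
  have "(\<lambda>n. c\<^sup>2 * (\<integral>x. (F n x - f x)\<^sup>2 \<partial>M)) \<longlonglongrightarrow> c\<^sup>2 * 0"
    using assms by (intro tendsto_intros) (auto simp: L2_tendsto_def)
  moreover have "(\<lambda>x. (c * F n x - c * f x)\<^sup>2) = (\<lambda>x. c\<^sup>2 * (F n x - f x)\<^sup>2)" for n
    by (simp add: right_diff_distrib[symmetric] power_mult_distrib)
  ultimately show ?thesis using assms by (simp add: L2_tendsto_def square_integrable_scale)
qed

lemma L2_tendsto_diff:
  assumes "L2_tendsto M F f" "L2_tendsto M G g"
  shows "L2_tendsto M (\<lambda>n x. F n x - G n x) (\<lambda>x. f x - g x)"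
  using L2_tendsto_add[OF assms(1) L2_tendsto_scale[OF assms(2), of "-1"]] by simp

lemma L2_tendsto_inner:
  assumes "L2_tendsto M F f" "L2_tendsto M G g"
  shows "(\<lambda>n. \<integral>x. F n x * G n x \<partial>M) \<longlonglongrightarrow> (\<integral>x. f x * g x \<partial>M)"
proof -
  have s: "square_integrable M (F n)" "square_integrable M f" "square_integrable M (G n)" "square_integrable M g" for n
    using assms by (auto simp: L2_tendsto_def)
  define df dg where "df n = (\<integral>x. (F n x - f x)\<^sup>2 \<partial>M)" and "dg n = (\<integral>x. (G n x - g x)\<^sup>2 \<partial>M)" for n
  have lim: "df \<longlonglongrightarrow> 0" "dg \<longlonglongrightarrow> 0" using assms by (auto simp: L2_tendsto_def df_def[abs_def] dg_def[abs_def])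
  have "(\<lambda>n. (\<integral>x. F n x * G n x \<partial>M) - (\<integral>x. f x * g x \<partial>M)) \<longlonglongrightarrow> 0"
  proof (rule Lim_null_comparison)
    show "\<forall>\<^sub>F n in sequentially. norm ((\<integral>x. F n x * G n x \<partial>M) - (\<integral>x. f x * g x \<partial>M)) \<le>
      sqrt (df n) * sqrt (dg n) + sqrt (df n) * sqrt (\<integral>x. (g x)\<^sup>2 \<partial>M) + sqrt (\<integral>x. (f x)\<^sup>2 \<partial>M) * sqrt (dg n)"
    proof (intro always_eventually allI)
      fix n
      note d = square_integrable_diff[OF s(1)[of n] s(2)] square_integrable_diff[OF s(3)[of n] s(4)]
      have "(\<lambda>x. F n x * G n x) = (\<lambda>x. ((F n x - f x) * (G n x - g x) + (F n x - f x) * g x + f x * (G n x - g x)) + f x * g x)"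
        by (simp add: algebra_simps)
      hence "(\<integral>x. F n x * G n x \<partial>M) - (\<integral>x. f x * g x \<partial>M) =
         (\<integral>x. (F n x - f x) * (G n x - g x) \<partial>M) + (\<integral>x. (F n x - f x) * g x \<partial>M) + (\<integral>x. f x * (G n x - g x) \<partial>M)"
        using square_integrable_mult_integrable[OF d(1) d(2)] square_integrable_mult_integrable[OF d(1) s(4)]
          square_integrable_mult_integrable[OF s(2) d(2)] square_integrable_mult_integrable[OF s(2) s(4)] by simp
      thus "norm ((\<integral>x. F n x * G n x \<partial>M) - (\<integral>x. f x * g x \<partial>M)) \<le>
      sqrt (df n) * sqrt (dg n) + sqrt (df n) * sqrt (\<integral>x. (g x)\<^sup>2 \<partial>M) + sqrt (\<integral>x. (f x)\<^sup>2 \<partial>M) * sqrt (dg n)"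
        using L2_Cauchy_Schwarz_abs[OF d(1) d(2)] L2_Cauchy_Schwarz_abs[OF d(1) s(4)] L2_Cauchy_Schwarz_abs[OF s(2) d(2)]
        unfolding df_def dg_def real_norm_def by linarith
    qed
    show "(\<lambda>n. sqrt (df n) * sqrt (dg n) + sqrt (df n) * sqrt (\<integral>x. (g x)\<^sup>2 \<partial>M) + sqrt (\<integral>x. (f x)\<^sup>2 \<partial>M) * sqrt (dg n)) \<longlonglongrightarrow> 0"
      using lim by (auto intro!: tendsto_eq_intros)
  qed
  thus ?thesis by (simp add: LIM_zero_iff)
qed

lemma L2_tendsto_const: "square_integrable M f \<Longrightarrow> L2_tendsto M (\<lambda>_. f) f"
  by (simp add: L2_tendsto_def)

lemma (in finite_measure) bounded_square_integrable:
  assumes "f \<in> borel_measurable M" "\<And>x. x \<in> space M \<Longrightarrow> \<bar>f x\<bar> \<le> B"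
  shows "square_integrable M f"
proof -
  have "integrable M (\<lambda>x. (f x)\<^sup>2)"
  proof (rule integrable_const_bound)
    show "AE x in M. norm ((f x)\<^sup>2) \<le> B\<^sup>2"
    proof (rule AE_I2)
      fix x assume "x \<in> space M"
      from power_mono[OF assms(2)[OF this], of 2] show "norm ((f x)\<^sup>2) \<le> B\<^sup>2" by simp
    qed
  qed (use assms(1) in measurable)
  with assms(1) show ?thesis by (simp add: square_integrable_def)
qed

lemma (in finite_measure) L2_imp_integrable:
  assumes "square_integrable M f"
  shows "integrable M f"
  using square_integrable_mult_integrable[OF assms bounded_square_integrable[of "\<lambda>_. 1" 1]] by simp

lemma has_integral_zero_square_AE:
  assumes "square_integrable M f" "(\<integral>x. (f x)\<^sup>2 \<partial>M) = 0"
  shows "AE x in M. f x = 0"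
  using integral_nonneg_eq_0_iff_AE[OF square_integrable_integrable[OF assms(1)]] assms(2) by auto

subsection \<open>Exponential generating functions and Hermite series\<close>

text \<open>By strong induction the lower coefficients vanish, so the series can be divided by t^k,
  and its limit at 0 is \<open>d k\<close>.\<close>

lemma powser_coeff_zero:
  fixes d :: "nat \<Rightarrow> real"
  assumes "\<And>t. (\<lambda>k. d k * t ^ k) sums 0"
  shows "d k = 0"
proof (induction k rule: less_induct)
  case (less k)
  have "(\<lambda>n. d (n + k) * t ^ n) sums 0" if "t \<noteq> 0" for t
  proof -
    have "(\<lambda>n. d (n + k) * t ^ (n + k)) sums (0 - (\<Sum>i<k. d i * t ^ i))"
      using sums_split_initial_segment[OF assms, of k t] by simp
    also have "(\<Sum>i<k. d i * t ^ i) = 0" using less by simp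
    finally have "(\<lambda>n. (d (n + k) * t ^ (n + k)) / t ^ k) sums (0 / t ^ k)"
      by (intro sums_divide) simp
    with that show ?thesis by (simp add: power_add)
  qed
  from powser_limit_0_strong[of 1 "\<lambda>n. d (n + k)" "\<lambda>_. 0", OF _ this]
  have "((\<lambda>_::real. 0::real) \<longlongrightarrow> d k) (at 0)" by simp
  from LIM_const_eq[OF this] show ?case by simp
qed

lemma powser_coeff_unique:
  fixes a b :: "nat \<Rightarrow> real"
  assumes "\<And>t. (\<lambda>k. a k * t ^ k / fact k) sums F t" "\<And>t. (\<lambda>k. b k * t ^ k / fact k) sums F t"
  shows "a = b"
proof
  fix k
  have "(\<lambda>k. ((a k - b k) / fact k) * t ^ k) sums 0" for t
    using sums_diff[OF assms(1)[of t] assms(2)[of t]] by (simp add: diff_divide_distrib left_diff_distrib)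
  from powser_coeff_zero[OF this, of k] show "a k = b k" by simp
qed

text \<open>Power series are written with the coefficients \<open>a k = k! * c k\<close>, for which \<^term>\<open>wick_analytic_coeffs\<close>
  is a geometric bound and \<^term>\<open>wick_deriv\<close> is a shift.\<close>

definition geom_bounded :: "(nat \<Rightarrow> real) \<Rightarrow> bool" where
  "geom_bounded a \<longleftrightarrow> (\<exists>C R. C \<ge> 0 \<and> R \<ge> 0 \<and> (\<forall>k. \<bar>a k\<bar> \<le> C * R ^ k))"

lemma geom_boundedE:
  assumes "geom_bounded a"
  obtains C R where "C \<ge> 0" "R \<ge> 0" "\<And>k. \<bar>a k\<bar> \<le> C * R ^ k"
  using assms unfolding geom_bounded_def by blast

lemma geom_bounded_add:
  assumes "geom_bounded a" "geom_bounded b"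
  shows "geom_bounded (\<lambda>k. a k + b k)"
proof -
  obtain C R where 1: "C \<ge> 0" "R \<ge> 0" "\<And>k. \<bar>a k\<bar> \<le> C * R ^ k" using assms(1) by (rule geom_boundedE) blast
  obtain D S where 2: "D \<ge> 0" "S \<ge> 0" "\<And>k. \<bar>b k\<bar> \<le> D * S ^ k" using assms(2) by (rule geom_boundedE) blast
  have "\<bar>a k + b k\<bar> \<le> (C + D) * (max R S) ^ k" for k
  proof -
    have "\<bar>a k + b k\<bar> \<le> C * R ^ k + D * S ^ k" using 1(3)[of k] 2(3)[of k] by linarith
    also have "\<dots> \<le> C * (max R S) ^ k + D * (max R S) ^ k"
      using 1 2 by (intro add_mono mult_left_mono power_mono) auto
    finally show ?thesis by (simp add: algebra_simps)
  qed
  with 1 2 show ?thesis unfolding geom_bounded_def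
    by (intro exI[of _ "C + D"] exI[of _ "max R S"]) auto
qed

lemma geom_bounded_scale:
  assumes "geom_bounded a"
  shows "geom_bounded (\<lambda>k. c * a k)"
proof -
  obtain C R where 1: "C \<ge> 0" "R \<ge> 0" "\<And>k. \<bar>a k\<bar> \<le> C * R ^ k" using assms(1) by (rule geom_boundedE) blast
  have "\<bar>c * a k\<bar> \<le> (\<bar>c\<bar> * C) * R ^ k" for k
    using mult_left_mono[OF 1(3)[of k], of "\<bar>c\<bar>"] by (simp add: abs_mult mult.assoc)
  with 1 show ?thesis unfolding geom_bounded_def
    by (intro exI[of _ "\<bar>c\<bar> * C"] exI[of _ R]) auto
qed

lemma geom_bounded_shift:
  assumes "geom_bounded a"
  shows "geom_bounded (\<lambda>k. a (k + j))"
proof -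
  obtain C R where 1: "C \<ge> 0" "R \<ge> 0" "\<And>k. \<bar>a k\<bar> \<le> C * R ^ k" using assms(1) by (rule geom_boundedE) blast
  have "\<bar>a (k + j)\<bar> \<le> (C * R ^ j) * R ^ k" for k
    using 1(3)[of "k+j"] by (simp add: power_add mult.assoc mult.commute mult.left_commute)
  with 1 show ?thesis unfolding geom_bounded_def
    by (intro exI[of _ "C * R ^ j"] exI[of _ R]) auto
qed

text \<open>Supplies the coefficients of single Wick powers and of truncated Wick series.\<close>

lemma geom_bounded_finite_support:
  assumes "\<And>k. k \<ge> n \<Longrightarrow> a k = 0"
  shows "geom_bounded a"
proof -
  have "\<bar>a k\<bar> \<le> (\<Sum>i<n. \<bar>a i\<bar>) * 1 ^ k" for k
  proof (cases "k < n")
    case True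
    then show ?thesis using member_le_sum[of k "{..<n}" "\<lambda>i. \<bar>a i\<bar>"] by simp
  next
    case False
    then show ?thesis using assms[of k] by (simp add: sum_nonneg)
  qed
  thus ?thesis unfolding geom_bounded_def
    by (intro exI[of _ "\<Sum>i<n. \<bar>a i\<bar>"] exI[of _ 1]) (auto simp: sum_nonneg)
qed

text \<open>For \<open>a k = k! * c k\<close> this is the sum of c_k y^k. At y = <f, g> it is the
  S-transform at g of the functional of I(f) with Wick coefficients c_k.\<close>

definition egf :: "(nat \<Rightarrow> real) \<Rightarrow> real \<Rightarrow> real" where
  "egf a y = (\<Sum>n. a n * y ^ n / fact n)"

lemma exp_sums_real: "(\<lambda>n. (y::real) ^ n / fact n) sums exp y"
  using exp_converges[of y] by (simp add: field_simps)

lemma egf_bounds: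
  assumes "R \<ge> 0" "\<And>k. \<bar>a k\<bar> \<le> C * R ^ k"
  shows egf_summable_abs: "summable (\<lambda>n. \<bar>a n * y ^ n / fact n\<bar>)"
    and egf_abs_le: "\<bar>egf a y\<bar> \<le> C * exp (R * \<bar>y\<bar>)"
proof -
  have s: "(\<lambda>n. C * ((R * \<bar>y\<bar>) ^ n / fact n)) sums (C * exp (R * \<bar>y\<bar>))"
    by (intro sums_mult exp_sums_real)
  have le: "\<bar>a n * y ^ n / fact n\<bar> \<le> C * ((R * \<bar>y\<bar>) ^ n / fact n)" for n
    using mult_right_mono[OF assms(2)[of n], of "\<bar>y\<bar> ^ n"]
    by (simp add: abs_mult power_abs power_mult_distrib divide_right_mono)
  show 1: "summable (\<lambda>n. \<bar>a n * y ^ n / fact n\<bar>)"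
    by (rule summable_comparison_test'[OF sums_summable[OF s], of 0]) (use le in auto)
  have "\<bar>egf a y\<bar> \<le> (\<Sum>n. \<bar>a n * y ^ n / fact n\<bar>)"
    unfolding egf_def by (rule summable_rabs[OF 1])
  also have "\<dots> \<le> (\<Sum>n. C * ((R * \<bar>y\<bar>) ^ n / fact n))"
    by (intro suminf_le le 1 sums_summable[OF s])
  finally show "\<bar>egf a y\<bar> \<le> C * exp (R * \<bar>y\<bar>)" using sums_unique[OF s] by simp
qed

lemma egf_sums:
  assumes "geom_bounded a"
  shows "(\<lambda>n. a n * y ^ n / fact n) sums egf a y"
proof -
  obtain C R where 1: "C \<ge> 0" "R \<ge> 0" "\<And>k. \<bar>a k\<bar> \<le> C * R ^ k" using assms(1) by (rule geom_boundedE) blast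
  show ?thesis unfolding egf_def
    by (rule summable_sums[OF summable_rabs_cancel[OF egf_summable_abs[OF 1(2,3)]]])
qed

lemma egf_add:
  assumes "geom_bounded a" "geom_bounded b"
  shows "egf (\<lambda>k. a k + b k) y = egf a y + egf b y"
  using sums_unique[OF sums_add[OF egf_sums[OF assms(1), of y] egf_sums[OF assms(2), of y]]]
  by (simp add: egf_def distrib_right add_divide_distrib)

lemma egf_scale:
  assumes "geom_bounded a"
  shows "egf (\<lambda>k. c * a k) y = c * egf a y"
  using sums_unique[OF sums_mult[OF egf_sums[OF assms(1), of y], of c]]
  by (simp add: egf_def mult.assoc)

text \<open>These are the coefficients of the k-th Wick power, whose S-transform is <f,
  g>^k.\<close>

lemma egf_power: "egf (\<lambda>i. if i = k then fact k else 0) y = y ^ k"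
proof -
  have "(\<lambda>n. (if n = k then fact k else 0) * y ^ n / fact n) = (\<lambda>n. if n = k then y ^ n else 0)"
    by auto
  thus ?thesis using sums_unique[OF sums_single[of k "\<lambda>n. y ^ n"]] by (simp add: egf_def)
qed

lemma DERIV_egf:
  assumes "geom_bounded a"
  shows "(egf a has_real_derivative egf (\<lambda>k. a (k + 1)) y) (at y)"
proof -
  have "((\<lambda>x. \<Sum>n. (a n / fact n) * x ^ n) has_real_derivative
      (\<Sum>n. diffs (\<lambda>n. a n / fact n) n * y ^ n)) (at y)"
  proof (rule termdiffs_strong_converges_everywhere)
    fix x :: real
    show "summable (\<lambda>n. (a n / fact n) * x ^ n)"
      using sums_summable[OF egf_sums[OF assms, of x]] by simp
  qed
  moreover have "diffs (\<lambda>n. a n / fact n) n = a (n + 1) / fact n" for n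
    unfolding diffs_def fact_Suc using of_nat_neq_0[of n, where 'a=real] by (simp del: of_nat_Suc)
  ultimately show ?thesis by (simp add: egf_def[abs_def])
qed

text \<open>The j-th derivative of \<open>egf a\<close> grows only geometrically in j, so sums over
  j with weights x^j / j! converge.\<close>

lemma egf_shift_bound:
  assumes "C \<ge> 0" "R \<ge> 0" "\<And>k. \<bar>a k\<bar> \<le> C * R ^ k"
  shows "\<bar>egf (\<lambda>k. a (k + j)) y\<bar> \<le> C * R ^ j * exp (R * \<bar>y\<bar>)"
  by (rule egf_abs_le) (use assms assms(3)[of "_ + j"] in \<open>auto simp: power_add mult_ac\<close>)

text \<open>The Taylor coefficients of \<open>exp (- v t\<^sup>2 / 2)\<close>. A negative \<open>v\<close> is allowed: it gives majorants.\<close>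

definition gauss_coeff :: "real \<Rightarrow> nat \<Rightarrow> real" where
  "gauss_coeff v j = (if even j then (- v / 2) ^ (j div 2) / fact (j div 2) else 0)"

lemma gauss_coeff_sums: "(\<lambda>j. gauss_coeff v j * t ^ j) sums exp (- (t\<^sup>2 * v / 2))"
proof -
  have "(\<lambda>n. gauss_coeff v (2 * n) * t ^ (2 * n)) sums exp (- (t\<^sup>2 * v / 2))"
  proof -
    have "(\<lambda>n. (- (t\<^sup>2 * v / 2)) ^ n / fact n) = (\<lambda>n. gauss_coeff v (2 * n) * t ^ (2 * n))"
    proof
      fix n
      have "(- (t\<^sup>2 * v / 2)) ^ n = ((- v / 2) * t\<^sup>2) ^ n" by (simp add: mult.commute)
      also have "\<dots> = (- v / 2) ^ n * t ^ (2 * n)" by (simp only: power_mult_distrib power_mult)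
      finally show "(- (t\<^sup>2 * v / 2)) ^ n / fact n = gauss_coeff v (2 * n) * t ^ (2 * n)"
        by (simp add: gauss_coeff_def)
    qed
    thus ?thesis using exp_sums_real[of "- (t\<^sup>2 * v / 2)"] by simp
  qed
  moreover have "gauss_coeff v n * t ^ n = 0" if "n \<notin> range ((*) 2)" for n
    using that by (auto simp: gauss_coeff_def elim!: evenE)
  \<comment> \<open>The odd coefficients vanish, so the series is reindexed along the even
    numbers.\<close>
  ultimately show ?thesis
    by (subst sums_mono_reindex[of "(*) 2", symmetric]) (auto simp: strict_mono_def)
qed

lemma abs_gauss_coeff: "\<bar>gauss_coeff v j\<bar> = gauss_coeff (- \<bar>v\<bar>) j"
  by (auto simp: gauss_coeff_def power_abs abs_mult)

text \<open>The monic Hermite polynomial of degree k with variance v, encoded as k! times the k-th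
  Taylor coefficient in t of exp (t x) exp (- t^2 v / 2), a Cauchy product.\<close>

definition hermite :: "real \<Rightarrow> real \<Rightarrow> nat \<Rightarrow> real" where
  "hermite v x k = fact k * (\<Sum>i\<le>k. x ^ i / fact i * gauss_coeff v (k - i))"

lemma summable_abs_gauss: "summable (\<lambda>j. norm (gauss_coeff v j * t ^ j))"
  using sums_summable[OF gauss_coeff_sums[of "- \<bar>v\<bar>" "\<bar>t\<bar>"]]
  by (simp add: abs_mult abs_gauss_coeff power_abs)

lemma hermite_sums: "(\<lambda>k. hermite v x k * t ^ k / fact k) sums exp (t * x - t\<^sup>2 * v / 2)"
proof -
  have "summable (\<lambda>i. norm ((t * x) ^ i / fact i))"
    using sums_summable[OF exp_sums_real[of "\<bar>t * x\<bar>"]] by (simp add: power_abs)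
  from Cauchy_product_sums[OF this summable_abs_gauss[of v t]]
  have "(\<lambda>k. \<Sum>i\<le>k. (t * x) ^ i / fact i * (gauss_coeff v (k - i) * t ^ (k - i))) sums
      (exp (t * x) * exp (- (t\<^sup>2 * v / 2)))"
    by (simp add: sums_unique[OF exp_sums_real, symmetric] sums_unique[OF gauss_coeff_sums, symmetric])
  also have "exp (t * x) * exp (- (t\<^sup>2 * v / 2)) = exp (t * x - t\<^sup>2 * v / 2)"
    by (simp add: exp_add[symmetric])
  also have "(\<lambda>k. \<Sum>i\<le>k. (t * x) ^ i / fact i * (gauss_coeff v (k - i) * t ^ (k - i)))
     = (\<lambda>k. hermite v x k * t ^ k / fact k)"
  proof
    fix k
    have "(t * x) ^ i / fact i * (gauss_coeff v (k - i) * t ^ (k - i)) =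
        x ^ i / fact i * gauss_coeff v (k - i) * t ^ k" if "i \<le> k" for i
    proof -
      have "t ^ k = t ^ i * t ^ (k - i)" using that by (simp add: power_add[symmetric])
      thus ?thesis by (simp add: power_mult_distrib)
    qed
    hence "(\<Sum>i\<le>k. (t * x) ^ i / fact i * (gauss_coeff v (k - i) * t ^ (k - i))) =
        (\<Sum>i\<le>k. x ^ i / fact i * gauss_coeff v (k - i) * t ^ k)"
      by (intro sum.cong[OF refl]) (simp only: atMost_iff)
    thus "(\<Sum>i\<le>k. (t * x) ^ i / fact i * (gauss_coeff v (k - i) * t ^ (k - i))) = hermite v x k * t ^ k / fact k"
      by (simp add: hermite_def sum_distrib_right)
  qed
  finally show ?thesis .
qed

text \<open>Absolute values taken termwise replace v by -|v| and x by |x|, and then every term is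
  nonnegative. The majorant has the generating function exp (t |x| + t^2 |v| / 2).\<close>

lemma abs_hermite_le: "\<bar>hermite v x k\<bar> \<le> hermite (- \<bar>v\<bar>) \<bar>x\<bar> k"
proof -
  have "\<bar>\<Sum>i\<le>k. x ^ i / fact i * gauss_coeff v (k - i)\<bar> \<le> (\<Sum>i\<le>k. \<bar>x ^ i / fact i * gauss_coeff v (k - i)\<bar>)"
    by (rule sum_abs)
  thus ?thesis by (simp add: hermite_def abs_mult abs_gauss_coeff power_abs)
qed

lemma hermite_measurable [measurable]: "(\<lambda>x. hermite v x k) \<in> borel_measurable borel"
  unfolding hermite_def by measurable

text \<open>With \<open>a k = k! * c k\<close>, v = ||f||^2 and x = I(f) this is the functional with
  Wick coefficients c_k.\<close>

definition hermite_series :: "(nat \<Rightarrow> real) \<Rightarrow> real \<Rightarrow> real \<Rightarrow> real" where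
  "hermite_series a v x = (\<Sum>k. a k * hermite v x k / fact k)"

lemma hermite_series_measurable [measurable]: "hermite_series a v \<in> borel_measurable borel"
  unfolding hermite_series_def[abs_def] by measurable

text \<open>The majorant is the generating function of the Hermite polynomials of variance -|v|,
  evaluated at t = R.\<close>

lemma hermite_series_summable:
  assumes "R \<ge> 0" "C \<ge> 0" "\<And>k. \<bar>a k\<bar> \<le> C * R ^ k"
  shows "summable (\<lambda>k. \<bar>a k * hermite v x k / fact k\<bar>)" (is ?th1)
    and "(\<Sum>k. \<bar>a k * hermite v x k / fact k\<bar>) \<le> C * exp (R * \<bar>x\<bar> + R\<^sup>2 * \<bar>v\<bar> / 2)" (is ?th2)
proof -
  have s: "(\<lambda>k. C * (hermite (- \<bar>v\<bar>) \<bar>x\<bar> k * R ^ k / fact k)) sums (C * exp (R * \<bar>x\<bar> + R\<^sup>2 * \<bar>v\<bar> / 2))"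
    using sums_mult[OF hermite_sums[of "- \<bar>v\<bar>" "\<bar>x\<bar>" R], of C] by simp
  have le: "\<bar>a k * hermite v x k / fact k\<bar> \<le> C * (hermite (- \<bar>v\<bar>) \<bar>x\<bar> k * R ^ k / fact k)" for k
  proof -
    have "\<bar>a k\<bar> * \<bar>hermite v x k\<bar> \<le> (C * R ^ k) * hermite (- \<bar>v\<bar>) \<bar>x\<bar> k"
      by (intro mult_mono assms abs_hermite_le) (use assms in auto)
    thus ?thesis by (simp add: abs_mult divide_right_mono mult_ac)
  qed
  show ?th1
    by (rule summable_comparison_test'[OF sums_summable[OF s], of 0]) (use le in auto)
  show ?th2
    unfolding sums_unique[OF s] by (intro suminf_le le \<open>?th1\<close> sums_summable[OF s])
qed

lemma hermite_series_bound:
  assumes "R \<ge> 0" "C \<ge> 0" "\<And>k. \<bar>a k\<bar> \<le> C * R ^ k"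
  shows "\<bar>hermite_series a v x\<bar> \<le> C * exp (R * \<bar>x\<bar> + R\<^sup>2 * \<bar>v\<bar> / 2)"
  unfolding hermite_series_def
  by (rule order_trans[OF summable_rabs[OF hermite_series_summable(1)[OF assms]] hermite_series_summable(2)[OF assms]])

text \<open>Exponential moments of both signs suffice, since exp (r |u|) is at most exp (r u) + exp
  (- r u).\<close>

lemma integrable_exp_abs:
  fixes U Y :: "'a \<Rightarrow> real"
  assumes [measurable]: "U \<in> borel_measurable M"
    and int: "\<And>t. integrable M (\<lambda>\<omega>. Y \<omega> * exp (t * U \<omega>))"
  shows "integrable M (\<lambda>\<omega>. \<bar>Y \<omega>\<bar> * exp (r * \<bar>U \<omega>\<bar>))"
proof -
  have [measurable]: "Y \<in> borel_measurable M" using int[of 0] by (auto dest: borel_measurable_integrable)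
  show ?thesis
  proof (rule Bochner_Integration.integrable_bound)
    show "integrable M (\<lambda>\<omega>. \<bar>Y \<omega> * exp (r * U \<omega>)\<bar> + \<bar>Y \<omega> * exp ((- r) * U \<omega>)\<bar>)"
      by (rule Bochner_Integration.integrable_add[OF integrable_abs[OF int[of r]] integrable_abs[OF int[of "- r"]]])
    show "AE \<omega> in M. norm (\<bar>Y \<omega>\<bar> * exp (r * \<bar>U \<omega>\<bar>)) \<le>
        norm (\<bar>Y \<omega> * exp (r * U \<omega>)\<bar> + \<bar>Y \<omega> * exp ((- r) * U \<omega>)\<bar>)"
    proof (intro AE_I2)
      fix \<omega>
      have "exp (r * \<bar>U \<omega>\<bar>) \<le> exp (r * U \<omega>) + exp ((- r) * U \<omega>)"
        by (cases "U \<omega> \<ge> 0") (auto simp: abs_if)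
      from mult_left_mono[OF this, of "\<bar>Y \<omega>\<bar>"]
      show "norm (\<bar>Y \<omega>\<bar> * exp (r * \<bar>U \<omega>\<bar>)) \<le>
        norm (\<bar>Y \<omega> * exp (r * U \<omega>)\<bar> + \<bar>Y \<omega> * exp ((- r) * U \<omega>)\<bar>)"
        by (simp add: abs_mult distrib_left)
    qed
  qed measurable
qed

text \<open>The bound for the absolute series is exponential in |U|, hence integrable against |Y|,
  and sum and integral may be exchanged.\<close>

lemma hermite_series_integral:
  assumes U[measurable]: "U \<in> borel_measurable M"
    and int: "\<And>t. integrable M (\<lambda>\<omega>. Y \<omega> * exp (t * U \<omega>))"
    and a: "geom_bounded a"
  shows "(\<lambda>k. a k * (\<integral>\<omega>. Y \<omega> * hermite v (U \<omega>) k \<partial>M) / fact k) sums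
      (\<integral>\<omega>. Y \<omega> * hermite_series a v (U \<omega>) \<partial>M)"
proof -
  have Y[measurable]: "Y \<in> borel_measurable M" using int[of 0] by (auto dest: borel_measurable_integrable)
  have bd: "integrable M (\<lambda>\<omega>. \<bar>Y \<omega>\<bar> * (C * exp (R * \<bar>U \<omega>\<bar> + R\<^sup>2 * \<bar>v\<bar> / 2)))" for C R
  proof -
    have eq: "(\<lambda>\<omega>. \<bar>Y \<omega>\<bar> * (C * exp (R * \<bar>U \<omega>\<bar> + R\<^sup>2 * \<bar>v\<bar> / 2))) =
        (\<lambda>\<omega>. (\<bar>Y \<omega>\<bar> * exp (R * \<bar>U \<omega>\<bar>)) * (C * exp (R\<^sup>2 * \<bar>v\<bar> / 2)))"
      by (simp add: exp_add mult_ac)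
    have "integrable M (\<lambda>\<omega>. \<bar>Y \<omega>\<bar> * exp (R * \<bar>U \<omega>\<bar>))" by (rule integrable_exp_abs[OF U int])
    hence "integrable M (\<lambda>\<omega>. (\<bar>Y \<omega>\<bar> * exp (R * \<bar>U \<omega>\<bar>)) * (C * exp (R\<^sup>2 * \<bar>v\<bar> / 2)))"
      by (rule integrable_mult_left)
    thus ?thesis unfolding eq .
  qed
  \<comment> \<open>A single Hermite polynomial divided by k! is one term of the absolute series
    with all coefficients 1, so the bound with C = R = 1 applies.\<close>
  have int_single: "integrable M (\<lambda>\<omega>. Y \<omega> * hermite v (U \<omega>) k)" for k
  proof (rule Bochner_Integration.integrable_bound[OF bd[of "fact k" 1]])
    show "AE \<omega> in M. norm (Y \<omega> * hermite v (U \<omega>) k) \<le>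
        norm (\<bar>Y \<omega>\<bar> * (fact k * exp (1 * \<bar>U \<omega>\<bar> + 1\<^sup>2 * \<bar>v\<bar> / 2)))"
    proof (intro AE_I2)
      fix \<omega>
      have "\<bar>hermite v (U \<omega>) k\<bar> / fact k \<le> (\<Sum>j. \<bar>1 * hermite v (U \<omega>) j / fact j\<bar>)"
        using sum_le_suminf[OF hermite_series_summable(1)[of 1 1 "\<lambda>_. 1" v "U \<omega>"], of "{k}"] by simp
      also have "\<dots> \<le> 1 * exp (1 * \<bar>U \<omega>\<bar> + 1\<^sup>2 * \<bar>v\<bar> / 2)"
        by (rule hermite_series_summable(2)) auto
      finally have "\<bar>hermite v (U \<omega>) k\<bar> \<le> fact k * exp (1 * \<bar>U \<omega>\<bar> + 1\<^sup>2 * \<bar>v\<bar> / 2)"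
        by (simp add: field_simps)
      from mult_left_mono[OF this, of "\<bar>Y \<omega>\<bar>"]
      show "norm (Y \<omega> * hermite v (U \<omega>) k) \<le>
        norm (\<bar>Y \<omega>\<bar> * (fact k * exp (1 * \<bar>U \<omega>\<bar> + 1\<^sup>2 * \<bar>v\<bar> / 2)))" by (simp add: abs_mult)
    qed
  qed measurable
  obtain C R where 1: "C \<ge> 0" "R \<ge> 0" "\<And>k. \<bar>a k\<bar> \<le> C * R ^ k" using a by (rule geom_boundedE) blast
  let ?f = "\<lambda>k \<omega>. Y \<omega> * (a k * hermite v (U \<omega>) k / fact k)"
  have intf: "integrable M (?f k)" for k
    using integrable_mult_left[OF int_single[of k], of "a k / fact k"] by (simp add: mult_ac)
  have absf: "norm (?f k \<omega>) = \<bar>Y \<omega>\<bar> * \<bar>a k * hermite v (U \<omega>) k / fact k\<bar>" for k \<omega>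
    by (simp add: abs_mult)
  have summ: "summable (\<lambda>k. norm (?f k \<omega>))" for \<omega>
    unfolding absf by (intro summable_mult hermite_series_summable(1)[OF 1(2,1,3)])
  have "summable (\<lambda>k. \<integral>\<omega>. norm (?f k \<omega>) \<partial>M)"
  proof (rule summableI_nonneg_bounded)
    fix n
    have "(\<Sum>k<n. \<integral>\<omega>. norm (?f k \<omega>) \<partial>M) = (\<integral>\<omega>. (\<Sum>k<n. norm (?f k \<omega>)) \<partial>M)"
      by (intro Bochner_Integration.integral_sum[symmetric] integrable_norm intf)
    also have "\<dots> \<le> (\<integral>\<omega>. \<bar>Y \<omega>\<bar> * (C * exp (R * \<bar>U \<omega>\<bar> + R\<^sup>2 * \<bar>v\<bar> / 2)) \<partial>M)"
    proof (rule integral_mono)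
      fix \<omega>
      have "(\<Sum>k<n. norm (?f k \<omega>)) = \<bar>Y \<omega>\<bar> * (\<Sum>k<n. \<bar>a k * hermite v (U \<omega>) k / fact k\<bar>)"
        unfolding absf by (simp add: sum_distrib_left)
      also have "\<dots> \<le> \<bar>Y \<omega>\<bar> * (\<Sum>k. \<bar>a k * hermite v (U \<omega>) k / fact k\<bar>)"
        by (intro mult_left_mono sum_le_suminf hermite_series_summable(1)[OF 1(2,1,3)]) auto
      also have "\<dots> \<le> \<bar>Y \<omega>\<bar> * (C * exp (R * \<bar>U \<omega>\<bar> + R\<^sup>2 * \<bar>v\<bar> / 2))"
        by (intro mult_left_mono hermite_series_summable(2)[OF 1(2,1,3)]) auto
      finally show "(\<Sum>k<n. norm (?f k \<omega>)) \<le> \<bar>Y \<omega>\<bar> * (C * exp (R * \<bar>U \<omega>\<bar> + R\<^sup>2 * \<bar>v\<bar> / 2))" .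
    qed (intro Bochner_Integration.integrable_sum integrable_norm intf bd)+
    finally show "(\<Sum>k<n. \<integral>\<omega>. norm (?f k \<omega>) \<partial>M) \<le> (\<integral>\<omega>. \<bar>Y \<omega>\<bar> * (C * exp (R * \<bar>U \<omega>\<bar> + R\<^sup>2 * \<bar>v\<bar> / 2)) \<partial>M)" .
  qed simp
  note * = sums_integral[OF intf _ this]
  have eq: "(\<Sum>k. ?f k \<omega>) = Y \<omega> * hermite_series a v (U \<omega>)" for \<omega>
    unfolding hermite_series_def
    by (rule suminf_mult[OF summable_rabs_cancel[OF hermite_series_summable(1)[OF 1(2,1,3)]]])
  have "(\<integral>\<omega>. ?f k \<omega> \<partial>M) = a k * (\<integral>\<omega>. Y \<omega> * hermite v (U \<omega>) k \<partial>M) / fact k" for k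
  proof -
    have "?f k = (\<lambda>\<omega>. (a k / fact k) * (Y \<omega> * hermite v (U \<omega>) k))" by (simp add: fun_eq_iff)
    thus ?thesis by simp
  qed
  moreover have "(\<lambda>k. \<integral>\<omega>. ?f k \<omega> \<partial>M) sums (\<integral>\<omega>. Y \<omega> * hermite_series a v (U \<omega>) \<partial>M)"
    using * summ unfolding eq by blast
  ultimately show "(\<lambda>k. a k * (\<integral>\<omega>. Y \<omega> * hermite v (U \<omega>) k \<partial>M) / fact k) sums
      (\<integral>\<omega>. Y \<omega> * hermite_series a v (U \<omega>) \<partial>M)" by (simp only:)
qed

text \<open>Comparing coefficients of the generating function \<open>exp (t x - t\<^sup>2 v / 2)\<close> replaces
  all explicit computations with Hermite polynomials.\<close>

lemma hermite_series_expectation: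
  assumes U[measurable]: "U \<in> borel_measurable M"
    and int: "\<And>t. integrable M (\<lambda>\<omega>. Y \<omega> * exp (t * U \<omega>))"
    and b: "\<And>t. (\<lambda>k. b k * t ^ k / fact k) sums (\<integral>\<omega>. Y \<omega> * exp (t * U \<omega> - t\<^sup>2 * v / 2) \<partial>M)"
    and a: "geom_bounded a"
  shows "(\<lambda>k. a k * b k / fact k) sums (\<integral>\<omega>. Y \<omega> * hermite_series a v (U \<omega>) \<partial>M)"
proof -
  have "(\<lambda>k. (\<integral>\<omega>. Y \<omega> * hermite v (U \<omega>) k \<partial>M)) = b"
  proof (rule powser_coeff_unique[OF _ b])
    fix t :: real
    \<comment> \<open>The coefficients t^k give back the generating function, so the integrals
      against single Hermite polynomials are the Taylor coefficients of the function of t in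
      \<open>b\<close>.\<close>
    have gb: "geom_bounded (\<lambda>k. t ^ k)"
      unfolding geom_bounded_def by (intro exI[of _ 1] exI[of _ "\<bar>t\<bar>"]) (auto simp: power_abs)
    have "hermite_series (\<lambda>k. t ^ k) v x = exp (t * x - t\<^sup>2 * v / 2)" for x
      using sums_unique[OF hermite_sums[of v x t]] by (simp add: hermite_series_def mult.commute)
    with hermite_series_integral[OF U int gb, of v]
    show "(\<lambda>k. (\<integral>\<omega>. Y \<omega> * hermite v (U \<omega>) k \<partial>M) * t ^ k / fact k) sums (\<integral>\<omega>. Y \<omega> * exp (t * U \<omega> - t\<^sup>2 * v / 2) \<partial>M)"
      by (simp add: mult.commute)
  qed
  hence "(\<integral>\<omega>. Y \<omega> * hermite v (U \<omega>) k \<partial>M) = b k" for k by (rule fun_cong)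
  with hermite_series_integral[OF U int a, of v] show ?thesis by simp
qed

subsection \<open>Averages over a grid\<close>

abbreviation unit_leb :: "real measure" where "unit_leb \<equiv> lebesgue_on {0..1}"

interpretation unit_leb: finite_measure unit_leb
  by (rule finite_measureI) (simp add: emeasure_restrict_space)

lemma measurable_unit_leb: "f \<in> borel_measurable borel \<Longrightarrow> f \<in> borel_measurable unit_leb" for f :: "real \<Rightarrow> real"
  by (intro measurable_restrict_space1 measurable_completion) simp

lemma indicator_Ioc_measurable [measurable]:
  "(indicator {s<..t} :: real \<Rightarrow> real) \<in> borel_measurable unit_leb"
  by (rule measurable_unit_leb) measurable

lemma integral_unit_leb_indicator:
  assumes "0 \<le> s" "s \<le> t" "t \<le> 1"
  shows "(\<integral>x. indicator {s<..t} x \<partial>unit_leb) = t - s"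
proof -
  have "(\<integral>x. indicator {s<..t} x \<partial>unit_leb) = measure unit_leb {s<..t}"
  proof -
    have "{s<..t} \<inter> {0..1} = {s<..t}" using assms by auto
    thus ?thesis by simp
  qed
  also have "\<dots> = measure lebesgue {s<..t}" using assms by (intro measure_restrict_space) auto
  finally show ?thesis using assms by simp
qed

lemma AE_unit_leb_nonzero: "AE x in unit_leb. x \<noteq> 0"
proof -
  have "AE x in lebesgue. x \<noteq> (0::real)"
    by (rule AE_completion) (rule AE_lborel_singleton)
  thus ?thesis by (subst AE_restrict_space_iff) (auto elim: AE_mp)
qed

section \<open>Averages and covariances on a single interval\<close>

lemma integral_unit_leb_FTC:
  fixes F f :: "real \<Rightarrow> real"
  assumes "0 \<le> s" "s \<le> t" "t \<le> 1" and F: "\<And>x. (F has_real_derivative f x) (at x)" and f: "continuous_on UNIV f"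
  shows "(\<integral>x. f x * indicator {s<..t} x \<partial>unit_leb) = F t - F s"
proof -
  have [measurable]: "f \<in> borel_measurable borel" using f by (rule borel_measurable_continuous_onI)
  have "(\<integral>x. f x * indicator {s<..t} x \<partial>unit_leb) = (\<integral>x. indicator {0..1} x *\<^sub>R (f x * indicator {s<..t} x) \<partial>lebesgue)"
    by (rule integral_restrict_space) simp
  also have "\<dots> = (\<integral>x. indicator {0..1} x *\<^sub>R (f x * indicator {s<..t} x) \<partial>lborel)"
    by (rule integral_completion) measurable
  also have "\<dots> = (\<integral>x. f x * indicator {s..t} x \<partial>lborel)"
  proof (rule integral_cong_AE)
    show "AE x in lborel. indicator {0..1} x *\<^sub>R (f x * indicator {s<..t} x) = f x * indicator {s..t} x"
      using AE_lborel_singleton[of s] by eventually_elim (use assms in \<open>auto simp: indicator_def\<close>)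
  qed measurable
  also have "\<dots> = F t - F s"
    by (rule integral_FTC_Icc_real[OF assms(2)]) (use F f in \<open>auto simp: continuous_on_eq_continuous_at\<close>)
  finally show ?thesis .
qed

text \<open>Origin of the constant 1/12: the uniform distribution on an interval of length h has
  variance h^2 / 12.\<close>

lemma integral_centered_square:
  assumes "0 \<le> l" "h \<ge> 0" "l + h \<le> 1"
  shows "(\<integral>x. (x - (l + h / 2))\<^sup>2 * indicator {l<..l + h} x \<partial>unit_leb) = h ^ 3 / 12"
proof -
  have "(\<integral>x. (x - (l + h / 2))\<^sup>2 * indicator {l<..l + h} x \<partial>unit_leb) =
     (l + h - (l + h / 2)) ^ 3 / 3 - (l - (l + h / 2)) ^ 3 / 3"
    by (rule integral_unit_leb_FTC) (use assms in \<open>auto intro!: derivative_eq_intros continuous_intros\<close>)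
  also have "\<dots> = h ^ 3 / 12" by (simp add: field_simps power3_eq_cube)
  finally show ?thesis .
qed

lemma integral_centered:
  assumes "0 \<le> l" "h \<ge> 0" "l + h \<le> 1"
  shows "(\<integral>x. (x - l) * indicator {l<..l + h} x \<partial>unit_leb) = h\<^sup>2 / 2"
proof -
  have "(\<integral>x. (x - l) * indicator {l<..l + h} x \<partial>unit_leb) = (l + h - l)\<^sup>2 / 2 - (l - l)\<^sup>2 / 2"
    by (rule integral_unit_leb_FTC) (use assms in \<open>auto intro!: derivative_eq_intros continuous_intros\<close>)
  thus ?thesis by simp
qed

lemma abs_integral_indicator_le:
  assumes "0 \<le> s" "s \<le> t" "t \<le> 1" "integrable unit_leb (\<lambda>x. u x * indicator {s<..t} x)"
    "\<And>x. s < x \<Longrightarrow> x \<le> t \<Longrightarrow> \<bar>u x\<bar> \<le> B"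
  shows "\<bar>\<integral>x. u x * indicator {s<..t} x \<partial>unit_leb\<bar> \<le> B * (t - s)"
proof -
  have "\<bar>\<integral>x. u x * indicator {s<..t} x \<partial>unit_leb\<bar> \<le> (\<integral>x. \<bar>u x * indicator {s<..t} x\<bar> \<partial>unit_leb)"
    by (rule integral_abs_bound)
  also have "\<dots> \<le> (\<integral>x. B * indicator {s<..t} x \<partial>unit_leb)"
  proof (rule integral_mono)
    show "integrable unit_leb (\<lambda>x. B * indicator {s<..t} x)"
      by (rule unit_leb.integrable_const_bound[of _ "\<bar>B\<bar>"], (auto simp: indicator_def)[1], measurable)
    show "integrable unit_leb (\<lambda>x. \<bar>u x * indicator {s<..t} x\<bar>)" by (rule integrable_abs[OF assms(4)])
  qed (use assms(5) in \<open>auto simp: indicator_def\<close>)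
  finally show ?thesis using integral_unit_leb_indicator[OF assms(1-3)] by simp
qed

text \<open>After subtraction of a line of slope d the derivative is at most w in absolute value, so
  the rest \<open>u\<close> is at most w h. The same holds for its average, whence the factor 2. The
  line minus its own average is d times the signed distance to the midpoint.\<close>

lemma interval_deviation:
  fixes f f' :: "real \<Rightarrow> real"
  assumes l: "0 \<le> l" "0 < h" "l + h \<le> 1"
    and f: "\<And>s. s \<in> {0..1} \<Longrightarrow> (f has_real_derivative f' s) (at s within {0..1})"
    and fm: "f \<in> borel_measurable unit_leb"
    and w: "\<And>s. s \<in> {l..l + h} \<Longrightarrow> \<bar>f' s - d\<bar> \<le> w"
    and s: "l < s" "s \<le> l + h"
  shows "\<bar>f s - (\<integral>x. f x * indicator {l<..l + h} x \<partial>unit_leb) / h - d * (s - (l + h / 2))\<bar> \<le> 2 * w * h"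
proof -
  note [measurable] = fm
  define u where "u x = f x - f l - d * (x - l)" for x
  have u: "\<bar>u x\<bar> \<le> w * h" if "x \<in> {l..l + h}" for x
  proof -
    have "norm (u x - u l) \<le> w * norm (x - l)"
    proof (rule field_differentiable_bound[of "{l..l + h}" u "\<lambda>s. f' s - d"])
      fix z assume z: "z \<in> {l..l + h}"
      have "(f has_real_derivative f' z) (at z within {l..l + h})"
        by (rule DERIV_subset[OF f]) (use z l in auto)
      thus "(u has_real_derivative f' z - d) (at z within {l..l + h})"
        unfolding u_def by (auto intro!: derivative_eq_intros)
    qed (use w that l in auto)
    also have "\<dots> \<le> w * h" using that w[of l] l by (intro mult_left_mono) auto
    finally show ?thesis by (simp add: u_def)
  qed
  have [measurable]: "(\<lambda>x. x) \<in> borel_measurable unit_leb" by (rule measurable_unit_leb) simp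
  have um[measurable]: "u \<in> borel_measurable unit_leb" unfolding u_def by measurable
  have iu: "integrable unit_leb (\<lambda>x. u x * indicator {l<..l + h} x)"
    by (rule unit_leb.integrable_const_bound[of _ "\<bar>w * h\<bar>"], rule AE_I2)
       (use order_trans[OF u abs_ge_self] in \<open>auto simp: indicator_def abs_mult\<close>)
  have i1: "integrable unit_leb (\<lambda>x. f l * indicator {l<..l + h} x)"
    by (rule unit_leb.integrable_const_bound[of _ "\<bar>f l\<bar>"]) (auto simp: indicator_def)
  have i2: "integrable unit_leb (\<lambda>x. d * ((x - l) * indicator {l<..l + h} x))"
    by (rule integrable_mult_right, rule unit_leb.integrable_const_bound[of _ h], rule AE_I2)
       (use l in \<open>auto simp: indicator_def\<close>)
  have "(\<lambda>x. f x * indicator {l<..l + h} x) =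
      (\<lambda>x. u x * indicator {l<..l + h} x + f l * indicator {l<..l + h} x + d * ((x - l) * indicator {l<..l + h} x))"
    by (simp add: fun_eq_iff u_def algebra_simps)
  hence "(\<integral>x. f x * indicator {l<..l + h} x \<partial>unit_leb) =
      (\<integral>x. u x * indicator {l<..l + h} x \<partial>unit_leb) + f l * h + d * (h\<^sup>2 / 2)"
    using iu i1 i2 integral_unit_leb_indicator[of l "l + h"] integral_centered[of l h] l by simp
  hence av: "(\<integral>x. f x * indicator {l<..l + h} x \<partial>unit_leb) / h =
      (\<integral>x. u x * indicator {l<..l + h} x \<partial>unit_leb) / h + f l + d * (h / 2)"
    using l by (simp add: field_simps power2_eq_square)
  have "\<bar>\<integral>x. u x * indicator {l<..l + h} x \<partial>unit_leb\<bar> \<le> (w * h) * (l + h - l)"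
    by (rule abs_integral_indicator_le) (use l iu u in auto)
  hence "\<bar>(\<integral>x. u x * indicator {l<..l + h} x \<partial>unit_leb) / h\<bar> \<le> w * h"
    using l by (simp add: field_simps abs_div)
  moreover have "\<bar>u s\<bar> \<le> w * h" using s by (intro u) auto
  moreover have "f s = u s + f l + d * (s - l)" by (simp add: u_def)
  moreover have "d * (s - l) - d * (h / 2) = d * (s - (l + h / 2))" by (simp add: algebra_simps)
  ultimately show ?thesis unfolding av by linarith
qed

text \<open>On a short interval both functions are almost linear with slopes f'(l) and g'(l), and
  the product of the centred lines integrates to f'(l) g'(l) h^3 / 12. The factor 10 is 9 for this
  linearisation plus 1 for replacing f' g' by its value at l.\<close>

lemma interval_covariance:
  fixes f f' g g' :: "real \<Rightarrow> real"
  assumes l: "0 \<le> l" "0 < h" "l + h \<le> 1"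
    and f: "\<And>s. s \<in> {0..1} \<Longrightarrow> (f has_real_derivative f' s) (at s within {0..1})"
    and g: "\<And>s. s \<in> {0..1} \<Longrightarrow> (g has_real_derivative g' s) (at s within {0..1})"
    and m: "f \<in> borel_measurable unit_leb" "g \<in> borel_measurable unit_leb"
      "f' \<in> borel_measurable unit_leb" "g' \<in> borel_measurable unit_leb"
    and K: "\<And>s. s \<in> {0..1} \<Longrightarrow> \<bar>f' s\<bar> \<le> K" "\<And>s. s \<in> {0..1} \<Longrightarrow> \<bar>g' s\<bar> \<le> K"
    and w: "\<And>s. s \<in> {l..l + h} \<Longrightarrow> \<bar>f' s - f' l\<bar> \<le> w" "\<And>s. s \<in> {l..l + h} \<Longrightarrow> \<bar>g' s - g' l\<bar> \<le> v"
    and wK: "w \<le> 2 * K"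
  shows "\<bar>(\<integral>x. (f x - (\<integral>x. f x * indicator {l<..l + h} x \<partial>unit_leb) / h) *
        (g x - (\<integral>x. g x * indicator {l<..l + h} x \<partial>unit_leb) / h) * indicator {l<..l + h} x \<partial>unit_leb) -
     h\<^sup>2 / 12 * (\<integral>x. f' x * g' x * indicator {l<..l + h} x \<partial>unit_leb)\<bar> \<le> 10 * K * (w + v) * h ^ 3"
proof -
  note [measurable] = m
  define af ag where "af = (\<integral>x. f x * indicator {l<..l + h} x \<partial>unit_leb) / h"
    and "ag = (\<integral>x. g x * indicator {l<..l + h} x \<partial>unit_leb) / h"
  define d e where "d = f' l" and "e = g' l"
  let ?I = "indicator {l<..l + h} :: real \<Rightarrow> real"
  have K0: "0 \<le> K" using K(1)[of 0] by simp
  have w0: "0 \<le> w" "0 \<le> v" using w(1)[of l] w(2)[of l] l by auto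
  have de: "\<bar>d\<bar> \<le> K" "\<bar>e\<bar> \<le> K" using K l by (auto simp: d_def e_def)
  define q where "q x = x - (l + h / 2)" for x
  have [measurable]: "q \<in> borel_measurable unit_leb" unfolding q_def by (rule measurable_unit_leb) measurable
  have qb: "\<bar>q x\<bar> \<le> h / 2" if "l < x" "x \<le> l + h" for x using that by (auto simp: q_def abs_if)
  define Qf Qg where "Qf x = f x - af - d * q x" and "Qg x = g x - ag - e * q x" for x
  have Qfb: "\<bar>Qf x\<bar> \<le> 2 * w * h" if "l < x" "x \<le> l + h" for x
    unfolding Qf_def af_def q_def by (rule interval_deviation[OF l f m(1)]) (use w that in \<open>auto simp: d_def\<close>)
  have Qgb: "\<bar>Qg x\<bar> \<le> 2 * v * h" if "l < x" "x \<le> l + h" for x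
    unfolding Qg_def ag_def q_def by (rule interval_deviation[OF l g m(2)]) (use w that in \<open>auto simp: e_def\<close>)
  have bf: "\<bar>f x - af\<bar> \<le> K * h / 2 + 2 * w * h" if "l < x" "x \<le> l + h" for x
  proof -
    have "\<bar>d * q x\<bar> \<le> K * (h / 2)" unfolding abs_mult by (intro mult_mono de qb that) (use K0 in auto)
    with Qfb[OF that] show ?thesis unfolding Qf_def by linarith
  qed
  have bg: "\<bar>g x - ag\<bar> \<le> K * h / 2 + 2 * v * h" if "l < x" "x \<le> l + h" for x
  proof -
    have "\<bar>e * q x\<bar> \<le> K * (h / 2)" unfolding abs_mult by (intro mult_mono de qb that) (use K0 in auto)
    with Qgb[OF that] show ?thesis unfolding Qg_def by linarith
  qed
  have i1: "integrable unit_leb (\<lambda>x. (f x - af) * (g x - ag) * ?I x)"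
  proof (rule unit_leb.integrable_const_bound[of _ "(K * h / 2 + 2 * w * h) * (K * h / 2 + 2 * v * h)"], rule AE_I2)
    fix x
    have nn: "0 \<le> K * h / 2 + 2 * w * h" "0 \<le> K * h / 2 + 2 * v * h" using K0 w0 l by auto
    show "norm ((f x - af) * (g x - ag) * ?I x) \<le> (K * h / 2 + 2 * w * h) * (K * h / 2 + 2 * v * h)"
      using mult_mono[OF bf bg nn(1) abs_ge_zero, of x x] mult_nonneg_nonneg[OF nn] by (auto simp: indicator_def abs_mult)
  qed measurable
  have i2: "integrable unit_leb (\<lambda>x. (q x)\<^sup>2 * ?I x)"
  proof (rule unit_leb.integrable_const_bound[of _ "(h / 2)\<^sup>2"], rule AE_I2)
    fix x show "norm ((q x)\<^sup>2 * ?I x) \<le> (h / 2)\<^sup>2"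
      using power_mono[OF qb abs_ge_zero, of x 2] by (auto simp: indicator_def)
  qed measurable
  have bnd: "\<bar>(f x - af) * (g x - ag) - d * e * (q x)\<^sup>2\<bar> \<le> 9 * K * (w + v) * h\<^sup>2" if x: "l < x" "x \<le> l + h" for x
  proof -
    have "(f x - af) * (g x - ag) - d * e * (q x)\<^sup>2 = d * q x * Qg x + Qf x * (e * q x) + Qf x * Qg x"
      by (simp add: Qf_def Qg_def algebra_simps power2_eq_square)
    moreover have "\<bar>d * q x * Qg x\<bar> \<le> K * (h / 2) * (2 * v * h)"
      unfolding abs_mult by (intro mult_mono de qb Qgb x) (use K0 w0 l in auto)
    moreover have "\<bar>Qf x * (e * q x)\<bar> \<le> (2 * w * h) * (K * (h / 2))"
      unfolding abs_mult by (intro mult_mono de qb Qfb x) (use K0 w0 l in auto)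
    \<comment> \<open>The product of the two errors is quadratic in the oscillations. Replacing w by
      2 K through \<open>wK\<close> keeps the bound linear, so that it can be summed over the
      grid.\<close>
    moreover have "\<bar>Qf x * Qg x\<bar> \<le> (2 * (2 * K) * h) * (2 * v * h)"
      unfolding abs_mult
      by (intro mult_mono Qgb x order_trans[OF Qfb[OF x]] mult_right_mono mult_left_mono wK) (use K0 w0 l in auto)
    moreover have "K * (h / 2) * (2 * v * h) + (2 * w * h) * (K * (h / 2)) + (2 * (2 * K) * h) * (2 * v * h) \<le> 9 * K * (w + v) * h\<^sup>2"
    proof -
      have "0 \<le> 8 * (K * w * h\<^sup>2)" using K0 w0 by simp
      moreover have "9 * K * (w + v) * h\<^sup>2 = K * (h / 2) * (2 * v * h) + (2 * w * h) * (K * (h / 2)) + (2 * (2 * K) * h) * (2 * v * h) + 8 * (K * w * h\<^sup>2)"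
        by (simp add: power2_eq_square algebra_simps)
      ultimately show ?thesis by linarith
    qed
    ultimately show ?thesis by linarith
  qed
  have bnd': "\<bar>f' x * g' x - d * e\<bar> \<le> K * (w + v)" if x: "l < x" "x \<le> l + h" for x
  proof -
    have "f' x * g' x - d * e = (f' x - d) * g' x + d * (g' x - e)" by (simp add: algebra_simps)
    moreover have "\<bar>(f' x - d) * g' x\<bar> \<le> w * K"
      unfolding abs_mult d_def by (intro mult_mono w K) (use K0 w0 l x in auto)
    moreover have "\<bar>d * (g' x - e)\<bar> \<le> K * v"
      unfolding abs_mult e_def by (intro mult_mono w de) (use K0 w0 l x in auto)
    ultimately show ?thesis by (simp add: algebra_simps)
  qed
  have i3: "integrable unit_leb (\<lambda>x. f' x * g' x * ?I x)"
  proof (rule unit_leb.integrable_const_bound[of _ "K * K"], rule AE_I2)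
    fix x show "norm (f' x * g' x * ?I x) \<le> K * K"
      using mult_mono[OF K(1)[of x] K(2)[of x] K0 abs_ge_zero] mult_nonneg_nonneg[OF K0 K0] l
      by (auto simp: indicator_def abs_mult)
  qed measurable
  have i4: "integrable unit_leb (\<lambda>x. ?I x)"
    by (rule unit_leb.integrable_const_bound[of _ 1], (auto simp: indicator_def)[1], measurable)
  have "(\<integral>x. ((f x - af) * (g x - ag) - d * e * (q x)\<^sup>2) * ?I x \<partial>unit_leb) =
      (\<integral>x. (f x - af) * (g x - ag) * ?I x - d * e * ((q x)\<^sup>2 * ?I x) \<partial>unit_leb)"
    by (rule Bochner_Integration.integral_cong) (auto simp: algebra_simps)
  also have "\<dots> = (\<integral>x. (f x - af) * (g x - ag) * ?I x \<partial>unit_leb) - d * e * (\<integral>x. (q x)\<^sup>2 * ?I x \<partial>unit_leb)"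
    using i1 i2 by simp
  also have "(\<integral>x. (q x)\<^sup>2 * ?I x \<partial>unit_leb) = h ^ 3 / 12"
    unfolding q_def using integral_centered_square[of l h] l by simp
  finally have e1: "(\<integral>x. (f x - af) * (g x - ag) * ?I x \<partial>unit_leb) - d * e * (h ^ 3 / 12) =
     (\<integral>x. ((f x - af) * (g x - ag) - d * e * (q x)\<^sup>2) * ?I x \<partial>unit_leb)" by simp
  have "\<bar>\<integral>x. ((f x - af) * (g x - ag) - d * e * (q x)\<^sup>2) * ?I x \<partial>unit_leb\<bar> \<le> (9 * K * (w + v) * h\<^sup>2) * (l + h - l)"
  proof (rule abs_integral_indicator_le)
    have "integrable unit_leb (\<lambda>x. (f x - af) * (g x - ag) * ?I x - d * e * ((q x)\<^sup>2 * ?I x))"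
      using i1 i2 by auto
    thus "integrable unit_leb (\<lambda>x. ((f x - af) * (g x - ag) - d * e * (q x)\<^sup>2) * ?I x)"
      by (simp add: left_diff_distrib mult.assoc)
  qed (use l bnd in auto)
  hence r1: "\<bar>(\<integral>x. (f x - af) * (g x - ag) * ?I x \<partial>unit_leb) - d * e * (h ^ 3 / 12)\<bar> \<le> 9 * K * (w + v) * h ^ 3"
    unfolding e1 by (simp add: power2_eq_square power3_eq_cube mult_ac)
  have "(\<integral>x. (f' x * g' x - d * e) * ?I x \<partial>unit_leb) = (\<integral>x. f' x * g' x * ?I x - d * e * ?I x \<partial>unit_leb)"
    by (simp add: left_diff_distrib)
  also have "\<dots> = (\<integral>x. f' x * g' x * ?I x \<partial>unit_leb) - d * e * (\<integral>x. ?I x \<partial>unit_leb)"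
    using i3 i4 by (simp del: integral_indicator)
  also have "(\<integral>x. ?I x \<partial>unit_leb) = h"
    using integral_unit_leb_indicator[of l "l + h"] l by simp
  finally have e2: "(\<integral>x. f' x * g' x * ?I x \<partial>unit_leb) - d * e * h = (\<integral>x. (f' x * g' x - d * e) * ?I x \<partial>unit_leb)" by simp
  have "\<bar>\<integral>x. (f' x * g' x - d * e) * ?I x \<partial>unit_leb\<bar> \<le> (K * (w + v)) * (l + h - l)"
  proof (rule abs_integral_indicator_le)
    have "integrable unit_leb (\<lambda>x. f' x * g' x * ?I x - d * e * ?I x)"
      using i3 i4 by auto
    thus "integrable unit_leb (\<lambda>x. (f' x * g' x - d * e) * ?I x)"
      by (simp add: left_diff_distrib)
  qed (use l bnd' in auto)
  hence r2: "\<bar>(\<integral>x. f' x * g' x * ?I x \<partial>unit_leb) - d * e * h\<bar> \<le> K * (w + v) * h" unfolding e2 by simp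
  have "h\<^sup>2 / 12 * \<bar>(\<integral>x. f' x * g' x * ?I x \<partial>unit_leb) - d * e * h\<bar> \<le> h\<^sup>2 / 12 * (K * (w + v) * h)"
    by (intro mult_left_mono r2) auto
  hence "\<bar>h\<^sup>2 / 12 * (\<integral>x. f' x * g' x * ?I x \<partial>unit_leb) - d * e * (h ^ 3 / 12)\<bar> \<le> h\<^sup>2 / 12 * (K * (w + v) * h)"
  proof -
    have "\<bar>h\<^sup>2 / 12 * (\<integral>x. f' x * g' x * ?I x \<partial>unit_leb) - d * e * (h ^ 3 / 12)\<bar> =
      \<bar>h\<^sup>2 / 12 * ((\<integral>x. f' x * g' x * ?I x \<partial>unit_leb) - d * e * h)\<bar>"
      by (simp add: algebra_simps power2_eq_square power3_eq_cube)
    also have "\<dots> = h\<^sup>2 / 12 * \<bar>(\<integral>x. f' x * g' x * ?I x \<partial>unit_leb) - d * e * h\<bar>"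
      by (simp add: abs_mult)
    finally show ?thesis using \<open>h\<^sup>2 / 12 * \<bar>_\<bar> \<le> _\<close> by simp
  qed
  moreover have "h\<^sup>2 / 12 * (K * (w + v) * h) \<le> K * (w + v) * h ^ 3"
  proof -
    have "0 \<le> K * (w + v) * h ^ 3" using K0 w0 l by simp
    thus ?thesis by (simp add: power2_eq_square power3_eq_cube field_simps)
  qed
  moreover have "10 * K * (w + v) * h ^ 3 = 9 * K * (w + v) * h ^ 3 + K * (w + v) * h ^ 3" by simp
  ultimately show ?thesis using r1 unfolding af_def[symmetric] ag_def[symmetric] by linarith
qed

section \<open>Derivatives of bounded variation: oscillation, boundedness, measurability\<close>

lemma bounded_variation_on_oscillation:
  assumes "bounded_variation_on 0 1 u"
  shows "\<exists>V. \<forall>n>0. \<exists>w. (\<forall>i<n. \<forall>s\<in>{real i / real n..real (Suc i) / real n}.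
      \<bar>u s - u (real i / real n)\<bar> \<le> w i) \<and> (\<Sum>i<n. w i) \<le> V"
proof -
  obtain C where C: "\<And>N t. mono_on {..N} t \<Longrightarrow> t ` {..N} \<subseteq> {0..1} \<Longrightarrow>
        (\<Sum>i<N. \<bar>u (t (Suc i)) - u (t i)\<bar>) \<le> C"
    using assms unfolding bounded_variation_on_def by metis
  \<comment> \<open>On each grid interval a point is chosen whose deviation from the value at the
    left end is at least half of every other deviation there. The chain through left ends and chosen
    points has variation at most C, whence 2 C.\<close>
  have "\<exists>w. (\<forall>i<n. \<forall>s\<in>{real i / real n..real (Suc i) / real n}.
      \<bar>u s - u (real i / real n)\<bar> \<le> w i) \<and> (\<Sum>i<n. w i) \<le> 2 * C" if n: "n > 0" for n
  proof -
    define I where "I i = {real i / real n..real (Suc i) / real n}" for i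
    have ne: "real i / real n \<in> I i" for i using n by (simp add: I_def divide_right_mono)
    have unit: "I i \<subseteq> {0..1}" if "i < n" for i
    proof
      fix s assume "s \<in> I i"
      hence "0 \<le> real i / real n" "real i / real n \<le> s" "s \<le> real (Suc i) / real n" by (auto simp: I_def)
      moreover have "real (Suc i) / real n \<le> 1" using that n by (simp add: divide_le_eq del: of_nat_Suc)
      ultimately show "s \<in> {0..1}" unfolding atLeastAtMost_iff by linarith
    qed
    \<comment> \<open>Without such a point some deviation would be positive and could be doubled
      again and again, against the bound C for every deviation.\<close>
    have "\<exists>x\<in>I i. \<forall>s\<in>I i. \<bar>u s - u (real i / real n)\<bar> \<le> 2 * \<bar>u x - u (real i / real n)\<bar>" if i: "i < n" for i
    proof (rule ccontr)
      assume "\<not> ?thesis"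
      hence ex: "\<And>x. x \<in> I i \<Longrightarrow> \<exists>s\<in>I i. \<bar>u s - u (real i / real n)\<bar> > 2 * \<bar>u x - u (real i / real n)\<bar>" by force
      then obtain s0 where s0: "s0 \<in> I i" "\<bar>u s0 - u (real i / real n)\<bar> > 0" using ne[of i] by fastforce
      define c where "c = \<bar>u s0 - u (real i / real n)\<bar>"
      have "\<exists>s\<in>I i. \<bar>u s - u (real i / real n)\<bar> \<ge> 2 ^ k * c" for k
      proof (induction k)
        case 0 show ?case using s0 by (auto simp: c_def)
      next
        case (Suc k)
        then obtain s where s: "s \<in> I i" "\<bar>u s - u (real i / real n)\<bar> \<ge> 2 ^ k * c" by blast
        then obtain s' where "s' \<in> I i" "\<bar>u s' - u (real i / real n)\<bar> > 2 * \<bar>u s - u (real i / real n)\<bar>" using ex by blast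
        with s show ?case by (intro bexI[of _ s']) auto
      qed
      moreover have "\<bar>u s - u (real i / real n)\<bar> \<le> C" if "s \<in> I i" for s
      proof -
        have sI: "s \<in> {0..1}" "real i / real n \<in> {0..1}" using unit[OF i] ne[of i] that by auto
        have "(\<Sum>j<1. \<bar>u ((\<lambda>j. if j = (0::nat) then real i / real n else s) (Suc j)) - u ((\<lambda>j. if j = 0 then real i / real n else s) j)\<bar>) \<le> C"
          by (rule C) (use sI that in \<open>auto simp: mono_on_def I_def\<close>)
        thus ?thesis by simp
      qed
      ultimately have le: "2 ^ k * c \<le> C" for k by (meson order_trans)
      have "c > 0" using s0 by (simp add: c_def)
      obtain k where "C / c < 2 ^ k" using real_arch_pow[of 2 "C / c"] by auto
      with le[of k] \<open>c > 0\<close> show False by (simp add: field_simps)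
    qed
    then obtain x where x: "\<And>i. i < n \<Longrightarrow> x i \<in> I i"
      "\<And>i s. i < n \<Longrightarrow> s \<in> I i \<Longrightarrow> \<bar>u s - u (real i / real n)\<bar> \<le> 2 * \<bar>u (x i) - u (real i / real n)\<bar>"
      by metis
    \<comment> \<open>Even indices run through the grid points, odd ones through the chosen points.
      Beyond the last interval an odd index repeats the grid point, which keeps \<open>t\<close>
      monotone everywhere.\<close>
    define t where "t j = (if even j then real (j div 2) / real n else if j div 2 < n then x (j div 2) else real (j div 2) / real n)" for j
    have t_even: "t (2 * i) = real i / real n" for i by (simp add: t_def)
    have t_odd: "t (Suc (2 * i)) = x i" if "i < n" for i using that by (simp add: t_def)
    have "t j \<le> t (Suc j)" for j
    proof (cases "even j")
      case True
      then obtain i where "j = 2 * i" by (auto elim: evenE)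
      thus ?thesis using x(1)[of i] by (auto simp: t_def I_def)
    next
      case False
      then obtain i where "j = Suc (2 * i)" by (auto elim: oddE)
      thus ?thesis using x(1)[of i] n by (auto simp: t_def I_def divide_right_mono)
    qed
    hence mono: "mono t" by (simp add: mono_iff_le_Suc)
    have "(\<Sum>i<2 * n. \<bar>u (t (Suc i)) - u (t i)\<bar>) \<le> C"
    proof (rule C)
      show "mono_on {..2 * n} t" using mono by (auto simp: mono_on_def mono_def)
      have "t 0 = 0" "t (2 * n) = 1" using n t_even[of n] by (auto simp: t_def)
      thus "t ` {..2 * n} \<subseteq> {0..1}" using monoD[OF mono, of 0] monoD[OF mono, of _ "2 * n"] by fastforce
    qed
    moreover have "(\<Sum>i<2 * m. \<bar>u (t (Suc i)) - u (t i)\<bar>) \<ge> (\<Sum>i<m. \<bar>u (x i) - u (real i / real n)\<bar>)" if "m \<le> n" for m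
      using that
    proof (induction m)
      case (Suc m)
      have "(\<Sum>i<2 * Suc m. \<bar>u (t (Suc i)) - u (t i)\<bar>) = (\<Sum>i<2 * m. \<bar>u (t (Suc i)) - u (t i)\<bar>) +
          \<bar>u (x m) - u (real m / real n)\<bar> + \<bar>u (t (Suc (Suc (2 * m)))) - u (t (Suc (2 * m)))\<bar>"
        using Suc t_even[of m] t_odd[of m] by simp
      with Suc show ?case by simp
    qed simp
    ultimately have "(\<Sum>i<n. \<bar>u (x i) - u (real i / real n)\<bar>) \<le> C" by (meson order_trans order_refl)
    hence "(\<Sum>i<n. 2 * \<bar>u (x i) - u (real i / real n)\<bar>) \<le> 2 * C" by (simp add: sum_distrib_left[symmetric])
    thus ?thesis using x(2) unfolding I_def
      by (intro exI[of _ "\<lambda>i. 2 * \<bar>u (x i) - u (real i / real n)\<bar>"]) auto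
  qed
  thus ?thesis by blast
qed

text \<open>The case of a single grid interval, [0, 1] itself.\<close>

lemma bounded_variation_on_bounded:
  assumes "bounded_variation_on 0 1 u"
  obtains K where "\<And>s. s \<in> {0..1} \<Longrightarrow> \<bar>u s\<bar> \<le> K"
proof -
  obtain V where V: "\<forall>n>0. \<exists>w. (\<forall>i<n. \<forall>s\<in>{real i / real n..real (Suc i) / real n}.
      \<bar>u s - u (real i / real n)\<bar> \<le> w i) \<and> (\<Sum>i<n. w i) \<le> V"
    using bounded_variation_on_oscillation[OF assms] by blast
  then obtain w where w: "\<forall>i<1. \<forall>s\<in>{real i / real 1..real (Suc i) / real 1}.
      \<bar>u s - u (real i / real 1)\<bar> \<le> w i" "(\<Sum>i<(1::nat). w i) \<le> V" by (metis zero_less_one)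
  have "\<bar>u s\<bar> \<le> \<bar>u 0\<bar> + V" if "s \<in> {0..1}" for s
  proof -
    have "\<bar>u s - u 0\<bar> \<le> V" using w that by force
    thus ?thesis by linarith
  qed
  thus ?thesis using that by blast
qed

lemma BV_derivative_continuous: "BV_derivative f f' \<Longrightarrow> continuous_on {0..1} f"
  unfolding BV_derivative_def continuous_on_eq_continuous_within by (blast intro: DERIV_continuous)

lemma BV_derivative_measurable: "BV_derivative f f' \<Longrightarrow> f \<in> borel_measurable unit_leb"
  unfolding BV_derivative_def square_integrable_def by blast

text \<open>A derivative is a pointwise limit of measurable difference quotients.\<close>

lemma derivative_measurable:
  fixes f f' :: "real \<Rightarrow> real"
  assumes f: "\<And>s. s \<in> {0..1} \<Longrightarrow> (f has_real_derivative f' s) (at s within {0..1})"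
  shows "f' \<in> borel_measurable unit_leb"
proof -
  have cont: "continuous_on {0..1} f"
    unfolding continuous_on_eq_continuous_within using f by (blast intro: DERIV_continuous)
  \<comment> \<open>The second point moves from s towards 1 and so never leaves [0, 1], where alone
    f is controlled.\<close>
  define y where "y n s = s + (1 - s) / real (n + 2)" for n s
  have yI: "y n s \<in> {0..1}" if "s \<in> {0..1}" for n s
  proof -
    have "0 \<le> (1 - s) / real (n + 2)" using that by (intro divide_nonneg_nonneg) auto
    moreover have "(1 - s) / real (n + 2) \<le> (1 - s) / 1" using that by (intro divide_left_mono) auto
    ultimately show ?thesis using that by (auto simp: y_def)
  qed
  have m: "f \<in> borel_measurable unit_leb"
    by (rule continuous_imp_measurable_on_sets_lebesgue[OF cont]) simp
  have my: "(\<lambda>s. f (y n s)) \<in> borel_measurable unit_leb" for n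
  proof (rule continuous_imp_measurable_on_sets_lebesgue)
    show "continuous_on {0..1} (\<lambda>s. f (y n s))"
      by (rule continuous_on_compose2[OF cont]) (use yI in \<open>auto simp: y_def intro!: continuous_intros\<close>)
  qed simp
  \<comment> \<open>At s = 1 the two points coincide and the quotient 0 / 0 is 0; the value
    \<open>f' 1\<close> is put back by an indicator.\<close>
  define g where "g s = (if s = 1 then 0 else f' s)" for s
  have "g \<in> borel_measurable unit_leb"
  proof (rule borel_measurable_LIMSEQ_real)
    fix s assume "s \<in> space unit_leb"
    hence s: "s \<in> {0..1}" by simp
    show "(\<lambda>n. (f (y n s) - f s) / ((1 - s) / real (n + 2))) \<longlonglongrightarrow> g s"
    proof (cases "s = 1")
      case False
      with s have s1: "s < 1" by auto
      have lim: "((\<lambda>x. (f x - f s) / (x - s)) \<longlongrightarrow> f' s) (at s within {0..1})"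
        using f[OF s] by (simp add: has_field_derivative_iff)
      have "(\<lambda>n. y n s) \<longlonglongrightarrow> s + 0"
        unfolding y_def
        by (intro tendsto_intros LIMSEQ_ignore_initial_segment[OF lim_const_over_n])
      hence "filterlim (\<lambda>n. y n s) (at s within {0..1}) sequentially"
        unfolding filterlim_at using yI[OF s] s1 by (auto simp: y_def)
      from filterlim_compose[OF lim this] show ?thesis using False by (simp add: g_def y_def)
    qed (simp add: g_def)
  next
    fix n
    have "(\<lambda>s. (1 - s) / real (n + 2)) \<in> borel_measurable unit_leb"
      by (rule measurable_unit_leb) measurable
    thus "(\<lambda>s. (f (y n s) - f s) / ((1 - s) / real (n + 2))) \<in> borel_measurable unit_leb"
      by (rule borel_measurable_divide[OF borel_measurable_diff[OF my m]])
  qed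
  moreover have "(\<lambda>s::real. indicator {1} s * f' 1) \<in> borel_measurable unit_leb"
    by (rule measurable_unit_leb) measurable
  ultimately have "(\<lambda>s. g s + indicator {1} s * f' 1) \<in> borel_measurable unit_leb" by (rule borel_measurable_add)
  also have "(\<lambda>s. g s + indicator {1} s * f' 1) = f'" by (auto simp: g_def indicator_def)
  finally show ?thesis .
qed

section \<open>Inner products and projection onto the step functions of a grid\<close>

definition L2_inner :: "(real \<Rightarrow> real) \<Rightarrow> (real \<Rightarrow> real) \<Rightarrow> real" where
  "L2_inner f g = (\<integral>s. f s * g s \<partial>unit_leb)"

abbreviation L2_unit :: "(real \<Rightarrow> real) \<Rightarrow> bool" where
  "L2_unit \<equiv> square_integrable unit_leb"

lemma L2_inner_commute: "L2_inner f g = L2_inner g f"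
  by (simp add: L2_inner_def mult.commute)

lemma L2_inner_add_left: "L2_unit f \<Longrightarrow> L2_unit g \<Longrightarrow> L2_unit h \<Longrightarrow> L2_inner (\<lambda>s. f s + g s) h = L2_inner f h + L2_inner g h"
  by (simp add: L2_inner_def distrib_right square_integrable_mult_integrable)

lemma L2_inner_scale_left: "L2_inner (\<lambda>s. c * f s) h = c * L2_inner f h"
  by (simp add: L2_inner_def mult.assoc)

lemma L2_inner_diff_left: "L2_unit f \<Longrightarrow> L2_unit g \<Longrightarrow> L2_unit h \<Longrightarrow> L2_inner (\<lambda>s. f s - g s) h = L2_inner f h - L2_inner g h"
  by (simp add: L2_inner_def left_diff_distrib square_integrable_mult_integrable)

lemma L2_inner_add_right: "L2_unit f \<Longrightarrow> L2_unit g \<Longrightarrow> L2_unit h \<Longrightarrow> L2_inner h (\<lambda>s. f s + g s) = L2_inner h f + L2_inner h g"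
  by (simp add: L2_inner_commute[of h] L2_inner_add_left)

lemma L2_inner_scale_right: "L2_inner h (\<lambda>s. c * f s) = c * L2_inner h f"
  by (simp add: L2_inner_commute[of h] L2_inner_scale_left)

lemma L2_inner_diff_right: "L2_unit f \<Longrightarrow> L2_unit g \<Longrightarrow> L2_unit h \<Longrightarrow> L2_inner h (\<lambda>s. f s - g s) = L2_inner h f - L2_inner h g"
  by (simp add: L2_inner_commute[of h] L2_inner_diff_left)

lemma L2_inner_sum_left: "(\<And>i. i \<in> I \<Longrightarrow> L2_unit (f i)) \<Longrightarrow> L2_unit h \<Longrightarrow> L2_inner (\<lambda>s. \<Sum>i\<in>I. f i s) h = (\<Sum>i\<in>I. L2_inner (f i) h)"
  by (simp add: L2_inner_def sum_distrib_right square_integrable_mult_integrable)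

lemma L2_unit_indicator: "L2_unit (indicator {s<..t})"
  by (rule unit_leb.bounded_square_integrable[OF indicator_Ioc_measurable, where B = 1]) (auto simp: indicator_def)

text \<open>Left-open intervals fit the increments of W and are disjoint; they miss the point 0. For
  n = 0 the interval is empty, since division by zero gives 0 at both ends.\<close>

definition grid_ind :: "nat \<Rightarrow> nat \<Rightarrow> real \<Rightarrow> real" where
  "grid_ind n i = indicator {real i / real n<..real (Suc i) / real n}"

definition grid_avg :: "nat \<Rightarrow> (real \<Rightarrow> real) \<Rightarrow> nat \<Rightarrow> real" where
  "grid_avg n f i = real n * L2_inner f (grid_ind n i)"

text \<open>For f in L2 this is the orthogonal projection onto the step functions of the
  grid.\<close>

definition grid_proj :: "nat \<Rightarrow> (real \<Rightarrow> real) \<Rightarrow> real \<Rightarrow> real" where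
  "grid_proj n f s = (\<Sum>i<n. grid_avg n f i * grid_ind n i s)"

lemma L2_unit_grid_ind: "L2_unit (grid_ind n i)"
  unfolding grid_ind_def by (rule L2_unit_indicator)

lemma L2_unit_grid_proj: "L2_unit (grid_proj n f)"
  unfolding grid_proj_def[abs_def]
  by (intro square_integrable_sum square_integrable_scale L2_unit_grid_ind)

lemma grid_ind_disjoint:
  assumes "i \<noteq> j"
  shows "grid_ind n i s * grid_ind n j s = 0"
proof (cases "n = 0")
  case False
  have False if "real i / real n < s" "s \<le> real (Suc i) / real n" "real j / real n < s" "s \<le> real (Suc j) / real n"
  proof -
    have "real i < s * real n" "s * real n \<le> real (Suc i)" "real j < s * real n" "s * real n \<le> real (Suc j)"
      using that False by (auto simp: field_simps)
    thus False using assms by linarith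
  qed
  thus ?thesis by (auto simp: grid_ind_def indicator_def)
qed (simp add: grid_ind_def)

lemma grid_ind_idem: "grid_ind n i s * grid_ind n i s = grid_ind n i s"
  by (simp add: grid_ind_def indicator_def)

lemma sum_grid_ind_lessThan: "(\<Sum>i<m. grid_ind n i s) = indicator {0<..real m / real n} s"
proof (induction m)
  case (Suc m)
  have "real m / real n \<le> real (Suc m) / real n" by (auto simp: divide_right_mono)
  moreover have "0 < s" if "real m / real n < s" by (rule le_less_trans[OF _ that]) simp
  ultimately show ?case using Suc by (auto simp: grid_ind_def indicator_def)
qed simp

lemma sum_grid_ind:
  assumes "n > 0" "s \<in> {0..1}" "s \<noteq> 0"
  shows "(\<Sum>i<n. grid_ind n i s) = 1"
  using assms by (simp add: sum_grid_ind_lessThan)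

lemma L2_inner_grid_ind:
  assumes "i < n" "j < n"
  shows "L2_inner (grid_ind n i) (grid_ind n j) = (if i = j then 1 / real n else 0)"
proof (cases "i = j")
  case True
  have "real (Suc i) / real n \<le> 1" using assms by (simp add: divide_le_eq del: of_nat_Suc)
  moreover have "real i / real n \<le> real (Suc i) / real n" by (rule divide_right_mono) auto
  ultimately have "(\<integral>x. indicator {real i / real n<..real (Suc i) / real n} x \<partial>unit_leb) = real (Suc i) / real n - real i / real n"
    by (intro integral_unit_leb_indicator) auto
  also have "\<dots> = 1 / real n" by (simp add: diff_divide_distrib[symmetric])
  finally show ?thesis using True by (simp only: L2_inner_def grid_ind_idem) (simp only: grid_ind_def simp_thms if_True)
next
  case False
  thus ?thesis by (simp add: L2_inner_def grid_ind_disjoint)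
qed

lemma L2_inner_grid_proj_ind:
  assumes "i < n"
  shows "L2_inner (grid_proj n f) (grid_ind n i) = L2_inner f (grid_ind n i)"
proof -
  have "L2_inner (grid_proj n f) (grid_ind n i) = (\<Sum>j<n. grid_avg n f j * L2_inner (grid_ind n j) (grid_ind n i))"
    unfolding grid_proj_def[abs_def]
    by (subst L2_inner_sum_left) (auto simp: L2_inner_scale_left L2_unit_grid_ind intro!: square_integrable_scale)
  also have "\<dots> = (\<Sum>j<n. if j = i then grid_avg n f j / real n else 0)"
    by (intro sum.cong refl) (use assms in \<open>auto simp: L2_inner_grid_ind\<close>)
  also have "\<dots> = L2_inner f (grid_ind n i)" using assms by (simp add: grid_avg_def)
  finally show ?thesis .
qed

lemma L2_inner_grid_step:
  assumes "L2_unit f"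
  shows "L2_inner (grid_proj n f) (\<lambda>s. \<Sum>i<n. c i * grid_ind n i s) = L2_inner f (\<lambda>s. \<Sum>i<n. c i * grid_ind n i s)"
proof -
  have *: "L2_inner g (\<lambda>s. \<Sum>i<n. c i * grid_ind n i s) = (\<Sum>i<n. c i * L2_inner g (grid_ind n i))" if "L2_unit g" for g
    by (subst (1 2) L2_inner_commute, subst L2_inner_sum_left)
       (auto simp: L2_inner_scale_left L2_unit_grid_ind that intro!: square_integrable_scale)
  show ?thesis unfolding *[OF assms] *[OF L2_unit_grid_proj]
    by (intro sum.cong refl) (simp add: L2_inner_grid_proj_ind)
qed

text \<open>The projected g is a step function, so the part of f orthogonal to the grid does not
  contribute.\<close>

lemma L2_inner_grid_proj:
  assumes "L2_unit f"
  shows "L2_inner f (grid_proj n g) = L2_inner (grid_proj n f) (grid_proj n g)"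
  unfolding grid_proj_def[of n g, abs_def] by (rule L2_inner_grid_step[OF assms, symmetric])

text \<open>Pythagoras in polarised form. It turns a difference of inner products into a covariance
  that can be estimated interval by interval.\<close>

lemma L2_inner_grid_residual:
  assumes "L2_unit f" "L2_unit g"
  shows "L2_inner (\<lambda>s. f s - grid_proj n f s) (\<lambda>s. g s - grid_proj n g s) =
     L2_inner f g - L2_inner (grid_proj n f) (grid_proj n g)"
proof -
  have "L2_inner (grid_proj n f) g = L2_inner (grid_proj n f) (grid_proj n g)"
    using L2_inner_grid_proj[OF assms(2), of n f] by (simp add: L2_inner_commute)
  thus ?thesis using L2_inner_grid_proj[OF assms(1), of n g]
    by (simp add: L2_inner_diff_left L2_inner_diff_right assms L2_unit_grid_proj square_integrable_diff)
qed

lemma integral_grid_decompose: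
  assumes "n > 0" "integrable unit_leb u"
  shows "(\<integral>s. u s \<partial>unit_leb) = (\<Sum>i<n. \<integral>s. u s * grid_ind n i s \<partial>unit_leb)"
proof -
  have i: "integrable unit_leb (\<lambda>s. u s * grid_ind n i s)" for i
  proof (rule Bochner_Integration.integrable_bound[OF assms(2)])
    show "(\<lambda>s. u s * grid_ind n i s) \<in> borel_measurable unit_leb"
      by (intro borel_measurable_times borel_measurable_integrable[OF assms(2)]
          square_integrable_measurable[OF L2_unit_grid_ind])
  qed (auto simp: grid_ind_def indicator_def)
  have "(\<integral>s. u s \<partial>unit_leb) = (\<integral>s. (\<Sum>i<n. u s * grid_ind n i s) \<partial>unit_leb)"
  proof (rule integral_cong_AE)
    \<comment> \<open>Only the point 0 lies in none of the grid intervals.\<close>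
    show "AE s in unit_leb. u s = (\<Sum>i<n. u s * grid_ind n i s)"
      using AE_unit_leb_nonzero AE_space
    proof eventually_elim
      case (elim s)
      thus ?case using sum_grid_ind[OF assms(1), of s] by (simp add: sum_distrib_left[symmetric])
    qed
  qed (use assms(2) i in \<open>auto dest: borel_measurable_integrable\<close>)
  thus ?thesis using i by simp
qed

text \<open>Continuity of \<open>f'\<close> is not needed: the oscillations of \<open>f'\<close> over the grid intervals add up to at most
  a multiple of its variation, which gives an error of order \<open>1 / n\<close>.\<close>

theorem grid_residual_limit:
  assumes f: "BV_derivative f f'" and g: "BV_derivative g g'"
  shows "(\<lambda>n. (real n)\<^sup>2 * (L2_inner f g - L2_inner (grid_proj n f) (grid_proj n g))) \<longlonglongrightarrow> L2_inner f' g' / 12"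
proof -
  have fd: "\<And>s. s \<in> {0..1} \<Longrightarrow> (f has_real_derivative f' s) (at s within {0..1})"
   and gd: "\<And>s. s \<in> {0..1} \<Longrightarrow> (g has_real_derivative g' s) (at s within {0..1})"
   and bv: "bounded_variation_on 0 1 f'" "bounded_variation_on 0 1 g'"
   and L2: "L2_unit f" "L2_unit g" using f g by (auto simp: BV_derivative_def)
  note m = BV_derivative_measurable[OF f] BV_derivative_measurable[OF g] derivative_measurable[OF fd] derivative_measurable[OF gd]
  obtain K1 where K1: "\<And>s. s \<in> {0..1} \<Longrightarrow> \<bar>f' s\<bar> \<le> K1" using bounded_variation_on_bounded[OF bv(1)] by blast
  obtain K2 where K2: "\<And>s. s \<in> {0..1} \<Longrightarrow> \<bar>g' s\<bar> \<le> K2" using bounded_variation_on_bounded[OF bv(2)] by blast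
  define K where "K = max K1 K2"
  have K: "\<And>s. s \<in> {0..1} \<Longrightarrow> \<bar>f' s\<bar> \<le> K" "\<And>s. s \<in> {0..1} \<Longrightarrow> \<bar>g' s\<bar> \<le> K"
    using K1 K2 by (auto simp: K_def le_max_iff_disj)
  have K0: "0 \<le> K" using K(1)[of 0] by simp
  obtain V1 where V1: "\<forall>n>0. \<exists>w. (\<forall>i<n. \<forall>s\<in>{real i / real n..real (Suc i) / real n}.
      \<bar>f' s - f' (real i / real n)\<bar> \<le> w i) \<and> (\<Sum>i<n. w i) \<le> V1"
    using bounded_variation_on_oscillation[OF bv(1)] by blast
  obtain V2 where V2: "\<forall>n>0. \<exists>w. (\<forall>i<n. \<forall>s\<in>{real i / real n..real (Suc i) / real n}.
      \<bar>g' s - g' (real i / real n)\<bar> \<le> w i) \<and> (\<Sum>i<n. w i) \<le> V2"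
    using bounded_variation_on_oscillation[OF bv(2)] by blast
  have L2': "L2_unit f'" "L2_unit g'" using m K by (auto intro!: unit_leb.bounded_square_integrable[of _ K])
  define r where "r n = (real n)\<^sup>2 * (L2_inner f g - L2_inner (grid_proj n f) (grid_proj n g)) - L2_inner f' g' / 12" for n
  \<comment> \<open>With h = 1 / n an interval contributes at most a multiple of h^3 times its
    oscillations. These sum to at most V1 + V2, and n^2 h^3 = 1 / n.\<close>
  have bound: "\<bar>r n\<bar> \<le> 10 * K * (V1 + V2) / real n" if n: "n > 0" for n
  proof -
    obtain w where w: "\<And>i s. i < n \<Longrightarrow> s \<in> {real i / real n..real (Suc i) / real n} \<Longrightarrow> \<bar>f' s - f' (real i / real n)\<bar> \<le> w i"
      "(\<Sum>i<n. w i) \<le> V1" using V1[rule_format, OF n] by blast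
    obtain v where v: "\<And>i s. i < n \<Longrightarrow> s \<in> {real i / real n..real (Suc i) / real n} \<Longrightarrow> \<bar>g' s - g' (real i / real n)\<bar> \<le> v i"
      "(\<Sum>i<n. v i) \<le> V2" using V2[rule_format, OF n] by blast
    \<comment> \<open>Capped at 2 K, as \<open>interval_covariance\<close> demands; the cap is valid
      because |f'| is at most K.\<close>
    define w' where "w' i = min (w i) (2 * K)" for i
    define h where "h = 1 / real n"
    have h: "h > 0" using n by (simp add: h_def)
    let ?F = "\<lambda>s. f s - grid_proj n f s" and ?G = "\<lambda>s. g s - grid_proj n g s"
    have L2r: "L2_unit ?F" "L2_unit ?G" by (intro square_integrable_diff L2 L2_unit_grid_proj)+
    have e1: "L2_inner f g - L2_inner (grid_proj n f) (grid_proj n g) = (\<Sum>i<n. \<integral>s. ?F s * ?G s * grid_ind n i s \<partial>unit_leb)"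
    proof -
      have "L2_inner ?F ?G = (\<Sum>i<n. \<integral>s. ?F s * ?G s * grid_ind n i s \<partial>unit_leb)"
        unfolding L2_inner_def
        by (rule integral_grid_decompose[OF n square_integrable_mult_integrable[OF L2r]])
      thus ?thesis unfolding L2_inner_grid_residual[OF L2] .
    qed
    have e2: "L2_inner f' g' = (\<Sum>i<n. \<integral>s. f' s * g' s * grid_ind n i s \<partial>unit_leb)"
      unfolding L2_inner_def
      by (rule integral_grid_decompose[OF n square_integrable_mult_integrable[OF L2']])
    have loc: "grid_proj n u s * grid_ind n i s = grid_avg n u i * grid_ind n i s" if "i < n" for u s i
    proof -
      have "grid_proj n u s * grid_ind n i s = (\<Sum>j<n. grid_avg n u j * (grid_ind n j s * grid_ind n i s))"
        by (simp add: grid_proj_def sum_distrib_right mult.assoc)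
      also have "\<dots> = (\<Sum>j<n. if j = i then grid_avg n u j * grid_ind n i s else 0)"
        by (intro sum.cong refl) (auto simp: grid_ind_disjoint grid_ind_idem)
      finally show ?thesis using that by simp
    qed
    have each: "\<bar>(\<integral>s. ?F s * ?G s * grid_ind n i s \<partial>unit_leb) - h\<^sup>2 / 12 * (\<integral>s. f' s * g' s * grid_ind n i s \<partial>unit_leb)\<bar>
        \<le> 10 * K * (w' i + v i) * h ^ 3" if i: "i < n" for i
    proof -
      define l where "l = real i / real n"
      have lh: "l + h = real (Suc i) / real n" by (simp add: l_def h_def add_divide_distrib)
      have l: "0 \<le> l" "0 < h" "l + h \<le> 1" using h i n unfolding lh
        by (auto simp: l_def divide_le_eq simp del: of_nat_Suc)
      have ind: "grid_ind n i = indicator {l<..l + h}" unfolding grid_ind_def lh by (simp add: l_def)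
      have av: "grid_avg n u i = (\<integral>x. u x * indicator {l<..l + h} x \<partial>unit_leb) / h" for u
        unfolding grid_avg_def L2_inner_def ind by (simp add: h_def)
      have "(\<lambda>s. ?F s * ?G s * grid_ind n i s) = (\<lambda>s. (f s - grid_avg n f i) * (g s - grid_avg n g i) * grid_ind n i s)"
      proof
        fix s
        have "?F s * ?G s * grid_ind n i s = (?F s * grid_ind n i s) * (?G s * grid_ind n i s)"
          by (simp add: grid_ind_def indicator_def)
        also have "\<dots> = ((f s - grid_avg n f i) * grid_ind n i s) * ((g s - grid_avg n g i) * grid_ind n i s)"
          unfolding left_diff_distrib loc[OF i] ..
        also have "\<dots> = (f s - grid_avg n f i) * (g s - grid_avg n g i) * grid_ind n i s"
          by (simp add: grid_ind_def indicator_def)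
        finally show "?F s * ?G s * grid_ind n i s = (f s - grid_avg n f i) * (g s - grid_avg n g i) * grid_ind n i s" .
      qed
      hence eq: "(\<integral>s. ?F s * ?G s * grid_ind n i s \<partial>unit_leb) =
          (\<integral>s. (f s - grid_avg n f i) * (g s - grid_avg n g i) * grid_ind n i s \<partial>unit_leb)" by simp
      have wi: "\<bar>f' s - f' l\<bar> \<le> w' i" if "s \<in> {l..l + h}" for s
      proof -
        have "\<bar>f' s - f' l\<bar> \<le> 2 * K" using K(1)[of s] K(1)[of l] that l by auto
        with w(1)[OF i, of s] that show ?thesis unfolding lh by (simp add: w'_def l_def)
      qed
      show ?thesis unfolding eq unfolding av unfolding ind
        by (rule interval_covariance[OF l fd gd m K]) (use wi v(1)[OF i] lh in \<open>auto simp: w'_def l_def\<close>)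
    qed
    have "r n = (real n)\<^sup>2 * (\<Sum>i<n. (\<integral>s. ?F s * ?G s * grid_ind n i s \<partial>unit_leb) - h\<^sup>2 / 12 * (\<integral>s. f' s * g' s * grid_ind n i s \<partial>unit_leb))"
    proof -
      have "(real n)\<^sup>2 * (h\<^sup>2 / 12 * x) = x / 12" for x using n by (simp add: h_def power_divide)
      thus ?thesis unfolding r_def e1 e2 sum_subtractf sum_distrib_left[symmetric]
        by (simp add: right_diff_distrib)
    qed
    hence "\<bar>r n\<bar> = (real n)\<^sup>2 * \<bar>\<Sum>i<n. (\<integral>s. ?F s * ?G s * grid_ind n i s \<partial>unit_leb) - h\<^sup>2 / 12 * (\<integral>s. f' s * g' s * grid_ind n i s \<partial>unit_leb)\<bar>"
      by (simp add: abs_mult)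
    also have "\<dots> \<le> (real n)\<^sup>2 * (\<Sum>i<n. 10 * K * (w' i + v i) * h ^ 3)"
      by (intro mult_left_mono order_trans[OF sum_abs] sum_mono each) auto
    also have "(\<Sum>i<n. 10 * K * (w' i + v i) * h ^ 3) = 10 * K * h ^ 3 * ((\<Sum>i<n. w' i) + (\<Sum>i<n. v i))"
      by (simp add: sum_distrib_left sum.distrib[symmetric] algebra_simps)
    also have "(real n)\<^sup>2 * \<dots> \<le> (real n)\<^sup>2 * (10 * K * h ^ 3 * (V1 + V2))"
    proof -
      have "(\<Sum>i<n. w' i) \<le> (\<Sum>i<n. w i)" by (intro sum_mono) (simp add: w'_def)
      thus ?thesis using w(2) v(2) K0 h by (intro mult_left_mono) auto
    qed
    also have "\<dots> = 10 * K * (V1 + V2) / real n"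
      using n by (simp add: h_def field_simps power2_eq_square power3_eq_cube)
    finally show ?thesis .
  qed
  have "r \<longlonglongrightarrow> 0"
  proof (rule Lim_null_comparison)
    show "\<forall>\<^sub>F n in sequentially. norm (r n) \<le> 10 * K * (V1 + V2) / real n"
      using eventually_gt_at_top[of 0] by eventually_elim (simp add: bound)
    show "(\<lambda>n. 10 * K * (V1 + V2) / real n) \<longlonglongrightarrow> 0" by (rule lim_const_over_n)
  qed
  thus ?thesis unfolding r_def[abs_def] by (rule LIM_zero_cancel)
qed

subsection \<open>Uniqueness for Laplace transforms\<close>

text \<open>For v = 0 the Hermite polynomials are the monomials. The weighted Laplace transform
  vanishes identically, hence so do all moments and the integrals of power series with geometrically
  bounded coefficients, cosine and sine among them.\<close>

lemma integral_trig_zero: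
  fixes Z X :: "'a \<Rightarrow> real"
  assumes X: "X \<in> borel_measurable M"
    and int: "\<And>t. integrable M (\<lambda>\<omega>. Z \<omega> * exp (t * X \<omega>))"
    and zero: "\<And>t. (\<integral>\<omega>. Z \<omega> * exp (t * X \<omega>) \<partial>M) = 0"
  shows "(\<integral>\<omega>. Z \<omega> * cos (\<theta> * X \<omega>) \<partial>M) = 0" "(\<integral>\<omega>. Z \<omega> * sin (\<theta> * X \<omega>) \<partial>M) = 0"
proof -
  have herm0: "hermite 0 x k = x ^ k" for x k
  proof -
    have "gauss_coeff 0 j = (if j = 0 then 1 else 0)" for j
      by (auto simp: gauss_coeff_def)
    hence "(\<Sum>i\<le>k. x ^ i / fact i * gauss_coeff 0 (k - i)) = (\<Sum>i\<le>k. if i = k then x ^ i / fact i else 0)"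
      by (intro sum.cong refl) auto
    thus ?thesis by (simp add: hermite_def)
  qed
  have z: "(\<integral>\<omega>. Z \<omega> * hermite_series a 0 (X \<omega>) \<partial>M) = 0" if "geom_bounded a" for a
  proof -
    have "(\<lambda>k. a k * 0 / fact k) sums (\<integral>\<omega>. Z \<omega> * hermite_series a 0 (X \<omega>) \<partial>M)"
      by (rule hermite_series_expectation[OF X int _ that]) (simp add: zero)
    thus ?thesis using sums_unique2[OF sums_zero] by fastforce
  qed
  have gb: "geom_bounded (\<lambda>k. fact k * c k * \<theta> ^ k)" if "\<And>k. \<bar>fact k * c k\<bar> \<le> 1" for c :: "nat \<Rightarrow> real"
    unfolding geom_bounded_def
  proof (rule exI[of _ 1], rule exI[of _ "\<bar>\<theta>\<bar>"], intro conjI allI)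
    fix k :: nat
    have "\<bar>fact k * c k\<bar> * \<bar>\<theta>\<bar> ^ k \<le> 1 * \<bar>\<theta>\<bar> ^ k" by (intro mult_right_mono that) auto
    thus "\<bar>fact k * c k * \<theta> ^ k\<bar> \<le> 1 * \<bar>\<theta>\<bar> ^ k" by (simp add: abs_mult power_abs)
  qed simp_all
  have "hermite_series (\<lambda>k. fact k * cos_coeff k * \<theta> ^ k) 0 x = cos (\<theta> * x)" for x
    using sums_unique[OF cos_converges[of "\<theta> * x"]]
    by (simp add: hermite_series_def herm0 power_mult_distrib mult_ac)
  with z[OF gb[of cos_coeff]] show "(\<integral>\<omega>. Z \<omega> * cos (\<theta> * X \<omega>) \<partial>M) = 0"
    by (auto simp: cos_coeff_def abs_mult)
  have "hermite_series (\<lambda>k. fact k * sin_coeff k * \<theta> ^ k) 0 x = sin (\<theta> * x)" for x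
    using sums_unique[OF sin_converges[of "\<theta> * x"]]
    by (simp add: hermite_series_def herm0 power_mult_distrib mult_ac)
  with z[OF gb[of sin_coeff]] show "(\<integral>\<omega>. Z \<omega> * sin (\<theta> * X \<omega>) \<partial>M) = 0"
    by (auto simp: sin_coeff_def abs_mult)
qed

text \<open>The positive and the negative part of Z, normalised to probability densities, push
  forward under X to laws with the same characteristic function.\<close>

lemma laplace_uniqueness:
  fixes Z X :: "'a \<Rightarrow> real"
  assumes X[measurable]: "X \<in> borel_measurable M"
    and int: "\<And>t. integrable M (\<lambda>\<omega>. Z \<omega> * exp (t * X \<omega>))"
    and zero: "\<And>t. (\<integral>\<omega>. Z \<omega> * exp (t * X \<omega>) \<partial>M) = 0"
    and A[measurable]: "A \<in> sets borel"
  shows "(\<integral>\<omega>. Z \<omega> * indicator A (X \<omega>) \<partial>M) = 0"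
proof -
  have iZ: "integrable M Z" using int[of 0] by simp
  have Zm[measurable]: "Z \<in> borel_measurable M" by (rule borel_measurable_integrable[OF iZ])
  define Zp Zn where "Zp \<omega> = max 0 (Z \<omega>)" and "Zn \<omega> = max 0 (- Z \<omega>)" for \<omega>
  have [measurable]: "Zp \<in> borel_measurable M" "Zn \<in> borel_measurable M" unfolding Zp_def Zn_def by measurable
  have nn: "Zp \<omega> \<ge> 0" "Zn \<omega> \<ge> 0" for \<omega> by (auto simp: Zp_def Zn_def)
  have Zd: "Z \<omega> = Zp \<omega> - Zn \<omega>" for \<omega> by (auto simp: Zp_def Zn_def)
  have ip: "integrable M Zp" "integrable M Zn"
    by (rule Bochner_Integration.integrable_bound[OF iZ]; auto simp: Zp_def Zn_def)+
  have mult_int: "integrable M (\<lambda>\<omega>. U \<omega> * u \<omega>)" if "integrable M U" "u \<in> borel_measurable M" "\<And>\<omega>. \<bar>u \<omega>\<bar> \<le> 1" for U u :: "'a \<Rightarrow> real"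
  proof (rule Bochner_Integration.integrable_bound[OF that(1)])
    show "(\<lambda>\<omega>. U \<omega> * u \<omega>) \<in> borel_measurable M" using that(2) borel_measurable_integrable[OF that(1)] by measurable
    show "AE x in M. norm (U x * u x) \<le> norm (U x)"
      using mult_left_mono[OF that(3) abs_ge_zero] by (intro AE_I2) (simp add: abs_mult)
  qed
  have eq: "(\<integral>\<omega>. Zp \<omega> * u \<omega> \<partial>M) = (\<integral>\<omega>. Zn \<omega> * u \<omega> \<partial>M)"
    if "u \<in> borel_measurable M" "\<And>\<omega>. \<bar>u \<omega>\<bar> \<le> 1" "(\<integral>\<omega>. Z \<omega> * u \<omega> \<partial>M) = 0" for u
    using that(3) mult_int[OF ip(1) that(1,2)] mult_int[OF ip(2) that(1,2)]
    unfolding Zd by (simp add: left_diff_distrib)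
  define m where "m = (\<integral>\<omega>. Zp \<omega> \<partial>M)"
  have m2: "(\<integral>\<omega>. Zn \<omega> \<partial>M) = m" using eq[of "\<lambda>_. 1"] zero[of 0] by (simp add: m_def)
  have m0: "m \<ge> 0" unfolding m_def using nn by simp
  show ?thesis
  \<comment> \<open>If the common mass m of the two parts is 0 they cannot be normalised, but then Z
    = 0 almost everywhere.\<close>
  proof (cases "m = 0")
    case True
    have "AE \<omega> in M. Zp \<omega> = 0" "AE \<omega> in M. Zn \<omega> = 0"
      using integral_nonneg_eq_0_iff_AE[OF ip(1)] integral_nonneg_eq_0_iff_AE[OF ip(2)] nn True m2 m_def by auto
    hence "AE \<omega> in M. Z \<omega> * indicator A (X \<omega>) = 0"
      by eventually_elim (simp add: Zd)
    hence "(\<integral>\<omega>. Z \<omega> * indicator A (X \<omega>) \<partial>M) = (\<integral>\<omega>. 0 \<partial>M)" by (intro integral_cong_AE) auto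
    thus ?thesis by simp
  next
    case False
    with m0 have m: "m > 0" by simp
    define \<mu> where "\<mu> U = distr (density M (\<lambda>\<omega>. ennreal (U \<omega> / m))) borel X" for U :: "'a \<Rightarrow> real"
    have dist: "real_distribution (\<mu> U)"
      if U: "integrable M U" "\<And>\<omega>. U \<omega> \<ge> 0" "(\<integral>\<omega>. U \<omega> \<partial>M) = m" for U
    proof -
      note [measurable] = borel_measurable_integrable[OF U(1)]
      have "emeasure (density M (\<lambda>\<omega>. ennreal (U \<omega> / m))) (space M) = (\<integral>\<^sup>+ \<omega>. ennreal (U \<omega> / m) \<partial>M)"
        by (subst emeasure_density) (auto intro!: nn_integral_cong)
      also have "\<dots> = ennreal (\<integral>\<omega>. U \<omega> / m \<partial>M)"
        by (rule nn_integral_eq_integral) (use U m in auto)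
      also have "\<dots> = 1" using U m by simp
      finally have "prob_space (density M (\<lambda>\<omega>. ennreal (U \<omega> / m)))"
        by (intro prob_spaceI) simp
      then interpret D: prob_space "density M (\<lambda>\<omega>. ennreal (U \<omega> / m))" .
      show ?thesis unfolding \<mu>_def by (rule D.real_distribution_distr) measurable
    qed
    have intmu: "(\<integral>x. h x \<partial>\<mu> U) = (\<integral>\<omega>. (U \<omega> / m) *\<^sub>R h (X \<omega>) \<partial>M)"
      if U: "integrable M U" "\<And>\<omega>. U \<omega> \<ge> 0" and h: "h \<in> borel_measurable borel" for U and h :: "real \<Rightarrow> 'b::{banach, second_countable_topology}"
      unfolding \<mu>_def using borel_measurable_integrable[OF U(1)] U(2) h m
      by (subst integral_distr) (auto simp: integral_density)
    have "char (\<mu> U) = (\<lambda>\<theta>. Complex ((\<integral>\<omega>. U \<omega> * cos (\<theta> * X \<omega>) \<partial>M) / m) ((\<integral>\<omega>. U \<omega> * sin (\<theta> * X \<omega>) \<partial>M) / m))"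
      if U: "integrable M U" "\<And>\<omega>. U \<omega> \<ge> 0" for U
    proof
      fix \<theta>
      note [measurable] = borel_measurable_integrable[OF U(1)]
      have ic: "integrable M (\<lambda>\<omega>. U \<omega> * cos (\<theta> * X \<omega>))" "integrable M (\<lambda>\<omega>. U \<omega> * sin (\<theta> * X \<omega>))"
        by (rule mult_int[OF U(1)]; simp)+
      have "char (\<mu> U) \<theta> = (\<integral>\<omega>. (U \<omega> / m) *\<^sub>R iexp (\<theta> * X \<omega>) \<partial>M)"
        unfolding char_def by (rule intmu[OF U]) measurable
      also have "\<dots> = (\<integral>\<omega>. complex_of_real (U \<omega> * cos (\<theta> * X \<omega>) / m) + \<i> * complex_of_real (U \<omega> * sin (\<theta> * X \<omega>) / m) \<partial>M)"
      proof (rule Bochner_Integration.integral_cong[OF refl])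
        fix \<omega>
        have "iexp (\<theta> * X \<omega>) = complex_of_real (cos (\<theta> * X \<omega>)) + \<i> * complex_of_real (sin (\<theta> * X \<omega>))"
          by (simp add: complex_eq_iff Re_exp Im_exp)
        thus "(U \<omega> / m) *\<^sub>R iexp (\<theta> * X \<omega>) = complex_of_real (U \<omega> * cos (\<theta> * X \<omega>) / m) + \<i> * complex_of_real (U \<omega> * sin (\<theta> * X \<omega>) / m)"
          by (simp add: complex_eq_iff)
      qed
      also have "\<dots> = complex_of_real ((\<integral>\<omega>. U \<omega> * cos (\<theta> * X \<omega>) \<partial>M) / m) + \<i> * complex_of_real ((\<integral>\<omega>. U \<omega> * sin (\<theta> * X \<omega>) \<partial>M) / m)"
      proof -
        have 1: "integrable M (\<lambda>\<omega>. complex_of_real (U \<omega> * cos (\<theta> * X \<omega>) / m))"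
          "integrable M (\<lambda>\<omega>. complex_of_real (U \<omega> * sin (\<theta> * X \<omega>) / m))"
          by (rule integrable_of_real, rule integrable_divide_zero, rule ic)+
        show ?thesis
          by (subst Bochner_Integration.integral_add[OF 1(1) integrable_mult_right[OF 1(2)]], subst integral_mult_right_zero)
             (simp only: integral_complex_of_real integral_divide_zero)
      qed
      also have "\<dots> = Complex ((\<integral>\<omega>. U \<omega> * cos (\<theta> * X \<omega>) \<partial>M) / m) ((\<integral>\<omega>. U \<omega> * sin (\<theta> * X \<omega>) \<partial>M) / m)"
        by (simp add: complex_eq_iff)
      finally show "char (\<mu> U) \<theta> = \<dots>" .
    qed
    note ch = this
    have "\<mu> Zp = \<mu> Zn"
    proof (rule Levy_uniqueness)
      show "real_distribution (\<mu> Zp)" by (rule dist) (use ip nn m_def in auto)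
      show "real_distribution (\<mu> Zn)" by (rule dist) (use ip nn m2 in auto)
      have "(\<integral>\<omega>. Zp \<omega> * cos (\<theta> * X \<omega>) \<partial>M) = (\<integral>\<omega>. Zn \<omega> * cos (\<theta> * X \<omega>) \<partial>M)"
        "(\<integral>\<omega>. Zp \<omega> * sin (\<theta> * X \<omega>) \<partial>M) = (\<integral>\<omega>. Zn \<omega> * sin (\<theta> * X \<omega>) \<partial>M)" for \<theta>
        by (rule eq; simp add: integral_trig_zero[OF X int zero])+
      thus "char (\<mu> Zp) = char (\<mu> Zn)" unfolding ch[OF ip(1) nn(1)] ch[OF ip(2) nn(2)] by simp
    qed
    hence "(\<integral>x. indicator A x \<partial>\<mu> Zp) = (\<integral>x. indicator A x \<partial>\<mu> Zn :: real)" by simp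
    hence "(\<integral>\<omega>. Zp \<omega> / m * indicator A (X \<omega>) \<partial>M) = (\<integral>\<omega>. Zn \<omega> / m * indicator A (X \<omega>) \<partial>M)"
      using intmu[OF ip(1) nn(1), of "indicator A :: real \<Rightarrow> real"] intmu[OF ip(2) nn(2), of "indicator A :: real \<Rightarrow> real"]
      by simp
    hence "(\<integral>\<omega>. Zp \<omega> * indicator A (X \<omega>) \<partial>M) = (\<integral>\<omega>. Zn \<omega> * indicator A (X \<omega>) \<partial>M)"
      using m by simp
    moreover have "integrable M (\<lambda>\<omega>. Zp \<omega> * indicator A (X \<omega>))" "integrable M (\<lambda>\<omega>. Zn \<omega> * indicator A (X \<omega>))"
      by (rule mult_int; use ip in \<open>auto simp: indicator_def\<close>)+
    ultimately show ?thesis unfolding Zd by (simp add: left_diff_distrib)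
  qed
qed

text \<open>With the coefficients of the other coordinates fixed, the exponential in coordinate j is
  exchanged for an indicator, which is then absorbed into Z; the induction is therefore over all
  Z.\<close>

lemma laplace_uniqueness_multi:
  fixes Z :: "'a \<Rightarrow> real" and X :: "'i \<Rightarrow> 'a \<Rightarrow> real"
  assumes "finite J"
    and X: "\<And>i. i \<in> J \<Longrightarrow> X i \<in> borel_measurable M"
    and int: "\<And>c. integrable M (\<lambda>\<omega>. Z \<omega> * exp (\<Sum>i\<in>J. c i * X i \<omega>))"
    and zero: "\<And>c. (\<integral>\<omega>. Z \<omega> * exp (\<Sum>i\<in>J. c i * X i \<omega>) \<partial>M) = 0"
    and A: "\<And>i. i \<in> J \<Longrightarrow> A i \<in> sets borel"
  shows "(\<integral>\<omega>. Z \<omega> * (\<Prod>i\<in>J. indicator (A i) (X i \<omega>)) \<partial>M) = 0"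
  using assms
proof (induction J arbitrary: Z rule: finite_induct)
  case empty
  then show ?case by simp
next
  case (insert j J)
  let ?Z = "\<lambda>\<omega>. Z \<omega> * indicator (A j) (X j \<omega>)"
  have [measurable]: "X j \<in> borel_measurable M" "A j \<in> sets borel" using insert by auto
  have split: "(\<Sum>i\<in>insert j J. (c(j := t)) i * X i \<omega>) = (\<Sum>i\<in>J. c i * X i \<omega>) + t * X j \<omega>" for c t \<omega>
  proof -
    have "(\<Sum>i\<in>J. (c(j := t)) i * X i \<omega>) = (\<Sum>i\<in>J. c i * X i \<omega>)"
      using insert(2) by (intro sum.cong) auto
    thus ?thesis using insert by simp
  qed
  have int': "integrable M (\<lambda>\<omega>. (Z \<omega> * exp (\<Sum>i\<in>J. c i * X i \<omega>)) * exp (t * X j \<omega>))" for c t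
    using insert.prems(2)[of "c(j := t)"] unfolding split by (simp add: exp_add mult.assoc)
  have zero': "(\<integral>\<omega>. (Z \<omega> * exp (\<Sum>i\<in>J. c i * X i \<omega>)) * exp (t * X j \<omega>) \<partial>M) = 0" for c t
    using insert.prems(3)[of "c(j := t)"] unfolding split by (simp add: exp_add mult.assoc)
  have "(\<integral>\<omega>. ?Z \<omega> * (\<Prod>i\<in>J. indicator (A i) (X i \<omega>)) \<partial>M) = 0"
  proof (rule insert.IH)
    show "integrable M (\<lambda>\<omega>. ?Z \<omega> * exp (\<Sum>i\<in>J. c i * X i \<omega>))" for c
    proof (rule Bochner_Integration.integrable_bound)
      show i: "integrable M (\<lambda>\<omega>. Z \<omega> * exp (\<Sum>i\<in>J. c i * X i \<omega>))" using int'[of c 0] by simp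
      have "(\<lambda>\<omega>. ?Z \<omega> * exp (\<Sum>i\<in>J. c i * X i \<omega>)) = (\<lambda>\<omega>. (Z \<omega> * exp (\<Sum>i\<in>J. c i * X i \<omega>)) * indicator (A j) (X j \<omega>))"
        by (simp add: mult_ac)
      also have "\<dots> \<in> borel_measurable M"
        by (intro borel_measurable_times borel_measurable_integrable[OF i]) measurable
      finally show "(\<lambda>\<omega>. ?Z \<omega> * exp (\<Sum>i\<in>J. c i * X i \<omega>)) \<in> borel_measurable M" .
    qed (auto simp: indicator_def)
    have "(\<integral>\<omega>. (Z \<omega> * exp (\<Sum>i\<in>J. c i * X i \<omega>)) * indicator (A j) (X j \<omega>) \<partial>M) = 0" for c
      by (rule laplace_uniqueness[OF _ int' zero']) measurable
    thus "(\<integral>\<omega>. ?Z \<omega> * exp (\<Sum>i\<in>J. c i * X i \<omega>) \<partial>M) = 0" for c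
      by (simp add: mult_ac)
  qed (use insert in auto)
  thus ?case using insert(1,2) by (simp add: mult.assoc)
qed

section \<open>Sigma-algebras generated by a process\<close>

lemma generated_algebra_space [simp]: "space (generated_algebra P W T) = space P"
  by (simp add: generated_algebra_def space_measure_of_conv)

lemma sets_generated_algebra:
  "sets (generated_algebra P W T) = sigma_sets (space P) (\<Union>t\<in>T. {W t -` A \<inter> space P | A. A \<in> sets borel})"
  unfolding generated_algebra_def by (intro sets_measure_of) auto

lemma generated_algebra_measurable:
  assumes "t \<in> T"
  shows "W t \<in> borel_measurable (generated_algebra P W T)"
proof (rule measurableI)
  fix A :: "real set" assume "A \<in> sets borel"
  thus "W t -` A \<inter> space (generated_algebra P W T) \<in> sets (generated_algebra P W T)"
    unfolding sets_generated_algebra generated_algebra_space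
    using assms by (intro sigma_sets.Basic) auto
qed simp

lemma generated_algebra_subalgebra:
  assumes "\<And>t. t \<in> T \<Longrightarrow> W t \<in> borel_measurable P"
  shows "subalgebra P (generated_algebra P W T)"
  unfolding subalgebra_def sets_generated_algebra generated_algebra_space
  using assms by (auto intro!: sets.sigma_sets_subset measurable_sets)

text \<open>The signed measure \<open>Z P\<close> vanishes on cylinder sets one coordinate at a time, hence on
  the \<open>\<sigma>\<close>-algebra they generate.\<close>

lemma laplace_uniqueness_generated:
  fixes Z :: "'a \<Rightarrow> real" and W :: "real \<Rightarrow> 'a \<Rightarrow> real"
  assumes X: "\<And>t. t \<in> T \<Longrightarrow> W t \<in> borel_measurable P"
    and int: "\<And>J c. finite J \<Longrightarrow> J \<subseteq> T \<Longrightarrow> integrable P (\<lambda>\<omega>. Z \<omega> * exp (\<Sum>i\<in>J. c i * W i \<omega>))"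
    and zero: "\<And>J c. finite J \<Longrightarrow> J \<subseteq> T \<Longrightarrow> (\<integral>\<omega>. Z \<omega> * exp (\<Sum>i\<in>J. c i * W i \<omega>) \<partial>P) = 0"
    and B: "B \<in> sets (generated_algebra P W T)"
  shows "(\<integral>\<omega>. Z \<omega> * indicator B \<omega> \<partial>P) = 0"
proof -
  \<comment> \<open>Cylinder sets. The family A is total, so two cylinders over different index sets
    are intersected by taking \<open>UNIV\<close> for the missing coordinates.\<close>
  define G where "G = {{\<omega> \<in> space P. \<forall>t\<in>J. W t \<omega> \<in> A t} | J A. finite J \<and> J \<subseteq> T \<and> (\<forall>t. A t \<in> sets (borel :: real measure))}"
  have iZ: "integrable P Z" using int[of "{}" "\<lambda>_. 0"] by simp
  have sub: "subalgebra P (generated_algebra P W T)" using X by (rule generated_algebra_subalgebra)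
  have G_sub: "G \<subseteq> sets (generated_algebra P W T)"
  proof
    fix C assume "C \<in> G"
    then obtain J A where C: "C = {\<omega> \<in> space P. \<forall>t\<in>J. W t \<omega> \<in> A t}" "finite J" "J \<subseteq> T" "\<And>t. A t \<in> sets (borel :: real measure)"
      unfolding G_def by blast
    show "C \<in> sets (generated_algebra P W T)"
    proof (cases "J = {}")
      case True
      hence "C = space (generated_algebra P W T)" using C(1) by simp
      thus ?thesis by (simp only: sets.top)
    next
      case False
      hence "C = (\<Inter>t\<in>J. W t -` A t \<inter> space (generated_algebra P W T))"
        unfolding C(1) generated_algebra_space by auto
      also have "\<dots> \<in> sets (generated_algebra P W T)"
      proof (rule sets.finite_INT[OF C(2) False])
        fix t assume "t \<in> J"
        hence "t \<in> T" using C(3) by auto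
        from measurable_sets[OF generated_algebra_measurable[OF this] C(4)]
        show "W t -` A t \<inter> space (generated_algebra P W T) \<in> sets (generated_algebra P W T)" .
      qed
      finally show ?thesis .
    qed
  qed
  have "sets (generated_algebra P W T) = sigma_sets (space P) G"
  proof
    show "sigma_sets (space P) G \<subseteq> sets (generated_algebra P W T)"
      using sets.sigma_sets_subset[OF G_sub] by simp
    show "sets (generated_algebra P W T) \<subseteq> sigma_sets (space P) G"
      unfolding sets_generated_algebra
    proof (rule sigma_sets_mono, safe)
      fix t and A :: "real set" assume t: "t \<in> T" "A \<in> sets borel"
      have "W t -` A \<inter> space P = {\<omega> \<in> space P. \<forall>s\<in>{t}. W s \<omega> \<in> A}" by auto
      also have "\<dots> \<in> G" unfolding G_def using t by (intro CollectI exI[of _ "{t}"] exI[of _ "\<lambda>_. A"]) auto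
      finally show "W t -` A \<inter> space P \<in> sigma_sets (space P) G" by (rule sigma_sets.Basic)
    qed
  qed
  with B have "B \<in> sigma_sets (space P) G" by simp
  moreover have "Int_stable G"
  proof (rule Int_stableI)
    fix C C' assume "C \<in> G" "C' \<in> G"
    then obtain J A J' A' where C: "C = {\<omega> \<in> space P. \<forall>t\<in>J. W t \<omega> \<in> A t}" "finite J" "J \<subseteq> T" "\<And>t. A t \<in> sets (borel :: real measure)"
      and C': "C' = {\<omega> \<in> space P. \<forall>t\<in>J'. W t \<omega> \<in> A' t}" "finite J'" "J' \<subseteq> T" "\<And>t. A' t \<in> sets (borel :: real measure)"
      unfolding G_def by blast
    have "C \<inter> C' = {\<omega> \<in> space P. \<forall>t\<in>J \<union> J'. W t \<omega> \<in> (if t \<in> J then A t else UNIV) \<inter> (if t \<in> J' then A' t else UNIV)}"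
      unfolding C(1) C'(1) by auto
    also have "\<dots> \<in> G" unfolding G_def
      by (intro CollectI exI[of _ "J \<union> J'"] exI[of _ "\<lambda>t. (if t \<in> J then A t else UNIV) \<inter> (if t \<in> J' then A' t else UNIV)"])
         (use C C' in auto)
    finally show "C \<inter> C' \<in> G" .
  qed
  moreover have "G \<subseteq> Pow (space P)" by (auto simp: G_def)
  moreover have inP: "C \<in> sets P" if "C \<in> sigma_sets (space P) G" for C
    using that sub \<open>sets (generated_algebra P W T) = sigma_sets (space P) G\<close> by (auto simp: subalgebra_def)
  have iI: "integrable P (\<lambda>\<omega>. Z \<omega> * indicator C \<omega>)" if "C \<in> sets P" for C
    using integrable_mult_indicator[OF that iZ] by (simp add: mult.commute)
  show ?thesis using \<open>Int_stable G\<close> \<open>G \<subseteq> Pow (space P)\<close> \<open>B \<in> sigma_sets (space P) G\<close>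
  proof (induction rule: sigma_sets_induct_disjoint)
    case (basic C)
    then obtain J A where C: "C = {\<omega> \<in> space P. \<forall>t\<in>J. W t \<omega> \<in> A t}" "finite J" "J \<subseteq> T" "\<And>t. A t \<in> sets (borel :: real measure)"
      unfolding G_def by blast
    have "(\<integral>\<omega>. Z \<omega> * indicator C \<omega> \<partial>P) = (\<integral>\<omega>. Z \<omega> * (\<Prod>t\<in>J. indicator (A t) (W t \<omega>)) \<partial>P)"
    proof (rule Bochner_Integration.integral_cong[OF refl])
      fix \<omega> assume w: "\<omega> \<in> space P"
      have "indicator C \<omega> = (\<Prod>t\<in>J. indicator (A t) (W t \<omega>) :: real)"
      proof (cases "\<omega> \<in> C")
        case True
        thus ?thesis by (auto simp: C)
      next
        case False
        with w C obtain t where "t \<in> J" "W t \<omega> \<notin> A t" by auto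
        hence "(\<Prod>t\<in>J. indicator (A t) (W t \<omega>) :: real) = 0" using C(2) by (intro prod_zero) (auto intro!: bexI[of _ t])
        with False show ?thesis by simp
      qed
      thus "Z \<omega> * indicator C \<omega> = Z \<omega> * (\<Prod>t\<in>J. indicator (A t) (W t \<omega>))" by simp
    qed
    also have "\<dots> = 0"
      by (rule laplace_uniqueness_multi) (use C X int zero in auto)
    finally show ?case .
  next
    case empty
    show ?case by simp
  next
    case (compl C)
    have C: "C \<in> sets P" by (rule inP) fact
    have "(\<integral>\<omega>. Z \<omega> * indicator (space P - C) \<omega> \<partial>P) = (\<integral>\<omega>. Z \<omega> - Z \<omega> * indicator C \<omega> \<partial>P)"
      by (rule Bochner_Integration.integral_cong) (auto simp: indicator_def)
    also have "\<dots> = 0" using iZ iI[OF C] compl(2) zero[of "{}" "\<lambda>_. 0"] by simp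
    finally show ?case .
  next
    case (union C)
    have C: "C i \<in> sets P" for i by (rule inP) (use union in auto)
    have "(LINT x:(\<Union>i. C i)|P. Z x) = (\<Sum>i. (LINT x:(C i)|P. Z x))"
    proof (rule lebesgue_integral_countable_add)
      show "set_integrable P (\<Union>i. C i) Z"
        unfolding set_integrable_def by (rule integrable_mult_indicator[OF _ iZ]) (use C in auto)
    qed (use union(1) C in \<open>auto simp: disjoint_family_on_def\<close>)
    also have "\<dots> = 0" using union(3) by (simp add: set_lebesgue_integral_def mult.commute)
    finally show ?case by (simp add: set_lebesgue_integral_def mult.commute)
  qed
qed

text \<open>Every event agrees with its main part, a set of F, up to a null set. So the integral of
  Z over every event vanishes, which determines a density.\<close>

lemma AE_zero_if_generated_integrals_zero:
  fixes Z :: "'a \<Rightarrow> real"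
  assumes sub: "subalgebra P F"
    and gen: "sets P = sets (completion (restr_to_subalg P F))"
    and iZ: "integrable P Z"
    and zero: "\<And>B. B \<in> sets F \<Longrightarrow> (\<integral>\<omega>. Z \<omega> * indicator B \<omega> \<partial>P) = 0"
  shows "AE \<omega> in P. Z \<omega> = 0"
proof (rule density_unique_real[OF iZ])
  fix A assume A: "A \<in> sets P"
  let ?R = "restr_to_subalg P F"
  have A': "A \<in> sets (completion ?R)" using A gen by simp
  have B: "main_part ?R A \<in> sets F" using main_part_sets[OF A'] sets_restr_to_subalg[OF sub] by simp
  from null_part[OF A'] obtain N where N: "N \<in> null_sets ?R" "null_part ?R A \<subseteq> N" by blast
  have NP: "N \<in> null_sets P" using N null_sets_restr_to_subalg[OF sub] by auto
  have BP: "main_part ?R A \<in> sets P" using B sub by (auto simp: subalgebra_def)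
  have "AE \<omega> in P. Z \<omega> * indicator A \<omega> = Z \<omega> * indicator (main_part ?R A) \<omega>"
    using AE_not_in[OF NP]
  proof eventually_elim
    case (elim \<omega>)
    have "\<omega> \<in> A \<longleftrightarrow> \<omega> \<in> main_part ?R A"
      using equalityD1[OF main_part_null_part_Un[OF A']] equalityD2[OF main_part_null_part_Un[OF A']] N(2) elim by blast
    thus ?case by (simp add: indicator_def)
  qed
  hence "(\<integral>\<omega>. Z \<omega> * indicator A \<omega> \<partial>P) = (\<integral>\<omega>. Z \<omega> * indicator (main_part ?R A) \<omega> \<partial>P)"
    by (intro integral_cong_AE borel_measurable_times borel_measurable_integrable[OF iZ]
        borel_measurable_indicator A BP)
  also have "\<dots> = 0" by (rule zero[OF B])
  finally show "(LINT \<omega>:A|P. Z \<omega>) = (LINT \<omega>:A|P. 0)"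
    by (simp add: set_lebesgue_integral_def mult.commute)
qed simp_all

subsection \<open>Linear integral equations\<close>

lemma abs_exp_minus_one_le:
  fixes x :: real
  assumes "\<bar>x\<bar> \<le> 1"
  shows "\<bar>exp x - 1 - x\<bar> \<le> x\<^sup>2"
proof -
  have "exp x \<ge> 1 + x" by (rule exp_ge_add_one_self)
  moreover have "exp x \<le> 1 + x + x\<^sup>2"
  proof (cases "x \<ge> 0")
    case True
    thus ?thesis using exp_bound[of x] assms by simp
  next
    case False
    define z where "z = - x"
    have z: "0 < z" "z \<le> 1" using False assms by (auto simp: z_def)
    \<comment> \<open>The product equals 1 + z^3.\<close>
    have "1 \<le> (1 + z) * (1 - z + z\<^sup>2)" using z by (simp add: algebra_simps power2_eq_square)
    also have "\<dots> \<le> exp z * (1 - z + z\<^sup>2)"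
    proof (rule mult_right_mono)
      show "1 + z \<le> exp z" by (rule exp_ge_add_one_self)
      show "0 \<le> 1 - z + z\<^sup>2" using z by simp
    qed
    finally have "exp (- z) \<le> 1 - z + z\<^sup>2" by (simp add: exp_minus field_simps)
    thus ?thesis by (simp add: z_def)
  qed
  ultimately show ?thesis by linarith
qed

text \<open>On a partition so fine that H grows by at most e per step, the squared increments sum to
  at most e times the total growth of H.\<close>

lemma quadratic_increments_constant:
  fixes y H :: "real \<Rightarrow> real"
  assumes H: "continuous_on {0..1} H"
    and mono: "\<And>s t. 0 \<le> s \<Longrightarrow> s \<le> t \<Longrightarrow> t \<le> 1 \<Longrightarrow> H s \<le> H t"
    and C: "C \<ge> 0"
    and y: "\<And>s t. 0 \<le> s \<Longrightarrow> s \<le> t \<Longrightarrow> t \<le> 1 \<Longrightarrow> H t - H s \<le> 1 \<Longrightarrow> \<bar>y t - y s\<bar> \<le> C * (H t - H s)\<^sup>2"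
  shows "y 1 = y 0"
proof -
  have bound: "\<bar>y 1 - y 0\<bar> \<le> e * (C * (H 1 - H 0))" if e: "0 < e" "e \<le> 1" for e
  proof -
    have "uniformly_continuous_on {0..1} H" by (rule compact_uniformly_continuous[OF H]) simp
    then obtain d where d: "d > 0" "\<And>s t. s \<in> {0..1} \<Longrightarrow> t \<in> {0..1} \<Longrightarrow> dist t s < d \<Longrightarrow> dist (H t) (H s) < e"
      using e unfolding uniformly_continuous_on_def by metis
    obtain n where n: "n > 0" "inverse (real n) < d" using d(1) by (metis ex_inverse_of_nat_less)
    define p where "p i = real i / real n" for i
    have p01: "0 \<le> p i" "p i \<le> p (Suc i)" for i by (auto simp: p_def divide_right_mono)
    have p1: "p i \<le> 1" if "i \<le> n" for i using that n by (simp add: p_def)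
    have step: "\<bar>y (p (Suc i)) - y (p i)\<bar> \<le> C * e * (H (p (Suc i)) - H (p i))" if i: "i < n" for i
    proof -
      have "p (Suc i) - p i = inverse (real n)" by (simp add: p_def add_divide_distrib inverse_eq_divide)
      hence "dist (H (p (Suc i))) (H (p i)) < e"
        using p01 p1[of i] p1[of "Suc i"] i n by (intro d(2)) (auto simp: dist_real_def)
      hence le: "H (p (Suc i)) - H (p i) \<le> e" by (simp add: dist_real_def)
      have nn: "0 \<le> H (p (Suc i)) - H (p i)" using mono[of "p i" "p (Suc i)"] p01[of i] p1[of "Suc i"] i by simp
      have "\<bar>y (p (Suc i)) - y (p i)\<bar> \<le> C * (H (p (Suc i)) - H (p i))\<^sup>2"
        using p01[of i] p1[of "Suc i"] i le e by (intro y) auto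
      also have "\<dots> \<le> C * (e * (H (p (Suc i)) - H (p i)))"
        unfolding power2_eq_square by (intro mult_left_mono mult_right_mono le nn C)
      finally show ?thesis by (simp add: mult.assoc)
    qed
    have "y 1 - y 0 = (\<Sum>i<n. y (p (Suc i)) - y (p i))"
      using n by (subst sum_lessThan_telescope) (simp add: p_def)
    hence "\<bar>y 1 - y 0\<bar> \<le> (\<Sum>i<n. C * e * (H (p (Suc i)) - H (p i)))"
      by (simp only:) (rule order_trans[OF sum_abs sum_mono], use step in auto)
    also have "\<dots> = C * e * (H 1 - H 0)"
      unfolding sum_distrib_left[symmetric] using n by (subst sum_lessThan_telescope) (simp add: p_def)
    finally show ?thesis by (simp add: mult_ac)
  qed
  have "\<bar>y 1 - y 0\<bar> \<le> 0"
  proof (rule field_le_epsilon)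
    fix d :: real assume d: "d > 0"
    define K where "K = C * (H 1 - H 0)"
    have K: "K \<ge> 0" using C mono[of 0 1] by (simp add: K_def)
    define e where "e = min 1 (d / (K + 1))"
    have "\<bar>y 1 - y 0\<bar> \<le> e * K" unfolding K_def by (rule bound) (use d K in \<open>auto simp: e_def\<close>)
    also have "\<dots> \<le> d / (K + 1) * K" using K by (intro mult_right_mono) (auto simp: e_def)
    also have "\<dots> \<le> d" using K d by (simp add: field_simps)
    finally show "\<bar>y 1 - y 0\<bar> \<le> 0 + d" by simp
  qed
  thus ?thesis by simp
qed

text \<open>The indicator keeps all t on one measure space, so differences and limits in t are taken
  under the integral.\<close>

definition primitive :: "(real \<Rightarrow> real) \<Rightarrow> real \<Rightarrow> real" where
  "primitive u t = (\<integral>s. indicator {0..t} s * u s \<partial>unit_leb)"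

lemma integrable_indicator_mult:
  fixes u :: "real \<Rightarrow> real"
  assumes "integrable unit_leb u" "A \<in> sets borel"
  shows "integrable unit_leb (\<lambda>s. indicator A s * u s)"
proof (rule Bochner_Integration.integrable_bound[OF assms(1)])
  have "(indicator A :: real \<Rightarrow> real) \<in> borel_measurable unit_leb"
    by (rule measurable_unit_leb) (use assms(2) in measurable)
  thus "(\<lambda>s. indicator A s * u s) \<in> borel_measurable unit_leb"
    by (intro borel_measurable_times borel_measurable_integrable[OF assms(1)])
qed (auto simp: indicator_def)

lemma primitive_diff:
  assumes "integrable unit_leb u" "0 \<le> s" "s \<le> t"
  shows "primitive u t - primitive u s = (\<integral>x. indicator {s<..t} x * u x \<partial>unit_leb)"
proof -
  have "primitive u t - primitive u s = (\<integral>x. indicator {0..t} x * u x - indicator {0..s} x * u x \<partial>unit_leb)"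
    unfolding primitive_def using integrable_indicator_mult[OF assms(1)] by simp
  also have "\<dots> = (\<integral>x. indicator {s<..t} x * u x \<partial>unit_leb)"
    by (rule Bochner_Integration.integral_cong) (use assms in \<open>auto simp: indicator_def\<close>)
  finally show ?thesis .
qed

text \<open>Dominated convergence: the indicators converge at every s except the limit point, a null
  set.\<close>

lemma primitive_continuous:
  assumes "integrable unit_leb u"
  shows "continuous_on {0..1} (primitive u)"
  unfolding continuous_on_sequentially
proof (intro allI ballI impI, elim conjE)
  fix x :: "nat \<Rightarrow> real" and a assume a: "a \<in> {0..1}" and x: "\<forall>n. x n \<in> {0..1}" "x \<longlonglongrightarrow> a"
  have "AE s in lebesgue. s \<noteq> a" by (rule AE_completion) (rule AE_lborel_singleton)
  hence ne: "AE s in unit_leb. s \<noteq> a" by (subst AE_restrict_space_iff) (auto elim: AE_mp)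
  have "(\<lambda>n. \<integral>s. indicator {0..x n} s * u s \<partial>unit_leb) \<longlonglongrightarrow> (\<integral>s. indicator {0..a} s * u s \<partial>unit_leb)"
  proof (rule integral_dominated_convergence)
    show "integrable unit_leb (\<lambda>s. \<bar>u s\<bar>)" by (rule integrable_abs[OF assms])
    show "AE s in unit_leb. (\<lambda>n. indicator {0..x n} s * u s) \<longlonglongrightarrow> indicator {0..a} s * u s"
      using ne AE_space
    proof eventually_elim
      case (elim s)
      have "eventually (\<lambda>n. indicator {0..x n} s = (indicator {0..a} s :: real)) sequentially"
      proof (cases "s < a")
        case True
        have "eventually (\<lambda>n. s < x n) sequentially" by (rule order_tendstoD(1)[OF x(2) True])
        thus ?thesis by eventually_elim (use True elim in \<open>auto simp: indicator_def\<close>)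
      next
        case False
        with elim have "a < s" by simp
        have "eventually (\<lambda>n. x n < s) sequentially" by (rule order_tendstoD(2)[OF x(2) \<open>a < s\<close>])
        thus ?thesis by eventually_elim (use \<open>a < s\<close> in \<open>auto simp: indicator_def\<close>)
      qed
      hence "(\<lambda>n. indicator {0..x n} s :: real) \<longlonglongrightarrow> indicator {0..a} s" by (rule tendsto_eventually)
      thus ?case by (intro tendsto_intros)
    qed
    show "AE s in unit_leb. norm (indicator {0..x n} s * u s) \<le> \<bar>u s\<bar>" for n
      by (auto simp: indicator_def)
  qed (rule borel_measurable_integrable[OF integrable_indicator_mult[OF assms]], simp)+
  thus "(primitive u \<circ> x) \<longlonglongrightarrow> primitive u a" by (simp add: primitive_def comp_def)
qed

lemma abs_integral_indicator_mono:
  fixes u v :: "real \<Rightarrow> real"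
  assumes "integrable unit_leb u" "integrable unit_leb v" "A \<in> sets borel" "\<And>x. x \<in> A \<Longrightarrow> x \<in> {0..1} \<Longrightarrow> \<bar>u x\<bar> \<le> v x"
  shows "\<bar>\<integral>x. indicator A x * u x \<partial>unit_leb\<bar> \<le> (\<integral>x. indicator A x * v x \<partial>unit_leb)"
proof -
  have "\<bar>\<integral>x. indicator A x * u x \<partial>unit_leb\<bar> \<le> (\<integral>x. \<bar>indicator A x * u x\<bar> \<partial>unit_leb)" by (rule integral_abs_bound)
  also have "\<dots> \<le> (\<integral>x. indicator A x * v x \<partial>unit_leb)"
  proof (rule integral_mono)
    show "integrable unit_leb (\<lambda>x. \<bar>indicator A x * u x\<bar>)"
      by (rule integrable_abs[OF integrable_indicator_mult[OF assms(1,3)]])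
  qed (use assms(4) integrable_indicator_mult[OF assms(2,3)] in \<open>auto simp: indicator_def\<close>)
  finally show ?thesis .
qed

text \<open>The product \<open>x t * exp (- \<integral>\<^sub>0\<^sup>t b)\<close> has increments of second order in the increments of
  \<open>\<integral> \<bar>b\<bar>\<close>, so it is constant.\<close>

lemma linear_integral_equation:
  fixes x b :: "real \<Rightarrow> real"
  assumes b: "integrable unit_leb b" and bx: "integrable unit_leb (\<lambda>s. b s * x s)"
    and eq: "\<And>t. t \<in> {0..1} \<Longrightarrow> x t = x0 + (\<integral>s. indicator {0..t} s * (b s * x s) \<partial>unit_leb)"
  shows "x 1 = x0 * exp (\<integral>s. b s \<partial>unit_leb)"
proof -
  \<comment> \<open>An a priori bound for |x|, read off from the equation itself.\<close>
  define M where "M = \<bar>x0\<bar> + (\<integral>s. \<bar>b s * x s\<bar> \<partial>unit_leb)"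
  define H where "H = primitive (\<lambda>s. \<bar>b s\<bar>)"
  define B where "B = primitive b"
  have ib: "integrable unit_leb (\<lambda>s. \<bar>b s\<bar>)" using b by simp
  have M0: "M \<ge> 0" unfolding M_def by simp
  have xM: "\<bar>x t\<bar> \<le> M" if "t \<in> {0..1}" for t
  proof -
    have "\<bar>\<integral>s. indicator {0..t} s * (b s * x s) \<partial>unit_leb\<bar> \<le> (\<integral>s. indicator {0..t} s * \<bar>b s * x s\<bar> \<partial>unit_leb)"
      by (rule abs_integral_indicator_mono[OF bx integrable_abs[OF bx]]) auto
    also have "\<dots> \<le> (\<integral>s. \<bar>b s * x s\<bar> \<partial>unit_leb)"
      by (rule integral_mono[OF integrable_indicator_mult[OF integrable_abs[OF bx]] integrable_abs[OF bx]]) (auto simp: indicator_def)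
    finally show ?thesis unfolding M_def eq[OF that] by linarith
  qed
  have Hdiff: "H t - H s = (\<integral>u. indicator {s<..t} u * \<bar>b u\<bar> \<partial>unit_leb)" if "0 \<le> s" "s \<le> t" for s t
    unfolding H_def by (rule primitive_diff[OF ib that])
  have Bdiff: "B t - B s = (\<integral>u. indicator {s<..t} u * b u \<partial>unit_leb)" if "0 \<le> s" "s \<le> t" for s t
    unfolding B_def by (rule primitive_diff[OF b that])
  have Hmono: "H s \<le> H t" if "0 \<le> s" "s \<le> t" for s t
  proof -
    have "0 \<le> H t - H s" unfolding Hdiff[OF that] by (intro Bochner_Integration.integral_nonneg) auto
    thus ?thesis by simp
  qed
  have BH: "\<bar>B t - B s\<bar> \<le> H t - H s" if "0 \<le> s" "s \<le> t" for s t
    unfolding Hdiff[OF that] Bdiff[OF that] by (rule abs_integral_indicator_mono[OF b ib]) auto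
  have xdiff: "x t - x s = (\<integral>u. indicator {s<..t} u * (b u * x u) \<partial>unit_leb)" if "0 \<le> s" "s \<le> t" "t \<le> 1" for s t
    using primitive_diff[OF bx that(1,2)] eq[of t] eq[of s] that by (simp add: primitive_def)
  have xH: "\<bar>x t - x s\<bar> \<le> M * (H t - H s)" if "0 \<le> s" "s \<le> t" "t \<le> 1" for s t
  proof -
    have "\<bar>x t - x s\<bar> \<le> (\<integral>u. indicator {s<..t} u * (M * \<bar>b u\<bar>) \<partial>unit_leb)"
      unfolding xdiff[OF that]
    proof (rule abs_integral_indicator_mono[OF bx])
      fix u assume "u \<in> {0..1::real}"
      from mult_right_mono[OF xM[OF this], of "\<bar>b u\<bar>"] show "\<bar>b u * x u\<bar> \<le> M * \<bar>b u\<bar>" by (simp add: abs_mult mult.commute)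
    qed (use ib in auto)
    also have "\<dots> = M * (H t - H s)" unfolding Hdiff[OF that(1,2)]
      by (subst integral_mult_right_zero[symmetric]) (simp add: mult_ac)
    finally show ?thesis .
  qed
  define y where "y t = x t * exp (- B t)" for t
  \<comment> \<open>2 M collects two second-order errors, one from freezing x at time s and one from
    linearising the exponential; \<open>exp (H 1)\<close> bounds \<open>exp (- B t)\<close>.\<close>
  define C where "C = exp (H 1) * (2 * M)"
  have C0: "C \<ge> 0" using M0 by (simp add: C_def)
  have "y 1 = y 0"
  proof (rule quadratic_increments_constant[of H C y])
    show "continuous_on {0..1} H" unfolding H_def by (rule primitive_continuous[OF ib])
    fix s t :: real assume st: "0 \<le> s" "s \<le> t" "t \<le> 1" and small: "H t - H s \<le> 1"
    define \<beta> where "\<beta> = B t - B s"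
    have \<beta>: "\<bar>\<beta>\<bar> \<le> H t - H s" "\<bar>\<beta>\<bar> \<le> 1" using BH[OF st(1,2)] small by (auto simp: \<beta>_def)
    \<comment> \<open>What remains is the integral of b(u) (x(u) - x(s)), whose second factor is
      itself of the order of the increment of H.\<close>
    have "x t - x s - x s * \<beta> = (\<integral>u. indicator {s<..t} u * (b u * x u - x s * b u) \<partial>unit_leb)"
    proof -
      have "(\<integral>u. indicator {s<..t} u * (b u * x u - x s * b u) \<partial>unit_leb) =
          (\<integral>u. indicator {s<..t} u * (b u * x u) - x s * (indicator {s<..t} u * b u) \<partial>unit_leb)"
        by (simp add: algebra_simps)
      also have "\<dots> = (\<integral>u. indicator {s<..t} u * (b u * x u) \<partial>unit_leb) - x s * (\<integral>u. indicator {s<..t} u * b u \<partial>unit_leb)"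
        using integrable_indicator_mult[OF bx, of "{s<..t}"] integrable_indicator_mult[OF b, of "{s<..t}"] by simp
      finally show ?thesis unfolding \<beta>_def Bdiff[OF st(1,2)] xdiff[OF st] by simp
    qed
    also have "\<bar>\<dots>\<bar> \<le> (\<integral>u. indicator {s<..t} u * (M * (H t - H s) * \<bar>b u\<bar>) \<partial>unit_leb)"
    proof (rule abs_integral_indicator_mono)
      show "integrable unit_leb (\<lambda>u. b u * x u - x s * b u)" using b bx by auto
      show "integrable unit_leb (\<lambda>u. M * (H t - H s) * \<bar>b u\<bar>)" using ib by auto
      fix u assume u: "u \<in> {s<..t}"
      have "\<bar>x u - x s\<bar> \<le> M * (H u - H s)" using u st by (intro xH) auto
      also have "\<dots> \<le> M * (H t - H s)" using u st Hmono[of u t] M0 by (intro mult_left_mono) auto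
      finally have "\<bar>x u - x s\<bar> * \<bar>b u\<bar> \<le> M * (H t - H s) * \<bar>b u\<bar>" by (rule mult_right_mono) simp
      moreover have "b u * x u - x s * b u = (x u - x s) * b u" by (simp add: algebra_simps)
      ultimately show "\<bar>b u * x u - x s * b u\<bar> \<le> M * (H t - H s) * \<bar>b u\<bar>" by (simp add: abs_mult)
    qed simp
    also have "\<dots> = M * (H t - H s) * (H t - H s)"
      by (subst (3) Hdiff[OF st(1,2)], subst integral_mult_right_zero[symmetric]) (simp add: mult_ac)
    finally have 1: "\<bar>x t - x s - x s * \<beta>\<bar> \<le> M * (H t - H s)\<^sup>2" by (simp add: power2_eq_square mult.assoc)
    have "\<bar>x s * (exp \<beta> - 1 - \<beta>)\<bar> \<le> M * (H t - H s)\<^sup>2"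
      unfolding abs_mult
    proof (intro mult_mono xM)
      have "\<bar>exp \<beta> - 1 - \<beta>\<bar> \<le> \<beta>\<^sup>2" by (rule abs_exp_minus_one_le[OF \<beta>(2)])
      also have "\<dots> \<le> (H t - H s)\<^sup>2" using power_mono[OF \<beta>(1), of 2] by simp
      finally show "\<bar>exp \<beta> - 1 - \<beta>\<bar> \<le> (H t - H s)\<^sup>2" .
    qed (use st M0 in auto)
    moreover have "x t - x s * exp \<beta> = (x t - x s - x s * \<beta>) - x s * (exp \<beta> - 1 - \<beta>)" by (simp add: algebra_simps)
    ultimately have 2: "\<bar>x t - x s * exp \<beta>\<bar> \<le> 2 * M * (H t - H s)\<^sup>2" using 1 by linarith
    have "y t - y s = exp (- B t) * (x t - x s * exp \<beta>)"
      by (simp add: y_def \<beta>_def algebra_simps exp_add[symmetric])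
    hence "\<bar>y t - y s\<bar> = exp (- B t) * \<bar>x t - x s * exp \<beta>\<bar>" by (simp add: abs_mult)
    also have "\<dots> \<le> exp (H 1) * (2 * M * (H t - H s)\<^sup>2)"
    proof (intro mult_mono 2)
      have "B 0 = 0" "H 0 = 0"
      proof -
        have "AE s in unit_leb. indicator {0..0} s * u s = (0::real)" for u :: "real \<Rightarrow> real"
          using AE_unit_leb_nonzero by eventually_elim (simp add: indicator_def)
        hence "primitive u 0 = 0" for u unfolding primitive_def by (intro integral_eq_zero_AE)
        thus "B 0 = 0" "H 0 = 0" by (auto simp: B_def H_def)
      qed
      hence "- B t \<le> H 1" using BH[of 0 t] Hmono[of t 1] st by auto
      thus "exp (- B t) \<le> exp (H 1)" by simp
    qed auto
    finally show "\<bar>y t - y s\<bar> \<le> C * (H t - H s)\<^sup>2" by (simp add: C_def mult_ac)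
  qed (use Hmono C0 in auto)
  moreover have "B 1 = (\<integral>s. b s \<partial>unit_leb)"
    unfolding B_def primitive_def by (rule Bochner_Integration.integral_cong) auto
  moreover have "primitive u 0 = 0" for u
  proof -
    have "AE s in unit_leb. indicator {0..0} s * u s = (0::real)"
      using AE_unit_leb_nonzero by eventually_elim (simp add: indicator_def)
    thus ?thesis unfolding primitive_def by (rule integral_eq_zero_AE)
  qed
  hence "B 0 = 0" "x 0 = x0" using eq[of 0] by (auto simp: B_def primitive_def)
  ultimately show ?thesis by (simp add: y_def exp_minus field_simps)
qed

subsection \<open>Completeness and density in \<open>L\<^sup>2\<close>\<close>

text \<open>Serves limits that exist only almost everywhere and come with bounds on the integrals
  instead of an integrable majorant.\<close>

lemma integrable_Fatou:
  fixes u :: "nat \<Rightarrow> 'a \<Rightarrow> real"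
  assumes u: "\<And>n. integrable M (u n)" "\<And>n x. 0 \<le> u n x" and v[measurable]: "v \<in> borel_measurable M"
    and lim: "AE x in M. (\<lambda>n. u n x) \<longlonglongrightarrow> v x"
    and B: "eventually (\<lambda>n. (\<integral>x. u n x \<partial>M) \<le> B) sequentially"
  shows "integrable M v" "(\<integral>x. v x \<partial>M) \<le> B"
proof -
  have [measurable]: "u n \<in> borel_measurable M" for n by (rule borel_measurable_integrable[OF u(1)])
  have nn: "AE x in M. 0 \<le> v x" using lim by eventually_elim (rule LIMSEQ_le_const, use u(2) in auto)
  obtain n0 where n0: "(\<integral>x. u n0 x \<partial>M) \<le> B" using eventually_happens'[OF _ B] by auto
  have B0: "0 \<le> B" by (rule order_trans[OF _ n0]) (simp add: u(2))
  have "(\<integral>\<^sup>+x. ennreal (v x) \<partial>M) = (\<integral>\<^sup>+x. liminf (\<lambda>n. ennreal (u n x)) \<partial>M)"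
  proof (rule nn_integral_cong_AE)
    show "AE x in M. ennreal (v x) = liminf (\<lambda>n. ennreal (u n x))"
      using lim by eventually_elim (rule lim_imp_Liminf[OF sequentially_bot tendsto_ennrealI, symmetric])
  qed
  also have "\<dots> \<le> liminf (\<lambda>n. \<integral>\<^sup>+x. ennreal (u n x) \<partial>M)" by (rule nn_integral_liminf) measurable
  also have "\<dots> \<le> ennreal B"
  proof (rule Liminf_le)
    show "eventually (\<lambda>n. (\<integral>\<^sup>+x. ennreal (u n x) \<partial>M) \<le> ennreal B) sequentially"
      using B by eventually_elim (use u in \<open>simp add: nn_integral_eq_integral ennreal_leI\<close>)
  qed simp
  finally have le: "(\<integral>\<^sup>+x. ennreal (v x) \<partial>M) \<le> ennreal B" .
  show i: "integrable M v"
  proof (rule integrableI_nonneg[OF v nn])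
    show "(\<integral>\<^sup>+x. ennreal (v x) \<partial>M) < \<infinity>" using le by (simp add: le_less_trans)
  qed
  show "(\<integral>x. v x \<partial>M) \<le> B" using le nn_integral_eq_integral[OF i nn] B0 by (simp add: ennreal_le_iff)
qed

text \<open>The rate (1/4)^m for squared distances makes the L1 norms of successive differences at
  most a multiple of (1/2)^m. So the differences are summable almost everywhere, and Fatou's lemma
  carries the distances over to the limit.\<close>

lemma (in prob_space) L2_complete:
  fixes S :: "nat \<Rightarrow> 'a \<Rightarrow> real"
  assumes S: "\<And>m. square_integrable M (S m)"
    and C: "\<And>m k. m \<le> k \<Longrightarrow> (\<integral>x. (S k x - S m x)\<^sup>2 \<partial>M) \<le> C * (1/4) ^ m"
  obtains Y where "L2_tendsto M S Y"
proof -
  have [measurable]: "S m \<in> borel_measurable M" for m by (rule square_integrable_measurable[OF S])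
  have one: "square_integrable M (\<lambda>_. 1)" by (rule bounded_square_integrable[of _ 1]) auto
  define D where "D m x = \<bar>S (Suc m) x - S m x\<bar>" for m x
  have D2: "square_integrable M (D m)" for m
    using square_integrable_diff[OF S[of "Suc m"] S[of m]] by (auto simp: D_def[abs_def] square_integrable_def)
  have [measurable]: "D m \<in> borel_measurable M" for m by (rule square_integrable_measurable[OF D2])
  have iD: "integrable M (D m)" for m using square_integrable_mult_integrable[OF D2 one] by simp
  have "0 \<le> (\<integral>x. (S 0 x - S 0 x)\<^sup>2 \<partial>M)" by simp
  hence C0: "0 \<le> C" using C[of 0 0] by simp
  have le: "(\<integral>x. D m x \<partial>M) \<le> sqrt C * (1/2) ^ m" for m
  proof -
    have "(\<integral>x. D m x \<partial>M)\<^sup>2 \<le> (\<integral>x. (D m x)\<^sup>2 \<partial>M)"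
      using L2_Cauchy_Schwarz[OF D2[of m] one] by (simp add: prob_space)
    also have "\<dots> \<le> C * (1/4) ^ m" using C[of m "Suc m"] by (simp add: D_def)
    also have "\<dots> = (sqrt C * (1/2) ^ m)\<^sup>2"
    proof -
      have "((1/2::real) ^ m)\<^sup>2 = (1/4) ^ m" by (simp add: power2_eq_square power_mult_distrib[symmetric])
      thus ?thesis using C0 by (simp add: power_mult_distrib)
    qed
    finally show ?thesis by (rule power2_le_imp_le) (use C0 in simp)
  qed
  have "(\<integral>\<^sup>+x. (\<Sum>m. ennreal (D m x)) \<partial>M) = (\<Sum>m. \<integral>\<^sup>+x. ennreal (D m x) \<partial>M)"
    by (rule nn_integral_suminf) measurable
  also have "\<dots> = (\<Sum>m. ennreal (\<integral>x. D m x \<partial>M))"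
  proof -
    have "(\<integral>\<^sup>+x. ennreal (D m x) \<partial>M) = ennreal (\<integral>x. D m x \<partial>M)" for m
      by (rule nn_integral_eq_integral[OF iD]) (simp add: D_def)
    thus ?thesis by (simp only:)
  qed
  also have "\<dots> \<le> (\<Sum>m. ennreal (sqrt C * (1/2) ^ m))"
    by (rule suminf_le[OF ennreal_leI[OF le]]) auto
  also have "\<dots> = ennreal (\<Sum>m. sqrt C * (1/2) ^ m)"
    by (rule suminf_ennreal2) (use C0 in \<open>simp_all add: summable_mult summable_geometric\<close>)
  finally have "(\<integral>\<^sup>+x. (\<Sum>m. ennreal (D m x)) \<partial>M) < \<infinity>" by (rule le_less_trans) simp
  hence "(\<integral>\<^sup>+x. (\<Sum>m. ennreal (D m x)) \<partial>M) \<noteq> \<infinity>" by simp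
  hence "AE x in M. (\<Sum>m. ennreal (D m x)) \<noteq> \<infinity>" by (intro nn_integral_PInf_AE) measurable
  hence conv: "AE x in M. convergent (\<lambda>m. S m x)"
  proof eventually_elim
    case (elim x)
    have "summable (\<lambda>m. D m x)" by (rule summable_suminf_not_top) (use elim in \<open>auto simp: D_def\<close>)
    hence "summable (\<lambda>m. S (Suc m) x - S m x)" unfolding D_def by (rule summable_rabs_cancel)
    hence "convergent (\<lambda>k. S k x - S 0 x)"
      using sum_lessThan_telescope[of "\<lambda>m. S m x"] by (simp add: summable_iff_convergent)
    from convergent_add[OF this convergent_const[of "S 0 x"]] show ?case by simp
  qed
  define Y where "Y x = lim (\<lambda>m. S m x)" for x
  have [measurable]: "Y \<in> borel_measurable M" unfolding Y_def by measurable
  have lim: "AE x in M. (\<lambda>m. S m x) \<longlonglongrightarrow> Y x" using conv by eventually_elim (simp add: Y_def convergent_LIMSEQ_iff)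
  have F: "integrable M (\<lambda>x. (Y x - S m x)\<^sup>2) \<and> (\<integral>x. (Y x - S m x)\<^sup>2 \<partial>M) \<le> C * (1/4) ^ m" for m
  proof -
    have l: "AE x in M. (\<lambda>k. (S k x - S m x)\<^sup>2) \<longlonglongrightarrow> (Y x - S m x)\<^sup>2"
      using lim by eventually_elim (intro tendsto_intros)
    have e: "eventually (\<lambda>k. (\<integral>x. (S k x - S m x)\<^sup>2 \<partial>M) \<le> C * (1/4) ^ m) sequentially"
      using eventually_ge_at_top[of m] by eventually_elim (rule C)
    note Fa = integrable_Fatou[of M "\<lambda>k x. (S k x - S m x)\<^sup>2" "\<lambda>x. (Y x - S m x)\<^sup>2" "C * (1/4) ^ m",
        OF square_integrable_integrable[OF square_integrable_diff[OF S S]] zero_le_power2 _ l e]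
    show ?thesis by (intro conjI Fa) measurable
  qed
  have YS: "square_integrable M (\<lambda>x. Y x - S m x)" for m using F by (simp add: square_integrable_def)
  have Y2: "square_integrable M Y" using square_integrable_add[OF YS[of 0] S[of 0]] by simp
  have "(\<lambda>m. \<integral>x. (S m x - Y x)\<^sup>2 \<partial>M) \<longlonglongrightarrow> 0"
  proof (rule Lim_null_comparison)
    show "\<forall>\<^sub>F m in sequentially. norm (\<integral>x. (S m x - Y x)\<^sup>2 \<partial>M) \<le> C * (1/4) ^ m"
      using F by (intro always_eventually allI) (simp add: power2_commute)
    show "(\<lambda>m. C * (1/4) ^ m) \<longlonglongrightarrow> 0"
      by (intro tendsto_mult_right_zero LIMSEQ_power_zero) simp
  qed
  with S Y2 have "L2_tendsto M S Y" by (simp add: L2_tendsto_def)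
  thus ?thesis by (rule that)
qed

lemma abs_exp_diff_le: "\<bar>exp x - exp y\<bar> \<le> \<bar>x - y\<bar> * (exp x + exp y)" for x y :: real
proof -
  have *: "\<bar>exp x - exp y\<bar> \<le> \<bar>x - y\<bar> * (exp x + exp y)" if "x \<le> y" for x y :: real
  proof -
    have "1 + (x - y) \<le> exp (x - y)" by (rule exp_ge_add_one_self)
    hence "exp y * (1 + (x - y)) \<le> exp y * exp (x - y)" by (intro mult_left_mono) auto
    hence "exp y - exp x \<le> (y - x) * exp y" by (simp add: exp_diff algebra_simps)
    also have "\<dots> \<le> (y - x) * (exp x + exp y)" using that by (intro mult_left_mono) auto
    finally show ?thesis using that by simp
  qed
  show ?thesis using *[of x y] *[of y x] by (cases "x \<le> y") (auto simp: abs_minus_commute add.commute)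
qed

text \<open>Fatou's lemma along an almost everywhere convergent subsequence puts exp Y into L2. Then
  |e^x - e^y| <= |x - y| (e^x + e^y) and Cauchy-Schwarz turn L2 convergence of the exponents into
  convergence of the exponential moments.\<close>

lemma (in prob_space) exp_moment_limit:
  fixes S :: "nat \<Rightarrow> 'a \<Rightarrow> real"
  assumes S: "L2_tendsto M S Y"
    and int: "\<And>m. integrable M (\<lambda>x. exp (2 * S m x))"
    and B: "eventually (\<lambda>m. (\<integral>x. exp (2 * S m x) \<partial>M) \<le> B) sequentially"
    and e: "(\<lambda>m. \<integral>x. exp (S m x) \<partial>M) \<longlonglongrightarrow> e"
  shows "square_integrable M (\<lambda>x. exp (Y x))" "(\<integral>x. exp (Y x) \<partial>M) = e"
proof -
  have s: "square_integrable M (S m)" "square_integrable M Y" for m using S by (auto simp: L2_tendsto_def)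
  note [measurable] = square_integrable_measurable[OF s(1)] square_integrable_measurable[OF s(2)]
  have one: "square_integrable M (\<lambda>_. 1)" by (rule bounded_square_integrable[of _ 1]) auto
  note d = square_integrable_diff[OF s(1) s(2)]
  have "(\<lambda>m. \<integral>x. norm ((S m x - Y x)\<^sup>2) \<partial>M) \<longlonglongrightarrow> 0" using S by (simp add: L2_tendsto_def)
  from tendsto_L1_AE_subseq[OF square_integrable_integrable[OF d] this]
  obtain r where r: "strict_mono r" "AE x in M. (\<lambda>m. (S (r m) x - Y x)\<^sup>2) \<longlonglongrightarrow> 0" by blast
  have lim: "AE x in M. (\<lambda>m. exp (2 * S (r m) x)) \<longlonglongrightarrow> exp (2 * Y x)"
    using r(2)
  proof eventually_elim
    case (elim x)
    have "(\<lambda>m. sqrt ((S (r m) x - Y x)\<^sup>2)) \<longlonglongrightarrow> sqrt 0" by (rule tendsto_real_sqrt[OF elim])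
    hence "(\<lambda>m. S (r m) x - Y x) \<longlonglongrightarrow> 0" by (simp add: tendsto_rabs_zero_iff)
    hence "(\<lambda>m. S (r m) x) \<longlonglongrightarrow> Y x" by (rule LIM_zero_cancel)
    thus ?case by (intro tendsto_intros)
  qed
  have B': "eventually (\<lambda>m. (\<integral>x. exp (2 * S (r m) x) \<partial>M) \<le> B) sequentially"
    using B by (rule eventually_subseq[OF r(1)])
  note F = integrable_Fatou[OF int _ _ lim B']
  have sq: "(exp z)\<^sup>2 = exp (2 * z)" for z :: real by (simp add: exp_double)
  have iY: "integrable M (\<lambda>x. exp (2 * Y x))" "(\<integral>x. exp (2 * Y x) \<partial>M) \<le> B"
    by (rule F; simp)+
  show Y2: "square_integrable M (\<lambda>x. exp (Y x))" using iY by (simp add: square_integrable_def sq)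
  have S2: "square_integrable M (\<lambda>x. exp (S m x))" for m using int[of m] by (simp add: square_integrable_def sq)
  have "(\<lambda>m. (\<integral>x. exp (S m x) \<partial>M) - (\<integral>x. exp (Y x) \<partial>M)) \<longlonglongrightarrow> 0"
  proof (rule Lim_null_comparison)
    show "\<forall>\<^sub>F m in sequentially. norm ((\<integral>x. exp (S m x) \<partial>M) - (\<integral>x. exp (Y x) \<partial>M)) \<le>
        sqrt (\<integral>x. (S m x - Y x)\<^sup>2 \<partial>M) * sqrt (4 * B)"
      using B
    proof eventually_elim
      case (elim m)
      let ?u = "\<lambda>x. exp (S m x) + exp (Y x)"
      have u: "square_integrable M ?u" by (rule square_integrable_add[OF S2 Y2])
      have ad: "square_integrable M (\<lambda>x. \<bar>S m x - Y x\<bar>)" using d[of m] by (auto simp: square_integrable_def)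
      have i: "integrable M (\<lambda>x. exp (S m x))" "integrable M (\<lambda>x. exp (Y x))"
        using square_integrable_mult_integrable[OF S2[of m] one] square_integrable_mult_integrable[OF Y2 one] by auto
      have "norm ((\<integral>x. exp (S m x) \<partial>M) - (\<integral>x. exp (Y x) \<partial>M)) = \<bar>\<integral>x. exp (S m x) - exp (Y x) \<partial>M\<bar>"
        using i by simp
      also have "\<dots> \<le> (\<integral>x. \<bar>exp (S m x) - exp (Y x)\<bar> \<partial>M)" by (rule integral_abs_bound)
      also have "\<dots> \<le> (\<integral>x. \<bar>S m x - Y x\<bar> * ?u x \<partial>M)"
        by (rule integral_mono[OF _ square_integrable_mult_integrable[OF ad u] abs_exp_diff_le]) (use i in auto)
      also have "\<dots> \<le> sqrt (\<integral>x. (S m x - Y x)\<^sup>2 \<partial>M) * sqrt (\<integral>x. (?u x)\<^sup>2 \<partial>M)"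
        using L2_Cauchy_Schwarz_abs[OF ad u] by simp
      \<comment> \<open>4 B is 2 B for the exponential of \<open>S m\<close> plus 2 B for that of
        Y.\<close>
      also have "\<dots> \<le> sqrt (\<integral>x. (S m x - Y x)\<^sup>2 \<partial>M) * sqrt (4 * B)"
        using L2_norm_add_le[OF S2[of m] Y2] elim iY(2) unfolding sq
        by (intro mult_left_mono real_sqrt_le_mono) auto
      finally show ?case .
    qed
    have "(\<lambda>m. sqrt (\<integral>x. (S m x - Y x)\<^sup>2 \<partial>M)) \<longlonglongrightarrow> sqrt 0"
      using S by (intro tendsto_real_sqrt) (simp add: L2_tendsto_def)
    thus "(\<lambda>m. sqrt (\<integral>x. (S m x - Y x)\<^sup>2 \<partial>M) * sqrt (4 * B)) \<longlonglongrightarrow> 0"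
      by (intro tendsto_mult_left_zero) simp
  qed
  hence "(\<lambda>m. \<integral>x. exp (S m x) \<partial>M) \<longlonglongrightarrow> (\<integral>x. exp (Y x) \<partial>M)" by (rule LIM_zero_cancel)
  thus "(\<integral>x. exp (Y x) \<partial>M) = e" using e by (rule LIMSEQ_unique)
qed

section \<open>Density of grid step functions in L2\<close>

definition grid_step :: "nat \<Rightarrow> (nat \<Rightarrow> real) \<Rightarrow> real \<Rightarrow> real" where
  "grid_step n c s = (\<Sum>i<n. c i * grid_ind n i s)"

lemma L2_unit_grid_step: "L2_unit (grid_step n c)"
  unfolding grid_step_def[abs_def]
  by (intro square_integrable_sum square_integrable_scale L2_unit_grid_ind)

definition grid_approximable :: "(real \<Rightarrow> real) \<Rightarrow> bool" where
  "grid_approximable f \<longleftrightarrow> (\<forall>e>0. \<exists>n>0. \<exists>c. (\<integral>s. (f s - grid_step n c s)\<^sup>2 \<partial>unit_leb) < e)"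

lemma indicator_Ioc_add:
  fixes a b c s :: real
  assumes "a \<le> b" "b \<le> c"
  shows "indicator {a<..b} s + indicator {b<..c} s = (indicator {a<..c} s :: real)"
  using assms by (auto simp: indicator_def)

lemma sum_grid_ind_refine:
  assumes "n > 0" "k > 0"
  shows "(\<Sum>j\<in>{i*k..<i*k+k}. grid_ind (n * k) j s) = grid_ind n i s"
proof -
  have "(\<Sum>j\<in>{i*k..<i*k+m}. grid_ind (n * k) j s) = indicator {real (i * k) / real (n * k)<..real (i * k + m) / real (n * k)} s" for m
  proof (induction m)
    case (Suc m)
    have "real (i * k) / real (n * k) \<le> real (i * k + m) / real (n * k)"
      "real (i * k + m) / real (n * k) \<le> real (i * k + Suc m) / real (n * k)"
      by (intro divide_right_mono; simp)+
    from indicator_Ioc_add[OF this, of s] show ?case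
      using Suc by (simp add: grid_ind_def del: of_nat_add of_nat_mult of_nat_Suc)
  qed simp
  moreover have "real (i * k) / real (n * k) = real i / real n" using assms by simp
  moreover have "real (i * k + k) / real (n * k) = real (Suc i) / real n"
  proof -
    have "real (i * k + k) = real (Suc i) * real k" by (simp add: algebra_simps)
    thus ?thesis using assms by simp
  qed
  ultimately show ?thesis by (simp only: grid_ind_def)
qed

text \<open>Lets step functions on the grids n and m be added on the common refinement n m: a fine
  interval inherits the coefficient of the coarse one that contains it.\<close>

lemma grid_step_refine:
  assumes "n > 0" "k > 0"
  shows "grid_step n c s = grid_step (n * k) (\<lambda>j. c (j div k)) s"
proof -
  have "grid_step (n * k) (\<lambda>j. c (j div k)) s = (\<Sum>i<n. \<Sum>j\<in>{i*k..<i*k+k}. c (j div k) * grid_ind (n * k) j s)"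
    unfolding grid_step_def by (rule sum.nat_group[symmetric])
  also have "\<dots> = (\<Sum>i<n. \<Sum>j\<in>{i*k..<i*k+k}. c i * grid_ind (n * k) j s)"
  proof (intro sum.cong refl)
    fix i j assume "j \<in> {i * k..<i * k + k}"
    hence "j div k = i" using assms by (intro div_nat_eqI) (auto simp: mult.commute)
    thus "c (j div k) * grid_ind (n * k) j s = c i * grid_ind (n * k) j s" by simp
  qed
  also have "\<dots> = grid_step n c s"
    unfolding grid_step_def sum_distrib_left[symmetric] sum_grid_ind_refine[OF assms] ..
  finally show ?thesis by simp
qed

lemma grid_approximable_add:
  assumes L: "L2_unit f" "L2_unit g" and f: "grid_approximable f" and g: "grid_approximable g"
  shows "grid_approximable (\<lambda>s. f s + g s)"
  unfolding grid_approximable_def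
proof (intro allI impI)
  fix e :: real assume "e > 0"
  hence e4: "e / 4 > 0" by simp
  obtain n c where n: "n > 0" "(\<integral>s. (f s - grid_step n c s)\<^sup>2 \<partial>unit_leb) < e / 4"
    using f[unfolded grid_approximable_def, rule_format, OF e4] by (elim exE conjE)
  obtain m d where m: "m > 0" "(\<integral>s. (g s - grid_step m d s)\<^sup>2 \<partial>unit_leb) < e / 4"
    using g[unfolded grid_approximable_def, rule_format, OF e4] by (elim exE conjE)
  define c' d' where "c' j = c (j div m)" and "d' j = d (j div n)" for j
  have e1: "grid_step n c = grid_step (n * m) c'" "grid_step m d = grid_step (n * m) d'"
  proof -
    show "grid_step n c = grid_step (n * m) c'"
      unfolding c'_def[abs_def] by (rule ext) (rule grid_step_refine[OF n(1) m(1)])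
    show "grid_step m d = grid_step (n * m) d'"
      unfolding d'_def[abs_def] mult.commute[of n m] by (rule ext) (rule grid_step_refine[OF m(1) n(1)])
  qed
  have e2: "grid_step (n * m) (\<lambda>i. c' i + d' i) s = grid_step (n * m) c' s + grid_step (n * m) d' s" for s
    by (simp add: grid_step_def distrib_right sum.distrib)
  have "(\<integral>s. ((f s - grid_step (n * m) c' s) + (g s - grid_step (n * m) d' s))\<^sup>2 \<partial>unit_leb) \<le>
      2 * (\<integral>s. (f s - grid_step n c s)\<^sup>2 \<partial>unit_leb) + 2 * (\<integral>s. (g s - grid_step m d s)\<^sup>2 \<partial>unit_leb)"
    unfolding e1 by (rule L2_norm_add_le) (intro square_integrable_diff L L2_unit_grid_step)+
  also have "\<dots> < e" using n m by simp
  also have "(\<lambda>s. ((f s - grid_step (n * m) c' s) + (g s - grid_step (n * m) d' s))\<^sup>2) =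
      (\<lambda>s. (f s + g s - grid_step (n * m) (\<lambda>i. c' i + d' i) s)\<^sup>2)"
    unfolding e2 by (simp add: algebra_simps)
  finally show "\<exists>n>0. \<exists>c. (\<integral>s. (f s + g s - grid_step n c s)\<^sup>2 \<partial>unit_leb) < e"
    using n m by (intro exI[of _ "n * m"]) auto
qed

lemma grid_approximable_scale:
  assumes f: "grid_approximable f"
  shows "grid_approximable (\<lambda>s. a * f s)"
  unfolding grid_approximable_def
proof (intro allI impI)
  fix e :: real assume e: "e > 0"
  \<comment> \<open>The summand 1 avoids division by zero when a = 0.\<close>
  define e' where "e' = e / (a\<^sup>2 + 1)"
  have p: "a\<^sup>2 + 1 > 0" using zero_le_power2[of a] by linarith
  have e': "e' > 0" "a\<^sup>2 * e' < e" using e p by (auto simp: e'_def field_simps)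
  obtain n c where n: "n > 0" "(\<integral>s. (f s - grid_step n c s)\<^sup>2 \<partial>unit_leb) < e'"
    using f[unfolded grid_approximable_def, rule_format, OF e'(1)] by (elim exE conjE)
  have "(\<lambda>s. (a * f s - grid_step n (\<lambda>i. a * c i) s)\<^sup>2) = (\<lambda>s. a\<^sup>2 * (f s - grid_step n c s)\<^sup>2)"
    by (simp add: grid_step_def sum_distrib_left[symmetric] mult.assoc right_diff_distrib[symmetric] power_mult_distrib)
  hence "(\<integral>s. (a * f s - grid_step n (\<lambda>i. a * c i) s)\<^sup>2 \<partial>unit_leb) = a\<^sup>2 * (\<integral>s. (f s - grid_step n c s)\<^sup>2 \<partial>unit_leb)" by simp
  also have "\<dots> \<le> a\<^sup>2 * e'" using n by (intro mult_left_mono) auto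
  also have "\<dots> < e" by (rule e')
  finally show "\<exists>n>0. \<exists>c. (\<integral>s. (a * f s - grid_step n c s)\<^sup>2 \<partial>unit_leb) < e" using n(1) by blast
qed

lemma grid_approximable_limit:
  assumes L: "\<And>i. L2_unit (g i)" "L2_unit f" and lim: "(\<lambda>i. \<integral>s. (f s - g i s)\<^sup>2 \<partial>unit_leb) \<longlonglongrightarrow> 0"
    and g: "\<And>i. grid_approximable (g i)"
  shows "grid_approximable f"
  unfolding grid_approximable_def
proof (intro allI impI)
  fix e :: real assume e: "e > 0"
  have e4: "e / 4 > 0" using e by simp
  have "eventually (\<lambda>i. (\<integral>s. (f s - g i s)\<^sup>2 \<partial>unit_leb) < e / 4) sequentially"
    by (rule order_tendstoD(2)[OF lim]) (use e in simp)
  then obtain i where i: "(\<integral>s. (f s - g i s)\<^sup>2 \<partial>unit_leb) < e / 4" using eventually_happens'[OF sequentially_bot] by blast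
  obtain n c where n: "n > 0" "(\<integral>s. (g i s - grid_step n c s)\<^sup>2 \<partial>unit_leb) < e / 4"
    using g[of i, unfolded grid_approximable_def, rule_format, OF e4] by (elim exE conjE)
  have "(\<integral>s. ((f s - g i s) + (g i s - grid_step n c s))\<^sup>2 \<partial>unit_leb) \<le>
      2 * (\<integral>s. (f s - g i s)\<^sup>2 \<partial>unit_leb) + 2 * (\<integral>s. (g i s - grid_step n c s)\<^sup>2 \<partial>unit_leb)"
    by (rule L2_norm_add_le) (intro square_integrable_diff L L2_unit_grid_step)+
  also have "\<dots> < e" using n i by simp
  finally show "\<exists>n>0. \<exists>c. (\<integral>s. (f s - grid_step n c s)\<^sup>2 \<partial>unit_leb) < e" using n(1) by auto
qed

lemma grid_approximable_cong_AE:
  assumes "AE s in unit_leb. f s = g s" "f \<in> borel_measurable unit_leb" "g \<in> borel_measurable unit_leb" "grid_approximable f"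
  shows "grid_approximable g"
proof -
  have "(\<integral>s. (f s - grid_step n c s)\<^sup>2 \<partial>unit_leb) = (\<integral>s. (g s - grid_step n c s)\<^sup>2 \<partial>unit_leb)" for n c
    by (rule integral_cong_AE)
       (use assms(1) in \<open>auto elim: AE_mp intro!: borel_measurable_power borel_measurable_diff assms square_integrable_measurable[OF L2_unit_grid_step]\<close>)
  with assms(4) show ?thesis by (simp add: grid_approximable_def)
qed

lemma grid_approximable_Ioc:
  assumes t: "0 \<le> t" "t \<le> 1"
  shows "grid_approximable (indicator {0<..t})"
  unfolding grid_approximable_def
proof (intro allI impI)
  fix e :: real assume "e > 0"
  then obtain n where n: "n > 0" "inverse (real n) < e" by (metis ex_inverse_of_nat_less)
  \<comment> \<open>t is rounded down to a grid point, at the cost of an interval of length at most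
    1 / n.\<close>
  define k where "k = nat \<lfloor>t * real n\<rfloor>"
  have k: "real k \<le> t * real n" "t * real n < real k + 1" using t by (auto simp: k_def)
  have kn: "k \<le> n"
  proof -
    have "t * real n \<le> 1 * real n" using t by (intro mult_right_mono) auto
    with k(1) show ?thesis by linarith
  qed
  have "t \<le> (real k + 1) / real n" using k n by (simp add: pos_le_divide_eq)
  hence kt: "real k / real n \<le> t" "t - real k / real n \<le> inverse (real n)"
    using k n by (auto simp: pos_divide_le_eq add_divide_distrib inverse_eq_divide)
  define c where "c i = (if i < k then 1 else 0 :: real)" for i
  have "grid_step n c s = indicator {0<..real k / real n} s" for s
  proof -
    have "grid_step n c s = (\<Sum>i<n. if i < k then grid_ind n i s else 0)"
      unfolding grid_step_def by (intro sum.cong) (auto simp: c_def)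
    also have "\<dots> = (\<Sum>i<k. grid_ind n i s)"
      using kn by (intro sum.mono_neutral_cong_right) auto
    also have "\<dots> = indicator {0<..real k / real n} s" by (rule sum_grid_ind_lessThan)
    finally show ?thesis .
  qed
  hence "(\<integral>s. (indicator {0<..t} s - grid_step n c s)\<^sup>2 \<partial>unit_leb) = (\<integral>s. indicator {real k / real n<..t} s \<partial>unit_leb)"
    using kt by (intro Bochner_Integration.integral_cong) (auto simp: indicator_def intro: le_less_trans[of 0 "real k / real n"])
  also have "\<dots> = t - real k / real n" using kt t by (intro integral_unit_leb_indicator) auto
  also have "\<dots> < e" using kt n by simp
  finally show "\<exists>n>0. \<exists>c. (\<integral>s. (indicator {0<..t} s - grid_step n c s)\<^sup>2 \<partial>unit_leb) < e" using n(1) by blast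
qed

text \<open>A Dynkin argument that starts from half-lines; countable disjoint unions are limits of
  their partial sums by dominated convergence.\<close>

lemma grid_approximable_borel:
  assumes "A \<in> sets borel"
  shows "grid_approximable (indicator A)"
proof -
  have m: "(indicator B :: real \<Rightarrow> real) \<in> borel_measurable unit_leb" if "B \<in> sets borel" for B :: "real set"
    by (rule measurable_unit_leb) (use that in measurable)
  have L: "L2_unit (indicator B)" if "B \<in> sets borel" for B :: "real set"
    by (rule unit_leb.bounded_square_integrable[OF m[OF that], where B = 1]) (auto simp: indicator_def)
  have at: "grid_approximable (indicator {..a})" for a :: real
  proof -
    \<comment> \<open>After clipping a to [0, 1], the interval {0<..b} and the half-line differ
      within [0, 1] at most at the point 0.\<close>
    define b where "b = max 0 (min a 1)"
    have "AE s in unit_leb. indicator {0<..b} s = (indicator {..a} s :: real)"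
      using AE_unit_leb_nonzero AE_space by eventually_elim (auto simp: b_def indicator_def)
    from grid_approximable_cong_AE[OF this] m[of "{0<..b}"] m[of "{..a}"] grid_approximable_Ioc[of b]
    show ?thesis by (simp add: b_def)
  qed
  have sig: "sigma_sets UNIV (range (\<lambda>a::real. {..a})) = sets borel"
    by (simp add: borel_eq_atMost)
  have "Int_stable (range (\<lambda>a::real. {..a}))"
    by (auto simp: Int_stable_def)
  moreover have "range (\<lambda>a::real. {..a}) \<subseteq> Pow UNIV" by simp
  moreover have "A \<in> sigma_sets UNIV (range (\<lambda>a::real. {..a}))" using assms sig by simp
  ultimately show ?thesis
  proof (induction rule: sigma_sets_induct_disjoint)
    case (basic A)
    then show ?case using at by auto
  next
    case empty
    show ?case
      using grid_approximable_Ioc[OF order_refl zero_le_one] unfolding greaterThanAtMost_empty[OF order_refl] .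
  next
    case (compl A)
    have one: "grid_approximable (indicator {..1})" by (rule at)
    have A: "A \<in> sets borel" using compl sig by auto
    have "AE s in unit_leb. indicator {..1} s + (-1) * indicator A s = (indicator (UNIV - A) s :: real)"
      by (rule AE_I2) (auto simp: indicator_def)
    thus ?case
    proof (rule grid_approximable_cong_AE)
      show "grid_approximable (\<lambda>s. indicator {..1} s + (-1) * indicator A s)"
        by (intro grid_approximable_add grid_approximable_scale one compl(2) L square_integrable_scale A) simp
      show "(indicator (UNIV - A) :: real \<Rightarrow> real) \<in> borel_measurable unit_leb" by (rule m) (use A in auto)
      show "(\<lambda>s. indicator {..1} s + (-1) * indicator A s :: real) \<in> borel_measurable unit_leb"
        using m[OF A] m[of "{..1}"] by simp
    qed
  next
    case (union A)
    have A: "A i \<in> sets borel" for i using union(2) sig by auto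
    define U where "U i = (\<lambda>s. \<Sum>j<i. indicator (A j) s :: real)" for i
    have LU: "L2_unit (U i)" for i unfolding U_def by (intro square_integrable_sum L A)
    have ap: "grid_approximable (U i)" for i
    proof (induction i)
      case 0
      then show ?case using grid_approximable_Ioc[of 0] by (simp add: U_def indicator_def[abs_def])
    next
      case (Suc i)
      have "U (Suc i) = (\<lambda>s. U i s + indicator (A i) s)" by (simp add: U_def)
      then show ?case using grid_approximable_add[OF LU L[OF A] Suc union(3)] by simp
    qed
    have Un: "(\<Union>i. A i) \<in> sets borel" using A by auto
    have sums: "(\<lambda>i. U i s) \<longlonglongrightarrow> indicator (\<Union>i. A i) s" for s
      using indicator_sums[of A s] union(1) by (simp add: U_def sums_def disjoint_family_on_def)
    have "(\<lambda>i. \<integral>s. (indicator (\<Union>i. A i) s - U i s)\<^sup>2 \<partial>unit_leb) \<longlonglongrightarrow> (\<integral>s. 0 \<partial>unit_leb)"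
    proof (rule integral_dominated_convergence[where w = "\<lambda>_. 1"])
      show "AE s in unit_leb. (\<lambda>i. (indicator (\<Union>i. A i) s - U i s)\<^sup>2) \<longlonglongrightarrow> 0"
      proof (rule AE_I2)
        fix s
        have "(\<lambda>i. (indicator (\<Union>i. A i) s - U i s)\<^sup>2) \<longlonglongrightarrow> (indicator (\<Union>i. A i) s - indicator (\<Union>i. A i) s)\<^sup>2"
          by (intro tendsto_intros sums)
        thus "(\<lambda>i. (indicator (\<Union>i. A i) s - U i s)\<^sup>2) \<longlonglongrightarrow> 0" by simp
      qed
      fix i
      show "AE s in unit_leb. norm ((indicator (\<Union>i. A i) s - U i s)\<^sup>2) \<le> 1"
      proof (rule AE_I2)
        fix s
        have "0 \<le> U i s" unfolding U_def by (intro sum_nonneg) auto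
        moreover have "U i s \<le> indicator (\<Union>i. A i) s"
          by (rule LIMSEQ_le_const[OF sums]) (auto simp: U_def intro!: exI[of _ i] sum_mono2)
        ultimately have "\<bar>indicator (\<Union>i. A i) s - U i s\<bar> \<le> 1" by (auto simp: indicator_def split: if_splits)
        from power_mono[OF this, of 2] show "norm ((indicator (\<Union>i. A i) s - U i s)\<^sup>2) \<le> 1" by simp
      qed
      show "(\<lambda>s. (indicator (\<Union>i. A i) s - U i s)\<^sup>2) \<in> borel_measurable unit_leb"
        by (intro borel_measurable_power borel_measurable_diff m[OF Un] square_integrable_measurable[OF LU])
    qed auto
    thus ?case by (intro grid_approximable_limit[OF LU L[OF Un] _ ap]) simp
  qed
qed

text \<open>A Lebesgue set agrees with its Borel main part off a null set.\<close>

lemma grid_approximable_lebesgue: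
  assumes "A \<in> sets unit_leb"
  shows "grid_approximable (indicator A)"
proof -
  have A: "A \<in> sets lebesgue" using assms by (simp add: sets_restrict_space_iff)
  have B: "main_part lborel A \<in> sets borel" using main_part_sets[OF A] by simp
  from null_part[OF A] obtain N where N: "N \<in> null_sets lborel" "null_part lborel A \<subseteq> N" by blast
  have "AE s in lebesgue. s \<notin> N" by (rule AE_completion[OF AE_not_in[OF N(1)]])
  hence "AE s in unit_leb. s \<notin> N" by (subst AE_restrict_space_iff) (auto elim: AE_mp)
  hence "AE s in unit_leb. indicator (main_part lborel A) s = (indicator A s :: real)"
  proof eventually_elim
    case (elim s)
    have "s \<in> A \<longleftrightarrow> s \<in> main_part lborel A"
      using equalityD1[OF main_part_null_part_Un[OF A]] equalityD2[OF main_part_null_part_Un[OF A]] N(2) elim by blast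
    thus ?case by (simp add: indicator_def)
  qed
  thus ?thesis
  proof (rule grid_approximable_cong_AE)
    show "(indicator (main_part lborel A) :: real \<Rightarrow> real) \<in> borel_measurable unit_leb"
      by (rule measurable_unit_leb) (use B in measurable)
    show "(indicator A :: real \<Rightarrow> real) \<in> borel_measurable unit_leb" using assms by measurable
  qed (rule grid_approximable_borel[OF B])
qed

lemma L2_unit_dominated:
  assumes "L2_unit g" "f \<in> borel_measurable unit_leb" "\<And>s. s \<in> space unit_leb \<Longrightarrow> \<bar>f s\<bar> \<le> g s"
  shows "L2_unit f"
proof -
  have "integrable unit_leb (\<lambda>s. (f s)\<^sup>2)"
  proof (rule Bochner_Integration.integrable_bound[OF square_integrable_integrable[OF assms(1)]])
    show "AE s in unit_leb. norm ((f s)\<^sup>2) \<le> norm ((g s)\<^sup>2)"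
    proof (rule AE_I2)
      fix s assume "s \<in> space unit_leb"
      from power_mono[OF assms(3)[OF this], of 2] show "norm ((f s)\<^sup>2) \<le> norm ((g s)\<^sup>2)" by simp
    qed
  qed (use assms(2) in measurable)
  with assms(2) show ?thesis by (simp add: square_integrable_def)
qed

text \<open>Induction from indicators through monotone limits to nonnegative functions, then
  positive and negative part.\<close>

theorem L2_unit_grid_approximable:
  assumes f: "L2_unit f"
  shows "grid_approximable f"
proof -
  \<comment> \<open>Square integrability is a premise inside the induction claim because it has to
    be handed down to the summands and to the members of a monotone sequence.\<close>
  have pos: "L2_unit u \<longrightarrow> grid_approximable u" if "u \<in> borel_measurable unit_leb" "\<And>x. 0 \<le> u x" for u
    using that
  proof (induction rule: borel_measurable_induct_real)
    case (set A)
    then show ?case using grid_approximable_lebesgue by blast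
  next
    case (mult u c)
    show ?case
    proof
      assume L: "L2_unit (\<lambda>x. c * u x)"
      show "grid_approximable (\<lambda>x. c * u x)"
      proof (cases "c = 0")
        case True
        thus ?thesis using grid_approximable_Ioc[of 0] by (simp add: indicator_def[abs_def])
      next
        case False
        have "L2_unit u" using square_integrable_scale[OF L, of "1 / c"] False by simp
        thus ?thesis using mult by (intro grid_approximable_scale) auto
      qed
    qed
  next
    case (add u v)
    show ?case
    proof
      assume L: "L2_unit (\<lambda>x. v x + u x)"
      have "L2_unit u" "L2_unit v" by (rule L2_unit_dominated[OF L]; use add in auto)+
      thus "grid_approximable (\<lambda>x. v x + u x)" using add by (intro grid_approximable_add) auto
    qed
  next
    case (seq U)
    show ?case
    proof
      assume L: "L2_unit u"
      have le: "U i s \<le> u s" if "s \<in> space unit_leb" for i s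
        by (rule incseq_le[OF _ seq.hyps(4)[OF that]]) (use seq.hyps(3) in \<open>auto simp: incseq_def le_fun_def\<close>)
      have LU: "L2_unit (U i)" for i by (rule L2_unit_dominated[OF L]) (use seq le in auto)
      have "(\<lambda>i. \<integral>s. (u s - U i s)\<^sup>2 \<partial>unit_leb) \<longlonglongrightarrow> (\<integral>s. 0 \<partial>unit_leb)"
      proof (rule integral_dominated_convergence[where w = "\<lambda>s. (u s)\<^sup>2"])
        show "AE s in unit_leb. (\<lambda>i. (u s - U i s)\<^sup>2) \<longlonglongrightarrow> 0"
        proof (rule AE_I2)
          fix s assume "s \<in> space unit_leb"
          hence "(\<lambda>i. (u s - U i s)\<^sup>2) \<longlonglongrightarrow> (u s - u s)\<^sup>2" by (intro tendsto_intros seq.hyps(4))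
          thus "(\<lambda>i. (u s - U i s)\<^sup>2) \<longlonglongrightarrow> 0" by simp
        qed
        fix i
        show "AE s in unit_leb. norm ((u s - U i s)\<^sup>2) \<le> (u s)\<^sup>2"
        proof (rule AE_I2)
          fix s assume s: "s \<in> space unit_leb"
          have "\<bar>u s - U i s\<bar> \<le> u s" using le[OF s, of i] seq.hyps(2)[of i s] by simp
          from power_mono[OF this, of 2] show "norm ((u s - U i s)\<^sup>2) \<le> (u s)\<^sup>2" by simp
        qed
        show "(\<lambda>s. (u s - U i s)\<^sup>2) \<in> borel_measurable unit_leb"
          by (intro borel_measurable_power borel_measurable_diff square_integrable_measurable[OF L] square_integrable_measurable[OF LU])
      qed (use square_integrable_integrable[OF L] in auto)
      thus "grid_approximable u" using seq.IH LU by (intro grid_approximable_limit[OF LU L]) auto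
    qed
  qed
  have fm[measurable]: "f \<in> borel_measurable unit_leb" by (rule square_integrable_measurable[OF f])
  have L: "L2_unit (\<lambda>s. \<bar>f s\<bar>)" using f by (auto simp: square_integrable_def)
  have L': "L2_unit (\<lambda>s. max 0 (f s))" "L2_unit (\<lambda>s. max 0 (- f s))"
    by (rule L2_unit_dominated[OF L]; auto)+
  have "grid_approximable (\<lambda>s. max 0 (f s) + (-1) * max 0 (- f s))"
    by (intro grid_approximable_add grid_approximable_scale square_integrable_scale L' pos[rule_format]) auto
  also have "(\<lambda>s. max 0 (f s) + (-1) * max 0 (- f s)) = f" by (auto simp: max_def)
  finally show ?thesis .
qed

subsection \<open>Wiener integrals\<close>

text \<open>Completing the square turns the integrand into a constant times the normal density with
  mean c \<sigma>^2.\<close>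

lemma normal_mgf:
  assumes s: "\<sigma> > 0"
  shows "integrable lborel (\<lambda>x. normal_density 0 \<sigma> x * exp (c * x))"
    "(\<integral>x. normal_density 0 \<sigma> x * exp (c * x) \<partial>lborel) = exp (c\<^sup>2 * \<sigma>\<^sup>2 / 2)"
proof -
  have eq: "normal_density 0 \<sigma> x * exp (c * x) = exp (c\<^sup>2 * \<sigma>\<^sup>2 / 2) * normal_density (c * \<sigma>\<^sup>2) \<sigma> x" for x
  proof -
    have "- x\<^sup>2 / (2 * \<sigma>\<^sup>2) + c * x = c\<^sup>2 * \<sigma>\<^sup>2 / 2 - (x - c * \<sigma>\<^sup>2)\<^sup>2 / (2 * \<sigma>\<^sup>2)"
      using s by (simp add: field_simps power2_eq_square)
    hence "exp (- x\<^sup>2 / (2 * \<sigma>\<^sup>2)) * exp (c * x) = exp (c\<^sup>2 * \<sigma>\<^sup>2 / 2) * exp (- (x - c * \<sigma>\<^sup>2)\<^sup>2 / (2 * \<sigma>\<^sup>2))"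
      by (simp add: exp_add[symmetric])
    thus ?thesis by (simp add: normal_density_def)
  qed
  show "integrable lborel (\<lambda>x. normal_density 0 \<sigma> x * exp (c * x))" unfolding eq using s by simp
  show "(\<integral>x. normal_density 0 \<sigma> x * exp (c * x) \<partial>lborel) = exp (c\<^sup>2 * \<sigma>\<^sup>2 / 2)" unfolding eq using s by simp
qed

text \<open>The length of an intersection of two intervals, in the polarised form in which the
  covariance of two increments appears.\<close>

lemma integral_indicator_Ioc_mult:
  assumes "0 \<le> s" "s \<le> t" "t \<le> 1" "0 \<le> u" "u \<le> v" "v \<le> 1"
  shows "2 * (\<integral>x. indicator {s<..t} x * indicator {u<..v} x \<partial>unit_leb) = \<bar>t - u\<bar> + \<bar>s - v\<bar> - \<bar>t - v\<bar> - \<bar>s - u\<bar>"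
proof -
  have "(\<integral>x. indicator {s<..t} x * indicator {u<..v} x \<partial>unit_leb) =
      (\<integral>x. indicator {max s u<..max (max s u) (min t v)} x \<partial>unit_leb :: real)"
    by (rule Bochner_Integration.integral_cong) (auto simp: indicator_def)
  also have "\<dots> = max (max s u) (min t v) - max s u"
    by (rule integral_unit_leb_indicator) (use assms in auto)
  finally show ?thesis using assms by (simp add: max_def min_def abs_if)
qed

context brownian_motion
begin

lemma increment_exp:
  assumes "0 \<le> s" "s \<le> t" "t \<le> 1"
  shows "integrable P (\<lambda>\<omega>. exp (c * (W t \<omega> - W s \<omega>)))"
    "expectation (\<lambda>\<omega>. exp (c * (W t \<omega> - W s \<omega>))) = exp (c\<^sup>2 * (t - s) / 2)"
proof -
  have "integrable P (\<lambda>\<omega>. exp (c * (W t \<omega> - W s \<omega>))) \<and>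
    expectation (\<lambda>\<omega>. exp (c * (W t \<omega> - W s \<omega>))) = exp (c\<^sup>2 * (t - s) / 2)"
  proof (cases "s = t")
    case True
    thus ?thesis by (simp add: prob_space)
  next
    case False
    with assms have st: "s < t" by simp
    note D = normal_increments[OF assms(1) st assms(3)]
    show ?thesis
      using normal_mgf[of "sqrt (t - s)" c] distributed_integral[OF D, of "\<lambda>x. exp (c * x)"]
        distributed_integrable[OF D, of "\<lambda>x. exp (c * x)"] st by simp
  qed
  thus "integrable P (\<lambda>\<omega>. exp (c * (W t \<omega> - W s \<omega>)))"
    "expectation (\<lambda>\<omega>. exp (c * (W t \<omega> - W s \<omega>))) = exp (c\<^sup>2 * (t - s) / 2)" by auto
qed

lemma increment_square:
  assumes "s \<in> {0..1}" "t \<in> {0..1}"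
  shows "square_integrable P (\<lambda>\<omega>. W t \<omega> - W s \<omega>)"
    "expectation (\<lambda>\<omega>. (W t \<omega> - W s \<omega>)\<^sup>2) = \<bar>t - s\<bar>"
proof -
  have *: "integrable P (\<lambda>\<omega>. (W t \<omega> - W s \<omega>)\<^sup>2) \<and> expectation (\<lambda>\<omega>. (W t \<omega> - W s \<omega>)\<^sup>2) = t - s"
    if st: "0 \<le> s" "s < t" "t \<le> 1" for s t
  proof -
    note D = normal_increments[OF st]
    have s0: "sqrt (t - s) > 0" using st by simp
    have "expectation (\<lambda>\<omega>. W t \<omega> - W s \<omega>) = 0" by (rule normal_distributed_expectation[OF s0 D])
    hence "expectation (\<lambda>\<omega>. (W t \<omega> - W s \<omega>)\<^sup>2) = (sqrt (t - s))\<^sup>2"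
      using normal_distributed_variance[OF s0 D] by simp
    moreover have "integrable P (\<lambda>\<omega>. (W t \<omega> - W s \<omega>)\<^sup>2)"
      using integrable_normal_moment[OF s0, of 0 2] distributed_integrable[OF D, of "\<lambda>x. x\<^sup>2"] by simp
    ultimately show ?thesis using st by simp
  qed
  have m: "(\<lambda>\<omega>. W t \<omega> - W s \<omega>) \<in> borel_measurable P" using assms measurable_W by auto
  have "integrable P (\<lambda>\<omega>. (W t \<omega> - W s \<omega>)\<^sup>2) \<and> expectation (\<lambda>\<omega>. (W t \<omega> - W s \<omega>)\<^sup>2) = \<bar>t - s\<bar>"
    using *[of s t] *[of t s] assms by (cases s t rule: linorder_cases) (auto simp: power2_commute)
  with m show "square_integrable P (\<lambda>\<omega>. W t \<omega> - W s \<omega>)" "expectation (\<lambda>\<omega>. (W t \<omega> - W s \<omega>)\<^sup>2) = \<bar>t - s\<bar>"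
    by (auto simp: square_integrable_def)
qed

text \<open>Polarisation reduces the covariance to the variances of four single increments, however
  the two intervals overlap.\<close>

lemma increment_covariance:
  assumes "0 \<le> s" "s \<le> t" "t \<le> 1" "0 \<le> u" "u \<le> v" "v \<le> 1"
  shows "expectation (\<lambda>\<omega>. (W t \<omega> - W s \<omega>) * (W v \<omega> - W u \<omega>)) =
     L2_inner (indicator {s<..t}) (indicator {u<..v})"
proof -
  have I: "s \<in> {0..1}" "t \<in> {0..1}" "u \<in> {0..1}" "v \<in> {0..1}" using assms by auto
  have i: "integrable P (\<lambda>\<omega>. (W a \<omega> - W b \<omega>)\<^sup>2)" if "a \<in> {0..1}" "b \<in> {0..1}" for a b
    by (rule square_integrable_integrable[OF increment_square(1)[OF that(2,1)]])
  have "(\<lambda>\<omega>. 2 * ((W t \<omega> - W s \<omega>) * (W v \<omega> - W u \<omega>))) =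
     (\<lambda>\<omega>. (W t \<omega> - W u \<omega>)\<^sup>2 + (W s \<omega> - W v \<omega>)\<^sup>2 - (W t \<omega> - W v \<omega>)\<^sup>2 - (W s \<omega> - W u \<omega>)\<^sup>2)"
    by (rule ext) (simp add: power2_eq_square algebra_simps)
  hence "expectation (\<lambda>\<omega>. 2 * ((W t \<omega> - W s \<omega>) * (W v \<omega> - W u \<omega>))) =
     \<bar>t - u\<bar> + \<bar>s - v\<bar> - \<bar>t - v\<bar> - \<bar>s - u\<bar>"
    using i[OF I(2,3)] i[OF I(1,4)] i[OF I(2,4)] i[OF I(1,3)]
      increment_square(2)[OF I(3,2)] increment_square(2)[OF I(4,1)] increment_square(2)[OF I(4,2)] increment_square(2)[OF I(3,1)]
    by simp
  with integral_indicator_Ioc_mult[OF assms] show ?thesis by (simp add: L2_inner_def)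
qed

section \<open>Integrals of step functions\<close>

definition simple_fun :: "nat \<Rightarrow> (nat \<Rightarrow> real) \<Rightarrow> (nat \<Rightarrow> real) \<Rightarrow> real \<Rightarrow> real" where
  "simple_fun n c t = (\<lambda>s. \<Sum>i<n. c i * indicator {t i<..t (Suc i)} s)"

definition simple_int :: "nat \<Rightarrow> (nat \<Rightarrow> real) \<Rightarrow> (nat \<Rightarrow> real) \<Rightarrow> 'a \<Rightarrow> real" where
  "simple_int n c t = (\<lambda>\<omega>. \<Sum>i<n. c i * (W (t (Suc i)) \<omega> - W (t i) \<omega>))"

definition partition :: "nat \<Rightarrow> (nat \<Rightarrow> real) \<Rightarrow> bool" where
  "partition n t \<longleftrightarrow> mono_on {..n} t \<and> t ` {..n} \<subseteq> {0..1}"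

lemma partitionD:
  assumes "partition n t" "i < n"
  shows "0 \<le> t i" "t i \<le> t (Suc i)" "t (Suc i) \<le> 1" "t i \<in> {0..1}" "t (Suc i) \<in> {0..1}"
proof -
  have "t i \<in> {0..1}" "t (Suc i) \<in> {0..1}" using assms unfolding partition_def by fastforce+
  moreover have "t i \<le> t (Suc i)" using assms unfolding partition_def by (auto intro: mono_onD)
  ultimately show "0 \<le> t i" "t i \<le> t (Suc i)" "t (Suc i) \<le> 1" "t i \<in> {0..1}" "t (Suc i) \<in> {0..1}" by auto
qed

lemma L2_unit_simple_fun: "L2_unit (simple_fun n c t)"
  unfolding simple_fun_def by (intro square_integrable_sum square_integrable_scale L2_unit_indicator)

lemma square_integrable_simple_int:
  assumes "partition n t"
  shows "square_integrable P (simple_int n c t)"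
  unfolding simple_int_def
  by (intro square_integrable_sum square_integrable_scale increment_square) (use partitionD[OF assms] in auto)

text \<open>The covariance formula covers any two intervals, so bilinearity settles two unrelated
  partitions at once.\<close>

lemma simple_isometry:
  assumes t: "partition n t" and u: "partition m u"
  shows "expectation (\<lambda>\<omega>. simple_int n c t \<omega> * simple_int m d u \<omega>) = L2_inner (simple_fun n c t) (simple_fun m d u)"
proof -
  have sq: "square_integrable P (\<lambda>\<omega>. W (t (Suc i)) \<omega> - W (t i) \<omega>)" if "i < n" for i
    by (rule increment_square(1)) (use partitionD[OF t that] in auto)
  have sq': "square_integrable P (\<lambda>\<omega>. W (u (Suc i)) \<omega> - W (u i) \<omega>)" if "i < m" for i
    by (rule increment_square(1)) (use partitionD[OF u that] in auto)
  have "(\<lambda>\<omega>. simple_int n c t \<omega> * simple_int m d u \<omega>) = (\<lambda>\<omega>. \<Sum>i<n. \<Sum>j<m. c i * d j *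
      ((W (t (Suc i)) \<omega> - W (t i) \<omega>) * (W (u (Suc j)) \<omega> - W (u j) \<omega>)))"
    by (simp add: simple_int_def sum_product mult_ac)
  hence "expectation (\<lambda>\<omega>. simple_int n c t \<omega> * simple_int m d u \<omega>) = expectation (\<lambda>\<omega>. \<Sum>i<n. \<Sum>j<m. c i * d j *
      ((W (t (Suc i)) \<omega> - W (t i) \<omega>) * (W (u (Suc j)) \<omega> - W (u j) \<omega>)))" by (simp only:)
  also have "\<dots> = (\<Sum>i<n. expectation (\<lambda>\<omega>. \<Sum>j<m. c i * d j *
      ((W (t (Suc i)) \<omega> - W (t i) \<omega>) * (W (u (Suc j)) \<omega> - W (u j) \<omega>))))"
    by (rule Bochner_Integration.integral_sum, rule Bochner_Integration.integrable_sum)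
       (use square_integrable_mult_integrable[OF sq sq'] in auto)
  also have "\<dots> = (\<Sum>i<n. \<Sum>j<m. expectation (\<lambda>\<omega>. c i * d j *
      ((W (t (Suc i)) \<omega> - W (t i) \<omega>) * (W (u (Suc j)) \<omega> - W (u j) \<omega>))))"
    by (intro sum.cong refl Bochner_Integration.integral_sum)
       (use square_integrable_mult_integrable[OF sq sq'] in auto)
  also have "\<dots> = (\<Sum>i<n. \<Sum>j<m. c i * d j *
      expectation (\<lambda>\<omega>. (W (t (Suc i)) \<omega> - W (t i) \<omega>) * (W (u (Suc j)) \<omega> - W (u j) \<omega>)))"
    by simp
  also have "\<dots> = (\<Sum>i<n. \<Sum>j<m. c i * d j * L2_inner (indicator {t i<..t (Suc i)}) (indicator {u j<..u (Suc j)}))"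
    by (intro sum.cong refl arg_cong2[where f = "(*)"] increment_covariance)
       (use partitionD[OF t] partitionD[OF u] in auto)
  also have "\<dots> = (\<integral>s. (\<Sum>i<n. \<Sum>j<m. c i * d j * (indicator {t i<..t (Suc i)} s * indicator {u j<..u (Suc j)} s)) \<partial>unit_leb)"
    by (simp add: L2_inner_def square_integrable_mult_integrable[OF L2_unit_indicator L2_unit_indicator])
  also have "\<dots> = L2_inner (simple_fun n c t) (simple_fun m d u)"
    unfolding L2_inner_def simple_fun_def sum_product by (simp only: mult_ac)
  finally show ?thesis .
qed

lemma simple_fun_norm:
  assumes t: "partition n t"
  shows "L2_inner (simple_fun n c t) (simple_fun n c t) = (\<Sum>i<n. (c i)\<^sup>2 * (t (Suc i) - t i))"
proof -
  have disj: "indicator {t i<..t (Suc i)} s * indicator {t j<..t (Suc j)} s = (if i = j then indicator {t i<..t (Suc i)} s else 0 :: real)"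
    if "i < n" "j < n" for i j s
  proof -
    have "t (Suc i) \<le> t j" if "i < j" "j < n" for i j
      using t that unfolding partition_def by (auto intro: mono_onD)
    from this[of i j] this[of j i] that show ?thesis by (cases i j rule: linorder_cases) (auto simp: indicator_def)
  qed
  have "simple_fun n c t s * simple_fun n c t s = (\<Sum>i<n. (c i)\<^sup>2 * indicator {t i<..t (Suc i)} s)" for s
  proof -
    have "simple_fun n c t s * simple_fun n c t s = (\<Sum>i<n. \<Sum>j<n. c i * c j * (indicator {t i<..t (Suc i)} s * indicator {t j<..t (Suc j)} s))"
      unfolding simple_fun_def sum_product by (intro sum.cong refl) (simp only: mult_ac)
    also have "\<dots> = (\<Sum>i<n. \<Sum>j<n. if i = j then c i * c j * indicator {t i<..t (Suc i)} s else 0)"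
      by (intro sum.cong refl) (simp add: disj)
    also have "\<dots> = (\<Sum>i<n. (c i)\<^sup>2 * indicator {t i<..t (Suc i)} s)"
      by (intro sum.cong refl) (simp add: power2_eq_square)
    finally show ?thesis .
  qed
  hence "L2_inner (simple_fun n c t) (simple_fun n c t) = (\<integral>s. (\<Sum>i<n. (c i)\<^sup>2 * indicator {t i<..t (Suc i)} s) \<partial>unit_leb)"
    by (simp add: L2_inner_def)
  also have "\<dots> = (\<Sum>i<n. (c i)\<^sup>2 * (\<integral>s. indicator {t i<..t (Suc i)} s \<partial>unit_leb))"
  proof -
    have "integrable unit_leb (\<lambda>s. (c i)\<^sup>2 * indicator {t i<..t (Suc i)} s)" for i
      by (intro integrable_mult_right unit_leb.L2_imp_integrable L2_unit_indicator)
    thus ?thesis by (subst Bochner_Integration.integral_sum) (simp_all del: integral_indicator)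
  qed
  also have "\<dots> = (\<Sum>i<n. (c i)\<^sup>2 * (t (Suc i) - t i))"
    by (intro sum.cong refl arg_cong2[where f = "(*)"] integral_unit_leb_indicator)
       (use partitionD[OF t] in auto)
  finally show ?thesis .
qed

text \<open>Independence of the increments factorises the exponential moment into Gaussian
  ones.\<close>

lemma simple_int_exp:
  assumes t: "partition n t"
  shows "integrable P (\<lambda>\<omega>. exp (r * simple_int n c t \<omega>))"
    "expectation (\<lambda>\<omega>. exp (r * simple_int n c t \<omega>)) = exp (r\<^sup>2 * L2_inner (simple_fun n c t) (simple_fun n c t) / 2)"
proof -
  have ind: "indep_vars (\<lambda>_. borel) (\<lambda>i \<omega>. W (t (Suc i)) \<omega> - W (t i) \<omega>) {..<n}"
    using t unfolding partition_def by (intro indep_increments) auto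
  have ind': "indep_vars (\<lambda>_. borel) (\<lambda>i \<omega>. exp ((r * c i) * (W (t (Suc i)) \<omega> - W (t i) \<omega>))) {..<n}"
    by (rule indep_vars_compose2[OF ind, of "\<lambda>i x. exp ((r * c i) * x)"]) simp
  have int: "integrable P (\<lambda>\<omega>. exp ((r * c i) * (W (t (Suc i)) \<omega> - W (t i) \<omega>)))" if "i \<in> {..<n}" for i
    by (rule increment_exp(1)) (use partitionD[OF t, of i] that in auto)
  have eq: "exp (r * simple_int n c t \<omega>) = (\<Prod>i<n. exp ((r * c i) * (W (t (Suc i)) \<omega> - W (t i) \<omega>)))" for \<omega>
    by (simp add: simple_int_def exp_sum[symmetric] sum_distrib_left mult.assoc)
  show "integrable P (\<lambda>\<omega>. exp (r * simple_int n c t \<omega>))"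
    unfolding eq by (rule indep_vars_integrable[OF _ ind' int]) auto
  have "expectation (\<lambda>\<omega>. exp (r * simple_int n c t \<omega>)) =
      (\<Prod>i<n. expectation (\<lambda>\<omega>. exp ((r * c i) * (W (t (Suc i)) \<omega> - W (t i) \<omega>))))"
    unfolding eq by (rule indep_vars_lebesgue_integral[OF _ ind' int]) auto
  also have "\<dots> = (\<Prod>i<n. exp ((r * c i)\<^sup>2 * (t (Suc i) - t i) / 2))"
    by (intro prod.cong refl increment_exp(2)) (use partitionD[OF t] in auto)
  also have "\<dots> = exp (\<Sum>i<n. (r * c i)\<^sup>2 * (t (Suc i) - t i) / 2)" by (simp add: exp_sum)
  also have "(\<Sum>i<n. (r * c i)\<^sup>2 * (t (Suc i) - t i) / 2) = r\<^sup>2 * L2_inner (simple_fun n c t) (simple_fun n c t) / 2"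
    by (simp add: simple_fun_norm[OF t] sum_distrib_left sum_divide_distrib power_mult_distrib mult.assoc)
  finally show "expectation (\<lambda>\<omega>. exp (r * simple_int n c t \<omega>)) = exp (r\<^sup>2 * L2_inner (simple_fun n c t) (simple_fun n c t) / 2)" .
qed

section \<open>The Wiener integral as a limit of step integrals\<close>

lemma has_wiener_integral_iff:
  "has_wiener_integral P W f Y \<longleftrightarrow> (\<exists>N c t. (\<forall>m. partition (N m) (t m)) \<and>
     L2_tendsto unit_leb (\<lambda>m. simple_fun (N m) (c m) (t m)) f \<and>
     L2_tendsto P (\<lambda>m. simple_int (N m) (c m) (t m)) Y)"
  by (simp add: has_wiener_integral_def partition_def simple_fun_def simple_int_def)

text \<open>The identity for step functions passes to the limit along any two approximating
  sequences. Stated for arbitrary versions Y and Z, it is the source of uniqueness and linearity of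
  the integral.\<close>

lemma wiener_isometry:
  assumes "has_wiener_integral P W f Y" "has_wiener_integral P W g Z"
  shows "expectation (\<lambda>\<omega>. Y \<omega> * Z \<omega>) = L2_inner f g"
proof -
  obtain N c t where 1: "\<And>m::nat. partition (N m) (t m)"
     "L2_tendsto unit_leb (\<lambda>m. simple_fun (N m) (c m) (t m)) f" "L2_tendsto P (\<lambda>m. simple_int (N m) (c m) (t m)) Y"
    using assms(1) unfolding has_wiener_integral_iff by blast
  obtain M d u where 2: "\<And>m::nat. partition (M m) (u m)"
     "L2_tendsto unit_leb (\<lambda>m. simple_fun (M m) (d m) (u m)) g" "L2_tendsto P (\<lambda>m. simple_int (M m) (d m) (u m)) Z"
    using assms(2) unfolding has_wiener_integral_iff by blast
  have "(\<lambda>m. L2_inner (simple_fun (N m) (c m) (t m)) (simple_fun (M m) (d m) (u m))) \<longlonglongrightarrow> expectation (\<lambda>\<omega>. Y \<omega> * Z \<omega>)"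
    using L2_tendsto_inner[OF 1(3) 2(3)] simple_isometry[OF 1(1) 2(1)] by simp
  moreover have "(\<lambda>m. L2_inner (simple_fun (N m) (c m) (t m)) (simple_fun (M m) (d m) (u m))) \<longlonglongrightarrow> L2_inner f g"
    using L2_tendsto_inner[OF 1(2) 2(2)] by (simp add: L2_inner_def)
  ultimately show ?thesis by (rule LIMSEQ_unique)
qed

text \<open>The exponential moments of the step integrals are explicit, and their second exponential
  moments stay bounded because the norms converge.\<close>

lemma has_wiener_integral_exp:
  assumes "has_wiener_integral P W f Y"
  shows "square_integrable P (\<lambda>\<omega>. exp (Y \<omega>))" "expectation (\<lambda>\<omega>. exp (Y \<omega>)) = exp (L2_inner f f / 2)"
proof -
  obtain N c t where 1: "\<And>m::nat. partition (N m) (t m)"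
     "L2_tendsto unit_leb (\<lambda>m. simple_fun (N m) (c m) (t m)) f" "L2_tendsto P (\<lambda>m. simple_int (N m) (c m) (t m)) Y"
    using assms(1) unfolding has_wiener_integral_iff by blast
  define q where "q m = L2_inner (simple_fun (N m) (c m) (t m)) (simple_fun (N m) (c m) (t m))" for m
  have q: "q \<longlonglongrightarrow> L2_inner f f" unfolding q_def using L2_tendsto_inner[OF 1(2) 1(2)] by (simp add: L2_inner_def)
  have e2: "eventually (\<lambda>m. expectation (\<lambda>\<omega>. exp (2 * simple_int (N m) (c m) (t m) \<omega>)) \<le> exp (2 * (L2_inner f f + 1))) sequentially"
  proof -
    have "eventually (\<lambda>m. q m < L2_inner f f + 1) sequentially" by (rule order_tendstoD(2)[OF q]) simp
    thus ?thesis by eventually_elim (simp add: simple_int_exp(2)[OF 1(1)] q_def)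
  qed
  have e1: "(\<lambda>m. expectation (\<lambda>\<omega>. exp (simple_int (N m) (c m) (t m) \<omega>))) \<longlonglongrightarrow> exp (L2_inner f f / 2)"
    using simple_int_exp(2)[OF 1(1), of 1] tendsto_exp[OF tendsto_divide[OF q tendsto_const, of 2]]
    by (simp add: q_def)
  show "square_integrable P (\<lambda>\<omega>. exp (Y \<omega>))" "expectation (\<lambda>\<omega>. exp (Y \<omega>)) = exp (L2_inner f f / 2)"
    by (rule exp_moment_limit[OF 1(3) simple_int_exp(1)[OF 1(1)] e2 e1])+
qed

text \<open>Step functions are chosen within (1/4)^m of f in squared norm; by the isometry their
  integrals then converge at the rate that \<open>L2_complete\<close> asks for.\<close>

lemma has_wiener_integral_exists:
  assumes f: "L2_unit f"
  obtains Y where "has_wiener_integral P W f Y"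
proof -
  have "\<exists>n>0. \<exists>c. (\<integral>s. (f s - grid_step n c s)\<^sup>2 \<partial>unit_leb) < (1/4) ^ m" for m :: nat
    using L2_unit_grid_approximable[OF f] unfolding grid_approximable_def by simp
  then obtain N c where N: "\<And>m::nat. N m > 0" "\<And>m. (\<integral>s. (f s - grid_step (N m) (c m) s)\<^sup>2 \<partial>unit_leb) < (1/4) ^ m"
    by metis
  define t where "t m i = real i / real (N m)" for m i
  have p: "partition (N m) (t m)" for m
    unfolding partition_def t_def using N(1)[of m] by (auto simp: mono_on_def divide_right_mono divide_le_eq)
  have step: "grid_step (N m) (c m) = simple_fun (N m) (c m) (t m)" for m
    by (simp add: fun_eq_iff grid_step_def simple_fun_def grid_ind_def t_def)
  let ?f = "\<lambda>m. simple_fun (N m) (c m) (t m)" and ?S = "\<lambda>m. simple_int (N m) (c m) (t m)"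
  note Lf = L2_unit_simple_fun and LS = square_integrable_simple_int[OF p]
  have close: "(\<integral>s. (?f m s - f s)\<^sup>2 \<partial>unit_leb) \<le> (1/4) ^ m" for m
    using less_imp_le[OF N(2)[of m]] unfolding step by (simp add: power2_commute)
  have lim: "L2_tendsto unit_leb ?f f"
    unfolding L2_tendsto_def
  proof (intro conjI allI Lf f)
    show "(\<lambda>m. \<integral>s. (?f m s - f s)\<^sup>2 \<partial>unit_leb) \<longlonglongrightarrow> 0"
    proof (rule Lim_null_comparison)
      show "\<forall>\<^sub>F m in sequentially. norm (\<integral>s. (?f m s - f s)\<^sup>2 \<partial>unit_leb) \<le> (1/4) ^ m"
        using close by (intro always_eventually allI) simp
      show "(\<lambda>m. (1/4::real) ^ m) \<longlonglongrightarrow> 0" by (rule LIMSEQ_power_zero) simp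
    qed
  qed
  have diff: "expectation (\<lambda>\<omega>. (?S k \<omega> - ?S m \<omega>)\<^sup>2) = (\<integral>s. (?f k s - ?f m s)\<^sup>2 \<partial>unit_leb)" for k m
  proof -
    have "expectation (\<lambda>\<omega>. (?S k \<omega> - ?S m \<omega>)\<^sup>2) =
      expectation (\<lambda>\<omega>. ?S k \<omega> * ?S k \<omega> - ?S k \<omega> * ?S m \<omega> - (?S m \<omega> * ?S k \<omega> - ?S m \<omega> * ?S m \<omega>))"
      by (rule Bochner_Integration.integral_cong) (auto simp: power2_eq_square algebra_simps)
    also have "\<dots> = L2_inner (?f k) (?f k) - L2_inner (?f k) (?f m) - (L2_inner (?f m) (?f k) - L2_inner (?f m) (?f m))"
      using square_integrable_mult_integrable[OF LS LS] by (simp add: simple_isometry[OF p p] L2_inner_commute)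
    also have "\<dots> = L2_inner (\<lambda>s. ?f k s - ?f m s) (\<lambda>s. ?f k s - ?f m s)"
      by (simp add: L2_inner_diff_left L2_inner_diff_right Lf square_integrable_diff)
    finally show ?thesis by (simp add: L2_inner_def power2_eq_square)
  qed
  obtain Y where "L2_tendsto P ?S Y"
  \<comment> \<open>Both step functions are within (1/4)^m of f, and the inequality with factor 2
    gives 2 + 2 = 4.\<close>
  proof (rule L2_complete[of ?S 4])
    show "square_integrable P (?S m)" for m by (rule LS)
    fix m k :: nat assume mk: "m \<le> k"
    have "(\<integral>s. ((?f k s - f s) + (f s - ?f m s))\<^sup>2 \<partial>unit_leb) \<le>
        2 * (\<integral>s. (?f k s - f s)\<^sup>2 \<partial>unit_leb) + 2 * (\<integral>s. (f s - ?f m s)\<^sup>2 \<partial>unit_leb)"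
      by (rule L2_norm_add_le) (intro square_integrable_diff Lf f)+
    also have "\<dots> \<le> 2 * (1/4) ^ k + 2 * (1/4) ^ m" using close[of k] close[of m] by (simp add: power2_commute)
    also have "\<dots> \<le> 4 * (1/4) ^ m" using power_decreasing[OF mk, of "1/4::real"] by simp
    finally show "expectation (\<lambda>\<omega>. (?S k \<omega> - ?S m \<omega>)\<^sup>2) \<le> 4 * (1/4) ^ m" unfolding diff by simp
  qed blast
  with p lim have "has_wiener_integral P W f Y" unfolding has_wiener_integral_iff by blast
  thus ?thesis by (rule that)
qed

abbreviation WI :: "(real \<Rightarrow> real) \<Rightarrow> 'a \<Rightarrow> real" where
  "WI \<equiv> wiener_integral P W"

lemma WI: "L2_unit f \<Longrightarrow> has_wiener_integral P W f (WI f)"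
  unfolding wiener_integral_def by (metis has_wiener_integral_exists someI_ex)

lemma has_wiener_integral_L2: "has_wiener_integral P W f Y \<Longrightarrow> square_integrable P Y"
  unfolding has_wiener_integral_iff L2_tendsto_def by blast

lemma WI_L2: "L2_unit f \<Longrightarrow> square_integrable P (WI f)"
  by (rule has_wiener_integral_L2[OF WI])

lemma WI_measurable [measurable]: "L2_unit f \<Longrightarrow> WI f \<in> borel_measurable P"
  by (rule square_integrable_measurable[OF WI_L2])

lemma WI_inner: "L2_unit f \<Longrightarrow> L2_unit g \<Longrightarrow> expectation (\<lambda>\<omega>. WI f \<omega> * WI g \<omega>) = L2_inner f g"
  by (rule wiener_isometry[OF WI WI])

text \<open>By the isometry all four terms of the expanded second moment of the difference equal <f,
  f> and cancel.\<close>

lemma WI_unique: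
  assumes "has_wiener_integral P W f Y"
  shows "AE \<omega> in P. WI f \<omega> = Y \<omega>"
proof -
  have h: "has_wiener_integral P W f (WI f)"
    unfolding wiener_integral_def using assms by (rule someI[of "has_wiener_integral P W f"])
  note L = has_wiener_integral_L2[OF h] has_wiener_integral_L2[OF assms]
  have "expectation (\<lambda>\<omega>. (WI f \<omega> - Y \<omega>)\<^sup>2) =
      expectation (\<lambda>\<omega>. WI f \<omega> * WI f \<omega> - WI f \<omega> * Y \<omega> - (Y \<omega> * WI f \<omega> - Y \<omega> * Y \<omega>))"
    by (rule Bochner_Integration.integral_cong) (auto simp: power2_eq_square algebra_simps)
  also have "\<dots> = 0"
    using square_integrable_mult_integrable[OF L(1) L(1)] square_integrable_mult_integrable[OF L(1) L(2)]
      square_integrable_mult_integrable[OF L(2) L(1)] square_integrable_mult_integrable[OF L(2) L(2)]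
    by (simp add: wiener_isometry[OF h h] wiener_isometry[OF h assms] wiener_isometry[OF assms h] wiener_isometry[OF assms assms])
  finally have "AE \<omega> in P. WI f \<omega> - Y \<omega> = 0"
    by (rule has_integral_zero_square_AE[OF square_integrable_diff[OF L]])
  thus ?thesis by eventually_elim simp
qed

text \<open>Linearity follows from the isometry: the second moment of the difference is a
  combination of inner products that cancels.\<close>

lemma WI_add:
  assumes f: "L2_unit f" and g: "L2_unit g"
  shows "AE \<omega> in P. WI (\<lambda>s. f s + g s) \<omega> = WI f \<omega> + WI g \<omega>"
proof -
  let ?h = "\<lambda>s. f s + g s"
  have h: "L2_unit ?h" by (rule square_integrable_add[OF f g])
  note L = WI_L2[OF f] WI_L2[OF g] WI_L2[OF h]
  have "expectation (\<lambda>\<omega>. (WI ?h \<omega> - (WI f \<omega> + WI g \<omega>))\<^sup>2) =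
      expectation (\<lambda>\<omega>. WI ?h \<omega> * WI ?h \<omega> - 2 * (WI ?h \<omega> * WI f \<omega>) - 2 * (WI ?h \<omega> * WI g \<omega>) +
        WI f \<omega> * WI f \<omega> + 2 * (WI f \<omega> * WI g \<omega>) + WI g \<omega> * WI g \<omega>)"
    by (rule Bochner_Integration.integral_cong) (auto simp: power2_eq_square algebra_simps)
  also have "\<dots> = L2_inner ?h ?h - 2 * L2_inner ?h f - 2 * L2_inner ?h g + L2_inner f f + 2 * L2_inner f g + L2_inner g g"
    by (simp add: square_integrable_mult_integrable L WI_inner f g h)
  also have "\<dots> = 0"
    by (simp add: L2_inner_add_left L2_inner_add_right f g h L2_inner_commute[of g f])
  finally have "AE \<omega> in P. WI ?h \<omega> - (WI f \<omega> + WI g \<omega>) = 0"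
    by (intro has_integral_zero_square_AE square_integrable_diff square_integrable_add L)
  thus ?thesis by eventually_elim simp
qed

lemma WI_scale:
  assumes f: "L2_unit f"
  shows "AE \<omega> in P. WI (\<lambda>s. c * f s) \<omega> = c * WI f \<omega>"
proof -
  let ?h = "\<lambda>s. c * f s"
  have h: "L2_unit ?h" by (rule square_integrable_scale[OF f])
  note L = WI_L2[OF f] WI_L2[OF h]
  have "expectation (\<lambda>\<omega>. (WI ?h \<omega> - c * WI f \<omega>)\<^sup>2) =
      expectation (\<lambda>\<omega>. WI ?h \<omega> * WI ?h \<omega> - (2 * c) * (WI ?h \<omega> * WI f \<omega>) + c\<^sup>2 * (WI f \<omega> * WI f \<omega>))"
    by (rule Bochner_Integration.integral_cong) (auto simp: power2_eq_square algebra_simps)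
  also have "\<dots> = L2_inner ?h ?h - (2 * c) * L2_inner ?h f + c\<^sup>2 * L2_inner f f"
    by (simp add: square_integrable_mult_integrable L WI_inner f h)
  also have "\<dots> = 0"
    by (simp add: L2_inner_scale_left L2_inner_scale_right power2_eq_square)
  finally have "AE \<omega> in P. WI ?h \<omega> - c * WI f \<omega> = 0"
    by (intro has_integral_zero_square_AE square_integrable_diff square_integrable_scale L)
  thus ?thesis by eventually_elim simp
qed

lemma WI_sum:
  assumes "finite J" "\<And>i. i \<in> J \<Longrightarrow> L2_unit (f i)"
  shows "AE \<omega> in P. WI (\<lambda>s. \<Sum>i\<in>J. c i * f i s) \<omega> = (\<Sum>i\<in>J. c i * WI (f i) \<omega>)"
  using assms
proof (induction J rule: finite_induct)
  case empty
  show ?case using WI_scale[OF square_integrable_zero, of 0] by simp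
next
  case (insert j J)
  have L: "L2_unit (\<lambda>s. c j * f j s)" "L2_unit (\<lambda>s. \<Sum>i\<in>J. c i * f i s)"
    using insert by (auto intro!: square_integrable_scale square_integrable_sum)
  have "AE \<omega> in P. WI (\<lambda>s. \<Sum>i\<in>J. c i * f i s) \<omega> = (\<Sum>i\<in>J. c i * WI (f i) \<omega>)" using insert by auto
  moreover note WI_add[OF L] WI_scale[OF insert.prems[OF insertI1], of "c j"]
  ultimately show ?case
    by eventually_elim (use insert in simp)
qed

text \<open>The indicator is a step function with one interval, and W 0 = 0 almost surely.\<close>

lemma WI_indicator:
  assumes t: "t \<in> {0..1}"
  shows "AE \<omega> in P. WI (indicator {0<..t}) \<omega> = W t \<omega>"
proof -
  define u where "u i = (if i = (0::nat) then 0 else t)" for i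
  have p: "partition 1 u" using t by (auto simp: partition_def mono_on_def u_def)
  have sf: "simple_fun 1 (\<lambda>_. 1) u = indicator {0<..t}" by (simp add: simple_fun_def u_def)
  have "has_wiener_integral P W (indicator {0<..t}) (simple_int 1 (\<lambda>_. 1) u)"
    unfolding has_wiener_integral_iff
    by (intro exI[of _ "\<lambda>_. 1"] exI[of _ "\<lambda>_ _. 1"] exI[of _ "\<lambda>_. u"] conjI allI p)
       (auto simp only: sf intro!: L2_tendsto_const L2_unit_indicator square_integrable_simple_int p)
  from WI_unique[OF this] start_zero show ?thesis
    by eventually_elim (simp add: simple_int_def u_def)
qed

end

subsection \<open>The second moment as a power series\<close>

text \<open>The product majorant makes the double series absolutely summable over all pairs, so it
  may be summed by rows or by antidiagonals.\<close>

lemma triangle_sums: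
  fixes F :: "nat \<Rightarrow> nat \<Rightarrow> real"
  assumes bound: "\<And>j m. \<bar>F j m\<bar> \<le> g j * h m" and g: "summable g" and h: "summable h"
    and nn: "\<And>j. 0 \<le> g j" "\<And>m. 0 \<le> h m"
    and rows: "\<And>j. F j sums G j"
  shows "(\<lambda>k. \<Sum>j\<le>k. F j (k - j)) sums suminf G" "summable G"
proof -
  have hs: "(h has_sum suminf h) UNIV" "(g has_sum suminf g) UNIV"
    using g h nn by (auto intro!: norm_summable_imp_has_sum summable_sums)
  have gh: "(\<lambda>(j, m). g j * h m) summable_on (UNIV \<times> UNIV)"
  proof (rule summable_on_SigmaI)
    show "((\<lambda>m. (case (j, m) of (j, m) \<Rightarrow> g j * h m)) has_sum g j * suminf h) UNIV" for j
      using has_sum_cmult_right[OF hs(1), of "g j"] by simp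
    show "(\<lambda>j. g j * suminf h) summable_on UNIV"
      using has_sum_cmult_left[OF hs(2), of "suminf h"] by (rule has_sum_imp_summable)
  qed (use nn in auto)
  have "(\<lambda>p. norm ((\<lambda>(j, m). F j m) p)) summable_on (UNIV \<times> UNIV)"
    by (rule summable_on_comparison_test[OF gh]) (use bound in auto)
  hence "(\<lambda>(j, m). F j m) summable_on (UNIV \<times> UNIV)" by (rule abs_summable_summable)
  then obtain S where S: "((\<lambda>(j, m). F j m) has_sum S) (UNIV \<times> UNIV)" by (auto simp: summable_on_def)
  have row: "(F j has_sum G j) UNIV" for j
  proof (rule norm_summable_imp_has_sum[OF _ rows])
    show "summable (\<lambda>m. norm (F j m))"
      by (rule summable_comparison_test'[OF summable_mult[OF h, of "g j"], of 0]) (use bound in auto)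
  qed
  have GS: "(G has_sum S) UNIV" by (rule has_sum_SigmaD[OF S]) (use row in auto)
  hence G: "G sums S" by (rule has_sum_imp_sums)
  thus "summable G" by (rule sums_summable)
  have "((\<lambda>(k, j). F j (k - j)) has_sum S) (SIGMA k:UNIV. {..k})"
    by (rule has_sum_reindex_bij_witness[where i = "\<lambda>(j, m). (j + m, j)" and j = "\<lambda>(k, j). (j, k - j)", THEN iffD2, OF _ _ _ _ _ refl S]) auto
  from has_sum_SigmaD[OF this, of "\<lambda>k. \<Sum>j\<le>k. F j (k - j)"]
  have "((\<lambda>k. \<Sum>j\<le>k. F j (k - j)) has_sum S) UNIV" by auto
  from has_sum_imp_sums[OF this] show "(\<lambda>k. \<Sum>j\<le>k. F j (k - j)) sums suminf G"
    using sums_unique[OF G] by simp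
qed

lemma summable_exp_power: "summable (\<lambda>j. C * (y::real) ^ j / fact j)"
  using summable_mult[OF sums_summable[OF exp_sums_real[of y]], of C] by simp

lemma egf_zero: "egf a 0 = a 0"
  unfolding egf_def by (subst suminf_finite[of "{0}"]) auto

text \<open>The Taylor expansion around y, where shifted coefficients are derivatives; the
  antidiagonals of the double series are binomial sums.\<close>

lemma egf_Taylor:
  assumes "geom_bounded b"
  shows "(\<lambda>j. egf (\<lambda>k. b (k + j)) y * z ^ j / fact j) sums egf b (y + z)"
proof -
  obtain C R where 1: "C \<ge> 0" "R \<ge> 0" "\<And>k. \<bar>b k\<bar> \<le> C * R ^ k" using assms by (rule geom_boundedE) blast
  define F where "F j m = (z ^ j / fact j) * (b (m + j) * y ^ m / fact m)" for j m
  define G where "G j = (z ^ j / fact j) * egf (\<lambda>k. b (k + j)) y" for j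
  have bd: "\<bar>F j m\<bar> \<le> (C * (R * \<bar>z\<bar>) ^ j / fact j) * ((R * \<bar>y\<bar>) ^ m / fact m)" for j m
  proof -
    have "\<bar>F j m\<bar> = \<bar>b (m + j)\<bar> * (\<bar>z\<bar> ^ j / fact j * (\<bar>y\<bar> ^ m / fact m))"
      by (simp add: F_def abs_mult power_abs)
    also have "\<dots> \<le> (C * R ^ (m + j)) * (\<bar>z\<bar> ^ j / fact j * (\<bar>y\<bar> ^ m / fact m))"
      by (intro mult_right_mono 1(3)) auto
    finally show ?thesis by (simp add: power_add power_mult_distrib mult_ac)
  qed
  have rows: "F j sums G j" for j
    unfolding F_def G_def by (intro sums_mult egf_sums geom_bounded_shift assms)
  note T = triangle_sums[of F "\<lambda>j. C * (R * \<bar>z\<bar>) ^ j / fact j" "\<lambda>m. (R * \<bar>y\<bar>) ^ m / fact m" G, OF bd summable_exp_power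
      sums_summable[OF exp_sums_real] _ _ rows]
  have "(\<lambda>k. \<Sum>j\<le>k. F j (k - j)) = (\<lambda>k. b k * (y + z) ^ k / fact k)"
  proof
    fix k
    have "(\<Sum>j\<le>k. F j (k - j)) = (\<Sum>j\<le>k. b k / fact k * (of_nat (k choose j) * z ^ j * y ^ (k - j)))"
      by (intro sum.cong refl) (simp add: F_def binomial_fact field_simps)
    also have "\<dots> = b k / fact k * (z + y) ^ k"
      by (simp add: binomial_ring sum_distrib_left)
    finally show "(\<Sum>j\<le>k. F j (k - j)) = b k * (y + z) ^ k / fact k" by (simp add: add.commute)
  qed
  hence "(\<lambda>k. b k * (y + z) ^ k / fact k) sums suminf G" using T(1) 1 by simp
  from sums_unique2[OF this egf_sums[OF assms]] have "suminf G = egf b (y + z)" .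
  moreover have "summable G" using T(2) 1 by simp
  ultimately have "G sums egf b (y + z)" using summable_sums by metis
  thus ?thesis by (simp add: G_def[abs_def] mult.commute)
qed

text \<open>\<open>exp \<langle>\<sigma>, \<tau>\<rangle> * fock_pairing a b \<langle>f, h\<rangle> \<langle>f, \<tau>\<rangle> \<langle>h, \<sigma>\<rangle>\<close> is the \<open>L\<^sup>2\<close> inner product of the functionals with
  coefficients \<open>a, b\<close> in \<open>I(f), I(h)\<close>, Wick multiplied by \<open>exp\<^sup>\<diamond>(I(\<sigma>))\<close> and \<open>exp\<^sup>\<diamond>(I(\<tau>))\<close>.\<close>

definition fock_pairing :: "(nat \<Rightarrow> real) \<Rightarrow> (nat \<Rightarrow> real) \<Rightarrow> real \<Rightarrow> real \<Rightarrow> real \<Rightarrow> real" where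
  "fock_pairing a b x u y = (\<Sum>j. x ^ j / fact j * (egf (\<lambda>k. a (k + j)) u * egf (\<lambda>k. b (k + j)) y))"

text \<open>k! times the k-th Taylor coefficient in t of exp (t u) times
  \<open>egf b (y + t * x)\<close>, which arises when the S-transform of a functional is evaluated
  along \<sigma> + t f.\<close>

definition exp_egf_coeff :: "(nat \<Rightarrow> real) \<Rightarrow> real \<Rightarrow> real \<Rightarrow> real \<Rightarrow> nat \<Rightarrow> real" where
  "exp_egf_coeff b x u y k = fact k * (\<Sum>j\<le>k. (egf (\<lambda>k. b (k + j)) y * x ^ j / fact j) * (u ^ (k - j) / fact (k - j)))"

lemma exp_egf_coeff_sums:
  assumes b: "geom_bounded b"
  shows "(\<lambda>k. exp_egf_coeff b x u y k * t ^ k / fact k) sums (exp (t * u) * egf b (y + t * x))"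
proof -
  obtain C R where 1: "C \<ge> 0" "R \<ge> 0" "\<And>k. \<bar>b k\<bar> \<le> C * R ^ k" using b by (rule geom_boundedE) blast
  have s1: "summable (\<lambda>j. norm (egf (\<lambda>k. b (k + j)) y * (t * x) ^ j / fact j))"
  proof (rule summable_comparison_test'[OF summable_exp_power[of "C * exp (R * \<bar>y\<bar>)" "R * \<bar>t * x\<bar>"], of 0])
    fix j
    have "\<bar>egf (\<lambda>k. b (k + j)) y\<bar> * \<bar>t * x\<bar> ^ j \<le> (C * R ^ j * exp (R * \<bar>y\<bar>)) * \<bar>t * x\<bar> ^ j"
      by (intro mult_right_mono egf_shift_bound[OF 1]) auto
    thus "norm (norm (egf (\<lambda>k. b (k + j)) y * (t * x) ^ j / fact j)) \<le> C * exp (R * \<bar>y\<bar>) * (R * \<bar>t * x\<bar>) ^ j / fact j"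
      by (simp add: abs_mult power_abs power_mult_distrib divide_right_mono mult_ac)
  qed
  have s2: "summable (\<lambda>i. norm ((t * u) ^ i / fact i))"
    using sums_summable[OF exp_sums_real[of "\<bar>t * u\<bar>"]] by (simp add: power_abs)
  from Cauchy_product_sums[OF s1 s2]
  have "(\<lambda>k. \<Sum>j\<le>k. (egf (\<lambda>k. b (k + j)) y * (t * x) ^ j / fact j) * ((t * u) ^ (k - j) / fact (k - j))) sums
      (egf b (y + t * x) * exp (t * u))"
    by (simp only: sums_unique[OF egf_Taylor[OF b], symmetric] sums_unique[OF exp_sums_real, symmetric])
  also have "(\<lambda>k. \<Sum>j\<le>k. (egf (\<lambda>k. b (k + j)) y * (t * x) ^ j / fact j) * ((t * u) ^ (k - j) / fact (k - j))) =
      (\<lambda>k. exp_egf_coeff b x u y k * t ^ k / fact k)"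
  proof
    fix k
    have "(egf (\<lambda>k. b (k + j)) y * (t * x) ^ j / fact j) * ((t * u) ^ (k - j) / fact (k - j)) =
        (egf (\<lambda>k. b (k + j)) y * x ^ j / fact j) * (u ^ (k - j) / fact (k - j)) * t ^ k" if "j \<le> k" for j
    proof -
      have "t ^ k = t ^ j * t ^ (k - j)" using that by (simp add: power_add[symmetric])
      thus ?thesis by (simp add: power_mult_distrib)
    qed
    hence "(\<Sum>j\<le>k. (egf (\<lambda>k. b (k + j)) y * (t * x) ^ j / fact j) * ((t * u) ^ (k - j) / fact (k - j))) =
       (\<Sum>j\<le>k. (egf (\<lambda>k. b (k + j)) y * x ^ j / fact j) * (u ^ (k - j) / fact (k - j)) * t ^ k)"
      by (intro sum.cong[OF refl]) (simp only: atMost_iff)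
    also have "\<dots> = exp_egf_coeff b x u y k * t ^ k / fact k"
      by (simp add: exp_egf_coeff_def sum_distrib_right)
    finally show "(\<Sum>j\<le>k. (egf (\<lambda>k. b (k + j)) y * (t * x) ^ j / fact j) * ((t * u) ^ (k - j) / fact (k - j))) =
      exp_egf_coeff b x u y k * t ^ k / fact k" .
  qed
  finally show ?thesis by (simp add: mult.commute)
qed

text \<open>Exchanging the order of summation collects, for each j, the power series of the j-th
  derivative of \<open>egf a\<close> at u.\<close>

lemma exp_egf_coeff_pairing:
  assumes a: "geom_bounded a" and b: "geom_bounded b"
  shows "(\<lambda>k. a k * exp_egf_coeff b x u y k / fact k) sums fock_pairing a b x u y"
proof -
  obtain C R where 1: "C \<ge> 0" "R \<ge> 0" "\<And>k. \<bar>a k\<bar> \<le> C * R ^ k" using a by (rule geom_boundedE) blast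
  obtain D S where 2: "D \<ge> 0" "S \<ge> 0" "\<And>k. \<bar>b k\<bar> \<le> D * S ^ k" using b by (rule geom_boundedE) blast
  define F where "F j m = (egf (\<lambda>k. b (k + j)) y * x ^ j / fact j) * (a (m + j) * u ^ m / fact m)" for j m
  define G where "G j = (egf (\<lambda>k. b (k + j)) y * x ^ j / fact j) * egf (\<lambda>k. a (k + j)) u" for j
  let ?K = "C * D * exp (S * \<bar>y\<bar>)"
  have K: "?K \<ge> 0" using 1 2 by simp
  have bd: "\<bar>F j m\<bar> \<le> (?K * (R * S * \<bar>x\<bar>) ^ j / fact j) * ((R * \<bar>u\<bar>) ^ m / fact m)" for j m
  proof -
    have "\<bar>F j m\<bar> = (\<bar>egf (\<lambda>k. b (k + j)) y\<bar> * \<bar>a (m + j)\<bar>) * (\<bar>x\<bar> ^ j / fact j * (\<bar>u\<bar> ^ m / fact m))"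
      by (simp add: F_def abs_mult power_abs)
    also have "\<dots> \<le> ((D * S ^ j * exp (S * \<bar>y\<bar>)) * (C * R ^ (m + j))) * (\<bar>x\<bar> ^ j / fact j * (\<bar>u\<bar> ^ m / fact m))"
      by (intro mult_right_mono mult_mono egf_shift_bound[OF 2] 1(3)) (use 1 2 in auto)
    finally show ?thesis by (simp add: power_add power_mult_distrib mult_ac)
  qed
  have rows: "F j sums G j" for j
    unfolding F_def G_def by (intro sums_mult egf_sums geom_bounded_shift a)
  note T = triangle_sums[of F "\<lambda>j. ?K * (R * S * \<bar>x\<bar>) ^ j / fact j" "\<lambda>m. (R * \<bar>u\<bar>) ^ m / fact m" G, OF bd summable_exp_power
      sums_summable[OF exp_sums_real] _ _ rows]
  have "(\<lambda>k. \<Sum>j\<le>k. F j (k - j)) = (\<lambda>k. a k * exp_egf_coeff b x u y k / fact k)"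
  proof
    fix k
    have "a k * exp_egf_coeff b x u y k / fact k =
        a k * (\<Sum>j\<le>k. (egf (\<lambda>k. b (k + j)) y * x ^ j / fact j) * (u ^ (k - j) / fact (k - j)))"
      by (simp add: exp_egf_coeff_def)
    also have "\<dots> = (\<Sum>j\<le>k. F j (k - j))"
      unfolding sum_distrib_left by (intro sum.cong refl) (simp add: F_def)
    finally show "(\<Sum>j\<le>k. F j (k - j)) = a k * exp_egf_coeff b x u y k / fact k" ..
  qed
  moreover have "suminf G = fock_pairing a b x u y"
    by (simp add: G_def[abs_def] fock_pairing_def mult_ac)
  ultimately show ?thesis using T(1) K 1 2 by (simp add: mult_nonneg_nonneg)
qed

lemma fock_pairing_summable:
  assumes a: "geom_bounded a" and b: "geom_bounded b"
  shows "summable (\<lambda>j. x ^ j / fact j * (egf (\<lambda>k. a (k + j)) u * egf (\<lambda>k. b (k + j)) y))"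
proof -
  obtain C R where 1: "C \<ge> 0" "R \<ge> 0" "\<And>k. \<bar>a k\<bar> \<le> C * R ^ k" using a by (rule geom_boundedE) blast
  obtain D S where 2: "D \<ge> 0" "S \<ge> 0" "\<And>k. \<bar>b k\<bar> \<le> D * S ^ k" using b by (rule geom_boundedE) blast
  show ?thesis
  proof (rule summable_comparison_test'[OF summable_exp_power[of "C * exp (R * \<bar>u\<bar>) * (D * exp (S * \<bar>y\<bar>))" "R * S * \<bar>x\<bar>"], of 0])
    fix j
    have "\<bar>x\<bar> ^ j / fact j * (\<bar>egf (\<lambda>k. a (k + j)) u\<bar> * \<bar>egf (\<lambda>k. b (k + j)) y\<bar>) \<le>
       \<bar>x\<bar> ^ j / fact j * ((C * R ^ j * exp (R * \<bar>u\<bar>)) * (D * S ^ j * exp (S * \<bar>y\<bar>)))"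
      by (intro mult_left_mono mult_mono egf_shift_bound[OF 1] egf_shift_bound[OF 2]) (use 1 2 in auto)
    thus "norm (x ^ j / fact j * (egf (\<lambda>k. a (k + j)) u * egf (\<lambda>k. b (k + j)) y)) \<le>
        C * exp (R * \<bar>u\<bar>) * (D * exp (S * \<bar>y\<bar>)) * (R * S * \<bar>x\<bar>) ^ j / fact j"
      by (simp add: abs_mult power_abs power_mult_distrib mult_ac)
  qed
qed

lemma fock_pairing_add_left:
  assumes "geom_bounded a" "geom_bounded a'" "geom_bounded b"
  shows "fock_pairing (\<lambda>k. a k + a' k) b x u y = fock_pairing a b x u y + fock_pairing a' b x u y"
proof -
  have "egf (\<lambda>k. a (k + j) + a' (k + j)) u = egf (\<lambda>k. a (k + j)) u + egf (\<lambda>k. a' (k + j)) u" for j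
    by (rule egf_add) (intro geom_bounded_shift assms)+
  thus ?thesis unfolding fock_pairing_def
    by (subst suminf_add[OF fock_pairing_summable fock_pairing_summable]) (simp_all add: assms algebra_simps)
qed

lemma fock_pairing_scale_left:
  assumes "geom_bounded a" "geom_bounded b"
  shows "fock_pairing (\<lambda>k. c * a k) b x u y = c * fock_pairing a b x u y"
proof -
  have "egf (\<lambda>k. c * a (k + j)) u = c * egf (\<lambda>k. a (k + j)) u" for j
    by (rule egf_scale) (intro geom_bounded_shift assms)
  thus ?thesis unfolding fock_pairing_def
    by (subst suminf_mult[OF fock_pairing_summable[OF assms], symmetric]) (simp add: mult_ac)
qed

lemma fock_pairing_commute: "fock_pairing a b x u y = fock_pairing b a x y u"
  by (simp add: fock_pairing_def mult.commute)

text \<open>Caratheodory's form of the derivative avoids division by x0 - x n, which may be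
  0.\<close>

lemma scaled_difference_limit:
  fixes p :: "real \<Rightarrow> real"
  assumes p: "(p has_real_derivative D) (at x0)" and x: "x \<longlonglongrightarrow> x0" and l: "(\<lambda>n. s n * (x0 - x n)) \<longlonglongrightarrow> l"
  shows "(\<lambda>n. s n * (p x0 - p (x n))) \<longlonglongrightarrow> l * D"
proof -
  obtain g where g: "\<And>z. p z - p x0 = g z * (z - x0)" "isCont g x0" "g x0 = D"
    using p unfolding CARAT_DERIV by blast
  have "(\<lambda>n. g (x n)) \<longlonglongrightarrow> g x0" by (rule isCont_tendsto_compose[OF g(2) x])
  from tendsto_mult[OF l this] have "(\<lambda>n. s n * (x0 - x n) * g (x n)) \<longlonglongrightarrow> l * D" using g(3) by simp
  moreover have "s n * (x0 - x n) * g (x n) = s n * (p x0 - p (x n))" for n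
  proof -
    have "p x0 - p (x n) = (x0 - x n) * g (x n)" using g(1)[of "x n"] by (simp add: algebra_simps)
    thus ?thesis by simp
  qed
  ultimately show ?thesis by simp
qed

text \<open>The crude (2 X)^j stands in for j X^(j - 1): a purely geometric factor fits a majorant
  that is summable thanks to 1 / j!.\<close>

lemma abs_power_diff_le:
  fixes x y X :: real
  assumes "\<bar>x\<bar> \<le> X" "\<bar>y\<bar> \<le> X" "1 \<le> X"
  shows "\<bar>x ^ j - y ^ j\<bar> \<le> (2 * X) ^ j * \<bar>x - y\<bar>"
proof (induction j)
  case (Suc j)
  have "\<bar>x ^ Suc j - y ^ Suc j\<bar> = \<bar>x * (x ^ j - y ^ j) + (x - y) * y ^ j\<bar>" by (simp add: algebra_simps)
  also have "\<dots> \<le> \<bar>x\<bar> * \<bar>x ^ j - y ^ j\<bar> + \<bar>x - y\<bar> * \<bar>y\<bar> ^ j"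
    by (rule order_trans[OF abs_triangle_ineq]) (simp add: abs_mult power_abs)
  also have "\<dots> \<le> X * ((2 * X) ^ j * \<bar>x - y\<bar>) + \<bar>x - y\<bar> * (X * (2 * X) ^ j)"
  proof (intro add_mono mult_mono assms Suc mult_left_mono)
    have "\<bar>y\<bar> ^ j \<le> X ^ j" using assms by (intro power_mono) auto
    also have "\<dots> \<le> (2 * X) ^ j" using assms by (intro power_mono) auto
    also have "\<dots> \<le> X * (2 * X) ^ j" using mult_right_mono[OF assms(3), of "(2 * X) ^ j"] assms by simp
    finally show "\<bar>y\<bar> ^ j \<le> X * (2 * X) ^ j" .
  qed (use assms in auto)
  also have "\<dots> = (2 * X) ^ Suc j * \<bar>x - y\<bar>" by simp
  finally show ?case .
qed simp

text \<open>Tannery's theorem: each term of the series in j converges by differentiation in x and y,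
  and geometric bounds divided by j! dominate the terms uniformly in n.\<close>

theorem fock_pairing_limit:
  assumes a: "geom_bounded a"
    and X: "(\<lambda>n. (real n)\<^sup>2 * (x0 - x n)) \<longlonglongrightarrow> \<xi>" and Y: "(\<lambda>n. (real n)\<^sup>2 * (y0 - y n)) \<longlonglongrightarrow> \<eta>"
    and x: "x \<longlonglongrightarrow> x0" and y: "y \<longlonglongrightarrow> y0"
  shows "(\<lambda>n. (real n)\<^sup>2 * (fock_pairing a a x0 y0 y0 - fock_pairing a a (x n) (y n) (y n))) \<longlonglongrightarrow>
     \<xi> * fock_pairing (\<lambda>k. a (k + 1)) (\<lambda>k. a (k + 1)) x0 y0 y0 + 2 * \<eta> * fock_pairing (\<lambda>k. a (k + 1)) a x0 y0 y0"
proof -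
  obtain C R where 1: "C \<ge> 0" "R \<ge> 0" "\<And>k. \<bar>a k\<bar> \<le> C * R ^ k" using a by (rule geom_boundedE) blast
  define E where "E j = egf (\<lambda>k. a (k + j))" for j
  have dE: "(E j has_real_derivative E (Suc j) z) (at z)" for j z
    unfolding E_def using DERIV_egf[OF geom_bounded_shift[OF a, of j], of z] by (simp add: add_ac)
  \<comment> \<open>The product rule for the j-th term. For j = 0 the factor \<open>real j\<close>
    removes the first summand, where the exponent j - 1 is truncated to 0.\<close>
  define b where "b j = real j * x0 ^ (j - 1) / fact j * \<xi> * (E j y0)\<^sup>2 + x0 ^ j / fact j * (\<eta> * (2 * E j y0 * E (Suc j) y0))" for j
  define T where "T j n = (real n)\<^sup>2 * (x0 ^ j / fact j * (E j y0)\<^sup>2 - (x n) ^ j / fact j * (E j (y n))\<^sup>2)" for j n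
  have lim: "T j \<longlonglongrightarrow> b j" for j
  proof -
    have d1: "((\<lambda>z. z ^ j / fact j) has_real_derivative real j * x0 ^ (j - 1) / fact j) (at x0)"
      by (auto intro!: derivative_eq_intros)
    have d2: "((\<lambda>z. (E j z)\<^sup>2) has_real_derivative 2 * E j y0 * E (Suc j) y0) (at y0)"
      using dE[of j y0] by (auto intro!: derivative_eq_intros)
    have "(\<lambda>n. (real n)\<^sup>2 * (x0 ^ j / fact j - x n ^ j / fact j) * (E j y0)\<^sup>2 +
        x n ^ j / fact j * ((real n)\<^sup>2 * ((E j y0)\<^sup>2 - (E j (y n))\<^sup>2))) \<longlonglongrightarrow>
        \<xi> * (real j * x0 ^ (j - 1) / fact j) * (E j y0)\<^sup>2 + x0 ^ j / fact j * (\<eta> * (2 * E j y0 * E (Suc j) y0))"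
      by (intro tendsto_intros scaled_difference_limit[OF d1 x X] scaled_difference_limit[OF d2 y Y] x) simp
    thus ?thesis unfolding T_def b_def by (simp add: algebra_simps)
  qed
  obtain X1 where X1: "\<And>n. \<bar>x n\<bar> \<le> X1" using convergent_imp_Bseq[OF convergentI[OF x]] unfolding Bseq_def by auto
  obtain Y1 where Y1: "\<And>n. \<bar>y n\<bar> \<le> Y1" using convergent_imp_Bseq[OF convergentI[OF y]] unfolding Bseq_def by auto
  obtain K1 where K1: "\<And>n. \<bar>(real n)\<^sup>2 * (x0 - x n)\<bar> \<le> K1" using convergent_imp_Bseq[OF convergentI[OF X]] unfolding Bseq_def by auto
  obtain K2 where K2: "\<And>n. \<bar>(real n)\<^sup>2 * (y0 - y n)\<bar> \<le> K2" using convergent_imp_Bseq[OF convergentI[OF Y]] unfolding Bseq_def by auto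
  define M where "M = max (max X1 \<bar>x0\<bar>) 1"
  define N where "N = max Y1 \<bar>y0\<bar>"
  have M: "1 \<le> M" "\<bar>x0\<bar> \<le> M" "\<bar>x n\<bar> \<le> M" for n using X1[of n] by (auto simp: M_def)
  have N: "\<bar>y0\<bar> \<le> N" "\<bar>y n\<bar> \<le> N" for n using Y1[of n] by (auto simp: N_def)
  \<comment> \<open>\<open>B * R ^ j\<close> bounds \<open>E j\<close> on the interval [-N, N],
    which contains y0 and all y n.\<close>
  define B where "B = C * exp (R * N)"
  have B0: "B \<ge> 0" using 1 by (simp add: B_def)
  have K0: "K1 \<ge> 0" "K2 \<ge> 0" using K1[of 0] K2[of 0] by auto
  have Eb: "\<bar>E j z\<bar> \<le> B * R ^ j" if "\<bar>z\<bar> \<le> N" for j z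
  proof -
    have "\<bar>E j z\<bar> \<le> C * R ^ j * exp (R * \<bar>z\<bar>)" unfolding E_def by (rule egf_shift_bound[OF 1])
    also have "\<dots> \<le> C * R ^ j * exp (R * N)" using 1 that by (intro mult_left_mono) (auto intro: mult_left_mono)
    finally show ?thesis by (simp add: B_def mult_ac)
  qed
  have Ed: "\<bar>E j y0 - E j (y n)\<bar> \<le> B * R ^ Suc j * \<bar>y0 - y n\<bar>" for j n
  proof -
    have "norm (E j y0 - E j (y n)) \<le> B * R ^ Suc j * norm (y0 - y n)"
    proof (rule field_differentiable_bound[of "{- N..N}" "E j" "E (Suc j)"])
      fix z assume "z \<in> {- N..N}"
      hence z: "\<bar>z\<bar> \<le> N" by auto
      show "norm (E (Suc j) z) \<le> B * R ^ Suc j" using Eb[OF z, of "Suc j"] by (simp only: real_norm_def)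
      show "(E j has_real_derivative E (Suc j) z) (at z within {- N..N})"
        using dE by (rule has_field_derivative_at_within)
    qed (use N(1) N(2)[of n] in auto)
    thus ?thesis by simp
  qed
  have bound: "norm (T j n) \<le> (K1 * B\<^sup>2 + 2 * B\<^sup>2 * R * K2) * (2 * M * R\<^sup>2) ^ j / fact j" for j n
  proof -
    have "fact j * T j n = (real n)\<^sup>2 * (x0 ^ j - x n ^ j) * (E j y0)\<^sup>2 +
        x n ^ j * (((real n)\<^sup>2 * (E j y0 - E j (y n))) * (E j y0 + E j (y n)))"
      by (simp add: T_def field_simps power2_eq_square)
    moreover have "\<bar>(real n)\<^sup>2 * (x0 ^ j - x n ^ j) * (E j y0)\<^sup>2\<bar> \<le> ((2 * M) ^ j * K1) * (B * R ^ j)\<^sup>2"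
      unfolding abs_mult
    proof (rule mult_mono)
      have "\<bar>(real n)\<^sup>2\<bar> * \<bar>x0 ^ j - x n ^ j\<bar> \<le> \<bar>(real n)\<^sup>2\<bar> * ((2 * M) ^ j * \<bar>x0 - x n\<bar>)"
        by (intro mult_left_mono abs_power_diff_le M) auto
      also have "\<dots> = (2 * M) ^ j * \<bar>(real n)\<^sup>2 * (x0 - x n)\<bar>" by (simp add: abs_mult)
      also have "\<dots> \<le> (2 * M) ^ j * K1" using M by (intro mult_left_mono K1) auto
      finally show "\<bar>(real n)\<^sup>2\<bar> * \<bar>x0 ^ j - x n ^ j\<bar> \<le> (2 * M) ^ j * K1" .
      show "\<bar>(E j y0)\<^sup>2\<bar> \<le> (B * R ^ j)\<^sup>2" using power_mono[OF Eb[OF N(1)], of j 2] by simp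
    qed (use M K0 in auto)
    moreover have "\<bar>x n ^ j * (((real n)\<^sup>2 * (E j y0 - E j (y n))) * (E j y0 + E j (y n)))\<bar> \<le>
        (2 * M) ^ j * ((B * R ^ Suc j * K2) * (2 * (B * R ^ j)))"
      unfolding abs_mult
    proof (rule mult_mono[OF _ mult_mono])
      have "\<bar>x n\<bar> ^ j \<le> (2 * M) ^ j" using M(1) M(3)[of n] by (intro power_mono) auto
      thus "\<bar>x n ^ j\<bar> \<le> (2 * M) ^ j" by (simp add: power_abs)
      have "\<bar>(real n)\<^sup>2\<bar> * \<bar>E j y0 - E j (y n)\<bar> \<le> \<bar>(real n)\<^sup>2\<bar> * (B * R ^ Suc j * \<bar>y0 - y n\<bar>)"
        by (intro mult_left_mono Ed) auto
      also have "\<dots> = B * R ^ Suc j * \<bar>(real n)\<^sup>2 * (y0 - y n)\<bar>" by (simp add: abs_mult)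
      also have "\<dots> \<le> B * R ^ Suc j * K2" using B0 1 by (intro mult_left_mono K2) auto
      finally show "\<bar>(real n)\<^sup>2\<bar> * \<bar>E j y0 - E j (y n)\<bar> \<le> B * R ^ Suc j * K2" .
      show "\<bar>E j y0 + E j (y n)\<bar> \<le> 2 * (B * R ^ j)" using Eb[OF N(1), of j] Eb[OF N(2)[of n], of j] by linarith
    qed (use M B0 1 K0 in auto)
    ultimately have "\<bar>fact j * T j n\<bar> \<le> ((2 * M) ^ j * K1) * (B * R ^ j)\<^sup>2 + (2 * M) ^ j * ((B * R ^ Suc j * K2) * (2 * (B * R ^ j)))"
      by linarith
    also have "\<dots> = (K1 * B\<^sup>2 + 2 * B\<^sup>2 * R * K2) * (2 * M * R\<^sup>2) ^ j"
      by (simp add: power_mult_distrib power2_eq_square algebra_simps)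
    finally show ?thesis by (simp add: abs_mult field_simps)
  qed
  have tan: "(\<lambda>n. suminf (\<lambda>j. T j n)) \<longlonglongrightarrow> suminf b"
    using tannerys_theorem[of T b sequentially "\<lambda>j. (K1 * B\<^sup>2 + 2 * B\<^sup>2 * R * K2) * (2 * M * R\<^sup>2) ^ j / fact j"]
      lim bound summable_exp_power by (auto intro!: always_eventually)
  have S: "(\<lambda>j. z ^ j / fact j * (E j w)\<^sup>2) sums fock_pairing a a z w w" for z w
    using summable_sums[OF fock_pairing_summable[OF a a, of z w w]]
    by (simp add: fock_pairing_def E_def power2_eq_square)
  have e1: "suminf (\<lambda>j. T j n) = (real n)\<^sup>2 * (fock_pairing a a x0 y0 y0 - fock_pairing a a (x n) (y n) (y n))" for n
    unfolding T_def by (intro sums_unique[symmetric] sums_mult sums_diff S)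
  have a': "geom_bounded (\<lambda>k. a (k + 1))" by (rule geom_bounded_shift[OF a])
  have S1: "(\<lambda>j. x0 ^ j / fact j * (E (Suc j) y0)\<^sup>2) sums fock_pairing (\<lambda>k. a (k + 1)) (\<lambda>k. a (k + 1)) x0 y0 y0"
    using summable_sums[OF fock_pairing_summable[OF a' a', of x0 y0 y0]]
    by (simp add: fock_pairing_def E_def power2_eq_square add_ac)
  have S2: "(\<lambda>j. x0 ^ j / fact j * (E (Suc j) y0 * E j y0)) sums fock_pairing (\<lambda>k. a (k + 1)) a x0 y0 y0"
    using summable_sums[OF fock_pairing_summable[OF a' a, of x0 y0 y0]]
    by (simp add: fock_pairing_def E_def add_ac)
  \<comment> \<open>Differentiation in x kills the term j = 0 and shifts the others, which raises
    the order of both factors E by one.\<close>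
  have S1': "(\<lambda>j. real j * x0 ^ (j - 1) / fact j * (E j y0)\<^sup>2) sums fock_pairing (\<lambda>k. a (k + 1)) (\<lambda>k. a (k + 1)) x0 y0 y0"
  proof -
    have "(\<lambda>j. real (Suc j) * x0 ^ (Suc j - 1) / fact (Suc j) * (E (Suc j) y0)\<^sup>2) = (\<lambda>j. x0 ^ j / fact j * (E (Suc j) y0)\<^sup>2)"
      by (rule ext) (simp del: of_nat_Suc)
    with S1 have "(\<lambda>j. real (Suc j) * x0 ^ (Suc j - 1) / fact (Suc j) * (E (Suc j) y0)\<^sup>2) sums
        fock_pairing (\<lambda>k. a (k + 1)) (\<lambda>k. a (k + 1)) x0 y0 y0" by (simp only:)
    from sums_Suc[OF this] show ?thesis by simp
  qed
  have "(\<lambda>j. \<xi> * (real j * x0 ^ (j - 1) / fact j * (E j y0)\<^sup>2) + 2 * \<eta> * (x0 ^ j / fact j * (E (Suc j) y0 * E j y0))) sums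
     (\<xi> * fock_pairing (\<lambda>k. a (k + 1)) (\<lambda>k. a (k + 1)) x0 y0 y0 + 2 * \<eta> * fock_pairing (\<lambda>k. a (k + 1)) a x0 y0 y0)"
    by (intro sums_add sums_mult S1' S2)
  moreover have "(\<lambda>j. \<xi> * (real j * x0 ^ (j - 1) / fact j * (E j y0)\<^sup>2) + 2 * \<eta> * (x0 ^ j / fact j * (E (Suc j) y0 * E j y0))) = b"
    by (simp add: fun_eq_iff b_def mult_ac)
  ultimately have "suminf b = \<xi> * fock_pairing (\<lambda>k. a (k + 1)) (\<lambda>k. a (k + 1)) x0 y0 y0 + 2 * \<eta> * fock_pairing (\<lambda>k. a (k + 1)) a x0 y0 y0"
    using sums_unique by metis
  with tan show ?thesis unfolding e1 by simp
qed

subsection \<open>Wick calculus\<close>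

lemma L2_tendsto_unique:
  assumes "L2_tendsto M F f" "L2_tendsto M F g"
  shows "AE x in M. f x = g x"
proof -
  from L2_tendsto_diff[OF assms] have L: "square_integrable M (\<lambda>x. f x - g x)"
    and "(\<lambda>n. \<integral>x. (f x - g x)\<^sup>2 \<partial>M) \<longlonglongrightarrow> 0" by (auto simp: L2_tendsto_def power2_commute)
  hence "(\<integral>x. (f x - g x)\<^sup>2 \<partial>M) = 0" by (simp add: LIMSEQ_const_iff)
  from has_integral_zero_square_AE[OF L this] show ?thesis by eventually_elim simp
qed

lemma L2_tendsto_cong_AE:
  assumes "L2_tendsto M F f" "\<And>n. AE x in M. F n x = G n x" "\<And>n. G n \<in> borel_measurable M"
  shows "L2_tendsto M G f"
proof -
  have G: "square_integrable M (G n)" for n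
    by (rule square_integrable_cong_AE[OF _ assms(2,3)]) (use assms(1) in \<open>auto simp: L2_tendsto_def\<close>)
  have f: "square_integrable M f" and F: "square_integrable M (F n)" for n using assms(1) by (auto simp: L2_tendsto_def)
  have "(\<integral>x. (G n x - f x)\<^sup>2 \<partial>M) = (\<integral>x. (F n x - f x)\<^sup>2 \<partial>M)" for n
    by (rule integral_cong_AE)
       (use assms(2)[of n] in \<open>auto elim: AE_mp intro!: borel_measurable_power borel_measurable_diff square_integrable_measurable[OF G] square_integrable_measurable[OF F] square_integrable_measurable[OF f]\<close>)
  with assms(1) G f show ?thesis by (simp add: L2_tendsto_def)
qed

context brownian_motion
begin

section \<open>Wick exponentials and the functionals built from them\<close>

abbreviation WE :: "(real \<Rightarrow> real) \<Rightarrow> 'a \<Rightarrow> real" where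
  "WE \<equiv> wick_exp P W"

lemma WE_eq: "WE g \<omega> = exp (WI g \<omega> - L2_inner g g / 2)"
  by (simp add: wick_exp_def L2_inner_def power2_eq_square)

lemma WE_L2:
  assumes "L2_unit g"
  shows "square_integrable P (WE g)"
proof -
  have "WE g = (\<lambda>\<omega>. exp (- L2_inner g g / 2) * exp (WI g \<omega>))"
    by (simp add: fun_eq_iff WE_eq exp_add[symmetric])
  thus ?thesis using square_integrable_scale[OF has_wiener_integral_exp(1)[OF WI[OF assms]]] by simp
qed

lemma WE_measurable: "L2_unit g \<Longrightarrow> WE g \<in> borel_measurable P"
  by (rule square_integrable_measurable[OF WE_L2])

lemma WE_expectation:
  assumes "L2_unit g"
  shows "expectation (WE g) = 1"
proof -
  have "WE g = (\<lambda>\<omega>. exp (- L2_inner g g / 2) * exp (WI g \<omega>))"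
    by (simp add: fun_eq_iff WE_eq exp_add[symmetric])
  hence "expectation (WE g) = exp (- L2_inner g g / 2) * expectation (\<lambda>\<omega>. exp (WI g \<omega>))"
    by (simp only: integral_mult_right_zero)
  also have "\<dots> = 1"
    unfolding has_wiener_integral_exp(2)[OF WI[OF assms]] by (simp add: exp_add[symmetric])
  finally show ?thesis .
qed

text \<open>As a function of t the second factor is the generating function of the Hermite
  polynomials of variance <f, f> in I(f) - <f, \<sigma>>. Testing against the left side thus encodes
  the expectations with all these polynomials at once.\<close>

lemma WE_shift:
  assumes f: "L2_unit f" and g: "L2_unit \<sigma>"
  shows "AE \<omega> in P. WE (\<lambda>s. \<sigma> s + t * f s) \<omega> =
    WE \<sigma> \<omega> * exp (t * (WI f \<omega> - L2_inner f \<sigma>) - t\<^sup>2 * L2_inner f f / 2)"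
  using WI_add[OF g square_integrable_scale[OF f, of t]] WI_scale[OF f, of t]
proof eventually_elim
  case (elim \<omega>)
  have "L2_inner (\<lambda>s. \<sigma> s + t * f s) (\<lambda>s. \<sigma> s + t * f s) = L2_inner \<sigma> \<sigma> + 2 * t * L2_inner f \<sigma> + t\<^sup>2 * L2_inner f f"
    using f g square_integrable_scale[OF f, of t] square_integrable_add[OF g square_integrable_scale[OF f, of t]]
    by (simp add: L2_inner_add_left L2_inner_add_right L2_inner_scale_left L2_inner_scale_right
        L2_inner_commute[of \<sigma> f] power2_eq_square algebra_simps)
  with elim show ?case by (simp add: WE_eq exp_add[symmetric] algebra_simps diff_divide_distrib add_divide_distrib)
qed

text \<open>The product of two Wick exponentials is exp <f, g> times the Wick exponential of the
  sum, which has expectation 1.\<close>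

lemma WE_inner:
  assumes f: "L2_unit f" and g: "L2_unit g"
  shows "expectation (\<lambda>\<omega>. WE f \<omega> * WE g \<omega>) = exp (L2_inner f g)"
proof -
  let ?h = "\<lambda>s. g s + 1 * f s"
  have h: "L2_unit ?h" using square_integrable_add[OF g f] by simp
  have "AE \<omega> in P. WE f \<omega> * WE g \<omega> = exp (L2_inner f g) * WE ?h \<omega>"
    using WE_shift[OF f g, of 1] by eventually_elim (simp add: WE_eq[of f] exp_add[symmetric])
  hence "expectation (\<lambda>\<omega>. WE f \<omega> * WE g \<omega>) = expectation (\<lambda>\<omega>. exp (L2_inner f g) * WE ?h \<omega>)"
    by (intro integral_cong_AE borel_measurable_times WE_measurable f g h borel_measurable_const)
  also have "\<dots> = exp (L2_inner f g)" using WE_expectation[OF h] by simp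
  finally show ?thesis .
qed

text \<open>\<open>F(I(f)) \<diamond> exp\<^sup>\<diamond>(I(\<sigma>))\<close>: Wick multiplication by \<open>exp\<^sup>\<diamond>(I(\<sigma>))\<close> is multiplication by it after the
  Girsanov shift of \<open>I(f)\<close> by \<open>\<langle>f, \<sigma>\<rangle>\<close>.\<close>

definition wick_functional :: "(nat \<Rightarrow> real) \<Rightarrow> (real \<Rightarrow> real) \<Rightarrow> (real \<Rightarrow> real) \<Rightarrow> 'a \<Rightarrow> real" where
  "wick_functional a f \<sigma> \<omega> = WE \<sigma> \<omega> * hermite_series a (L2_inner f f) (WI f \<omega> - L2_inner f \<sigma>)"

lemma wick_functional_measurable:
  assumes "L2_unit f" "L2_unit \<sigma>"
  shows "wick_functional a f \<sigma> \<in> borel_measurable P"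
proof -
  note [measurable] = WE_measurable[OF assms(2)] WI_measurable[OF assms(1)]
  show ?thesis unfolding wick_functional_def[abs_def] by measurable
qed

lemma wick_functional_L2:
  assumes f: "L2_unit f" and \<sigma>: "L2_unit \<sigma>" and a: "geom_bounded a"
  shows "square_integrable P (wick_functional a f \<sigma>)"
proof -
  obtain C R where 1: "C \<ge> 0" "R \<ge> 0" "\<And>k. \<bar>a k\<bar> \<le> C * R ^ k" using a by (rule geom_boundedE) blast
  define U where "U \<omega> = WI f \<omega> - L2_inner f \<sigma>" for \<omega>
  have [measurable]: "U \<in> borel_measurable P" unfolding U_def using WI_measurable[OF f] by measurable
  note [measurable] = WE_measurable[OF \<sigma>] wick_functional_measurable[OF f \<sigma>]
  have int: "integrable P (\<lambda>\<omega>. (WE \<sigma> \<omega>)\<^sup>2 * exp (t * U \<omega>))" for t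
  proof -
    \<comment> \<open>Half of t, because squaring \<open>WE ?h\<close> doubles the linear part of
      the exponent to t U.\<close>
    let ?h = "\<lambda>s. \<sigma> s + (t / 2) * f s"
    have h: "L2_unit ?h" by (intro square_integrable_add square_integrable_scale f \<sigma>)
    have "AE \<omega> in P. exp (t\<^sup>2 * L2_inner f f / 4) * (WE ?h \<omega>)\<^sup>2 = (WE \<sigma> \<omega>)\<^sup>2 * exp (t * U \<omega>)"
      using WE_shift[OF f \<sigma>, of "t / 2"]
    proof eventually_elim
      case (elim \<omega>)
      show ?case unfolding elim power_mult_distrib exp_double[symmetric] U_def[symmetric]
        by (simp add: exp_add[symmetric] power_divide algebra_simps)
    qed
    moreover have i: "integrable P (\<lambda>\<omega>. exp (t\<^sup>2 * L2_inner f f / 4) * (WE ?h \<omega>)\<^sup>2)"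
      by (intro integrable_mult_right square_integrable_integrable WE_L2 h)
    moreover have "(\<lambda>\<omega>. (WE \<sigma> \<omega>)\<^sup>2 * exp (t * U \<omega>)) \<in> borel_measurable P" by measurable
    ultimately show ?thesis
      using integrable_cong_AE[OF borel_measurable_integrable[OF i]] by blast
  qed
  have i: "integrable P (\<lambda>\<omega>. \<bar>(WE \<sigma> \<omega>)\<^sup>2\<bar> * exp ((2 * R) * \<bar>U \<omega>\<bar>))"
    by (rule integrable_exp_abs[OF _ int]) measurable
  define K where "K = C * exp (R\<^sup>2 * \<bar>L2_inner f f\<bar> / 2)"
  have "integrable P (\<lambda>\<omega>. (wick_functional a f \<sigma> \<omega>)\<^sup>2)"
  proof (rule Bochner_Integration.integrable_bound[OF integrable_mult_right[OF i, of "K\<^sup>2"]])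
    show "AE \<omega> in P. norm ((wick_functional a f \<sigma> \<omega>)\<^sup>2) \<le> norm (K\<^sup>2 * (\<bar>(WE \<sigma> \<omega>)\<^sup>2\<bar> * exp ((2 * R) * \<bar>U \<omega>\<bar>)))"
    proof (rule AE_I2)
      fix \<omega>
      have "\<bar>hermite_series a (L2_inner f f) (U \<omega>)\<bar> \<le> C * exp (R * \<bar>U \<omega>\<bar> + R\<^sup>2 * \<bar>L2_inner f f\<bar> / 2)"
        by (rule hermite_series_bound[OF 1(2,1,3)])
      also have "\<dots> = K * exp (R * \<bar>U \<omega>\<bar>)" by (simp add: K_def exp_add)
      finally have "\<bar>hermite_series a (L2_inner f f) (U \<omega>)\<bar>\<^sup>2 \<le> (K * exp (R * \<bar>U \<omega>\<bar>))\<^sup>2" by (intro power_mono) auto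
      hence "(hermite_series a (L2_inner f f) (U \<omega>))\<^sup>2 \<le> K\<^sup>2 * exp ((2 * R) * \<bar>U \<omega>\<bar>)"
        by (simp add: power_mult_distrib exp_double[symmetric] mult.assoc)
      from mult_left_mono[OF this, of "(WE \<sigma> \<omega>)\<^sup>2"]
      show "norm ((wick_functional a f \<sigma> \<omega>)\<^sup>2) \<le> norm (K\<^sup>2 * (\<bar>(WE \<sigma> \<omega>)\<^sup>2\<bar> * exp ((2 * R) * \<bar>U \<omega>\<bar>)))"
        by (simp add: wick_functional_def U_def power_mult_distrib mult_ac)
    qed
  qed measurable
  thus ?thesis using wick_functional_measurable[OF f \<sigma>] by (simp add: square_integrable_def)
qed

text \<open>Reduces any expectation with a functional to Y against Wick exponentials along \<sigma>
  + t f: the Taylor coefficients in t are the expectations with single Hermite polynomials, weighted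
  by \<open>WE \<sigma>\<close>.\<close>

lemma wick_functional_expectation:
  assumes f: "L2_unit f" and \<sigma>: "L2_unit \<sigma>" and a: "geom_bounded a" and Y: "square_integrable P Y"
    and b: "\<And>t. (\<lambda>k. b k * t ^ k / fact k) sums expectation (\<lambda>\<omega>. Y \<omega> * WE (\<lambda>s. \<sigma> s + t * f s) \<omega>)"
  shows "(\<lambda>k. a k * b k / fact k) sums expectation (\<lambda>\<omega>. Y \<omega> * wick_functional a f \<sigma> \<omega>)"
proof -
  define U where "U \<omega> = WI f \<omega> - L2_inner f \<sigma>" for \<omega>
  have U[measurable]: "U \<in> borel_measurable P" unfolding U_def using WI_measurable[OF f] by measurable
  note [measurable] = WE_measurable[OF \<sigma>] square_integrable_measurable[OF Y]
  have h: "L2_unit (\<lambda>s. \<sigma> s + t * f s)" for t by (intro square_integrable_add square_integrable_scale f \<sigma>)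
  have eq: "AE \<omega> in P. Y \<omega> * WE (\<lambda>s. \<sigma> s + t * f s) \<omega> = (Y \<omega> * WE \<sigma> \<omega>) * exp (t * U \<omega> - t\<^sup>2 * L2_inner f f / 2)" for t
    using WE_shift[OF f \<sigma>, of t] by eventually_elim (simp add: U_def)
  have int: "integrable P (\<lambda>\<omega>. (Y \<omega> * WE \<sigma> \<omega>) * exp (t * U \<omega>))" for t
  proof -
    have "integrable P (\<lambda>\<omega>. (Y \<omega> * WE \<sigma> \<omega>) * exp (t * U \<omega> - t\<^sup>2 * L2_inner f f / 2))"
      by (rule iffD1[OF integrable_cong_AE[OF _ _ eq] square_integrable_mult_integrable[OF Y WE_L2[OF h]]])
         (use WE_measurable[OF h] in measurable)
    from integrable_mult_left[OF this, of "exp (t\<^sup>2 * L2_inner f f / 2)"]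
    show ?thesis by (simp add: mult.assoc exp_add[symmetric])
  qed
  have "(\<lambda>k. a k * b k / fact k) sums expectation (\<lambda>\<omega>. (Y \<omega> * WE \<sigma> \<omega>) * hermite_series a (L2_inner f f) (U \<omega>))"
  proof (rule hermite_series_expectation[OF U int _ a])
    fix t
    have "expectation (\<lambda>\<omega>. Y \<omega> * WE (\<lambda>s. \<sigma> s + t * f s) \<omega>) =
        expectation (\<lambda>\<omega>. (Y \<omega> * WE \<sigma> \<omega>) * exp (t * U \<omega> - t\<^sup>2 * L2_inner f f / 2))"
      by (rule integral_cong_AE[OF _ _ eq]) (use WE_measurable[OF h] in measurable)
    with b[of t] show "(\<lambda>k. b k * t ^ k / fact k) sums
        expectation (\<lambda>\<omega>. (Y \<omega> * WE \<sigma> \<omega>) * exp (t * U \<omega> - t\<^sup>2 * L2_inner f f / 2))" by simp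
  qed
  thus ?thesis by (simp add: wick_functional_def U_def mult.assoc)
qed

text \<open>Testing \<open>WE g\<close> along \<sigma> + t f gives exp <\<sigma>, g> exp (t <f, g>),
  whose coefficients are multiples of <f, g>^k.\<close>

lemma wick_functional_S_transform:
  assumes f: "L2_unit f" and \<sigma>: "L2_unit \<sigma>" and a: "geom_bounded a" and g: "L2_unit g"
  shows "expectation (\<lambda>\<omega>. wick_functional a f \<sigma> \<omega> * WE g \<omega>) = exp (L2_inner \<sigma> g) * egf a (L2_inner f g)"
proof -
  have "(\<lambda>k. a k * (exp (L2_inner \<sigma> g) * L2_inner f g ^ k) / fact k) sums expectation (\<lambda>\<omega>. WE g \<omega> * wick_functional a f \<sigma> \<omega>)"
  proof (rule wick_functional_expectation[OF f \<sigma> a WE_L2[OF g]])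
    fix t
    have "expectation (\<lambda>\<omega>. WE g \<omega> * WE (\<lambda>s. \<sigma> s + t * f s) \<omega>) = exp (L2_inner g (\<lambda>s. \<sigma> s + t * f s))"
      by (intro WE_inner g square_integrable_add square_integrable_scale f \<sigma>)
    also have "\<dots> = exp (L2_inner \<sigma> g) * exp (t * L2_inner f g)"
      by (simp add: L2_inner_add_right L2_inner_scale_right square_integrable_scale f \<sigma> g exp_add L2_inner_commute)
    finally show "(\<lambda>k. exp (L2_inner \<sigma> g) * L2_inner f g ^ k * t ^ k / fact k) sums expectation (\<lambda>\<omega>. WE g \<omega> * WE (\<lambda>s. \<sigma> s + t * f s) \<omega>)"
      using sums_mult[OF exp_sums_real[of "t * L2_inner f g"], of "exp (L2_inner \<sigma> g)"]
      by (simp add: power_mult_distrib mult_ac)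
  qed
  moreover have "(\<lambda>k. a k * (exp (L2_inner \<sigma> g) * L2_inner f g ^ k) / fact k) sums (exp (L2_inner \<sigma> g) * egf a (L2_inner f g))"
    using sums_mult[OF egf_sums[OF a, of "L2_inner f g"], of "exp (L2_inner \<sigma> g)"] by (simp add: mult_ac)
  ultimately show ?thesis by (simp add: sums_unique2 mult.commute)
qed

text \<open>The S-transform of the second functional along \<sigma> + t f is an exponential times a
  shifted \<open>egf\<close>, with the coefficients \<open>exp_egf_coeff\<close> up to a
  constant.\<close>

lemma wick_functional_inner:
  assumes f: "L2_unit f" and \<sigma>: "L2_unit \<sigma>" and a: "geom_bounded a"
    and h: "L2_unit h" and \<tau>: "L2_unit \<tau>" and b: "geom_bounded b"
  shows "expectation (\<lambda>\<omega>. wick_functional a f \<sigma> \<omega> * wick_functional b h \<tau> \<omega>) =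
    exp (L2_inner \<sigma> \<tau>) * fock_pairing a b (L2_inner f h) (L2_inner f \<tau>) (L2_inner h \<sigma>)"
proof -
  let ?c = "exp_egf_coeff b (L2_inner f h) (L2_inner f \<tau>) (L2_inner h \<sigma>)"
  have "(\<lambda>k. a k * (exp (L2_inner \<sigma> \<tau>) * ?c k) / fact k) sums
      expectation (\<lambda>\<omega>. wick_functional b h \<tau> \<omega> * wick_functional a f \<sigma> \<omega>)"
  proof (rule wick_functional_expectation[OF f \<sigma> a wick_functional_L2[OF h \<tau> b]])
    fix t
    have g: "L2_unit (\<lambda>s. \<sigma> s + t * f s)" by (intro square_integrable_add square_integrable_scale f \<sigma>)
    have "expectation (\<lambda>\<omega>. wick_functional b h \<tau> \<omega> * WE (\<lambda>s. \<sigma> s + t * f s) \<omega>) =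
      exp (L2_inner \<tau> (\<lambda>s. \<sigma> s + t * f s)) * egf b (L2_inner h (\<lambda>s. \<sigma> s + t * f s))"
      by (rule wick_functional_S_transform[OF h \<tau> b g])
    also have "\<dots> = exp (L2_inner \<sigma> \<tau>) * (exp (t * L2_inner f \<tau>) * egf b (L2_inner h \<sigma> + t * L2_inner f h))"
      by (simp add: L2_inner_add_right L2_inner_scale_right square_integrable_scale f \<sigma> h \<tau> exp_add
          L2_inner_commute[of \<tau> \<sigma>] L2_inner_commute[of \<tau> f] L2_inner_commute[of h f])
    finally show "(\<lambda>k. exp (L2_inner \<sigma> \<tau>) * ?c k * t ^ k / fact k) sums
        expectation (\<lambda>\<omega>. wick_functional b h \<tau> \<omega> * WE (\<lambda>s. \<sigma> s + t * f s) \<omega>)"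
      using sums_mult[OF exp_egf_coeff_sums[OF b, of "L2_inner f h" "L2_inner f \<tau>" "L2_inner h \<sigma>" t], of "exp (L2_inner \<sigma> \<tau>)"]
      by (simp add: mult.assoc)
  qed
  moreover have "(\<lambda>k. a k * (exp (L2_inner \<sigma> \<tau>) * ?c k) / fact k) sums
      (exp (L2_inner \<sigma> \<tau>) * fock_pairing a b (L2_inner f h) (L2_inner f \<tau>) (L2_inner h \<sigma>))"
    using sums_mult[OF exp_egf_coeff_pairing[OF a b], of "exp (L2_inner \<sigma> \<tau>)"] by (simp add: mult_ac)
  ultimately show ?thesis by (simp add: sums_unique2 mult.commute)
qed

text \<open>Links the Laplace transforms of values of W to S-transforms at step functions.\<close>

lemma exp_sum_W:
  fixes c :: "real \<Rightarrow> real"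
  assumes J: "finite J" "J \<subseteq> {0..1}"
  defines "g \<equiv> \<lambda>s. \<Sum>t\<in>J. c t * indicator {0<..t} s"
  shows "AE \<omega> in P. exp (\<Sum>t\<in>J. c t * W t \<omega>) = exp (L2_inner g g / 2) * WE g \<omega>"
proof -
  have "AE \<omega> in P. \<forall>t\<in>J. WI (indicator {0<..t}) \<omega> = W t \<omega>"
    using J WI_indicator by (intro AE_finite_allI) auto
  moreover have "AE \<omega> in P. WI g \<omega> = (\<Sum>t\<in>J. c t * WI (indicator {0<..t}) \<omega>)"
    unfolding g_def by (rule WI_sum[OF J(1) L2_unit_indicator])
  ultimately show ?thesis
  proof eventually_elim
    case (elim \<omega>)
    have "(\<Sum>t\<in>J. c t * W t \<omega>) = WI g \<omega>" unfolding elim(2) using elim(1) by (intro sum.cong) auto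
    thus ?case by (simp add: WE_eq exp_add[symmetric])
  qed
qed

text \<open>Orthogonality to the Wick exponentials of step functions with jumps in T says that
  Laplace transforms vanish, and so controls all events observable at the times in T.\<close>

lemma generated_integrals_zero:
  assumes T: "T \<subseteq> {0..1}" and Z: "Z \<in> borel_measurable P"
    and g: "\<And>J c. finite J \<Longrightarrow> J \<subseteq> T \<Longrightarrow> integrable P (\<lambda>\<omega>. Z \<omega> * WE (\<lambda>s. \<Sum>t\<in>J. c t * indicator {0<..t} s) \<omega>)"
    and zero: "\<And>J c. finite J \<Longrightarrow> J \<subseteq> T \<Longrightarrow> expectation (\<lambda>\<omega>. Z \<omega> * WE (\<lambda>s. \<Sum>t\<in>J. c t * indicator {0<..t} s) \<omega>) = 0"
    and B: "B \<in> sets (generated_algebra P W T)"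
  shows "expectation (\<lambda>\<omega>. Z \<omega> * indicator B \<omega>) = 0"
proof (rule laplace_uniqueness_generated[OF _ _ _ B])
  show W: "W t \<in> borel_measurable P" if "t \<in> T" for t using that T measurable_W by auto
  fix J :: "real set" and c :: "real \<Rightarrow> real" assume J: "finite J" "J \<subseteq> T"
  define g where "g = (\<lambda>s. \<Sum>t\<in>J. c t * indicator {0<..t} s)"
  have Lg: "L2_unit g" unfolding g_def by (intro square_integrable_sum square_integrable_scale L2_unit_indicator)
  have AE: "AE \<omega> in P. exp (L2_inner g g / 2) * (Z \<omega> * WE g \<omega>) = Z \<omega> * exp (\<Sum>t\<in>J. c t * W t \<omega>)"
    using exp_sum_W[OF J(1) order_trans[OF J(2) T], of c] unfolding g_def[symmetric]
    by eventually_elim simp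
  have m: "(\<lambda>\<omega>. exp (L2_inner g g / 2) * (Z \<omega> * WE g \<omega>)) \<in> borel_measurable P"
    by (intro borel_measurable_times borel_measurable_const Z WE_measurable Lg)
  have m': "(\<lambda>\<omega>. Z \<omega> * exp (\<Sum>t\<in>J. c t * W t \<omega>)) \<in> borel_measurable P"
    by (intro borel_measurable_times Z measurable_compose[OF _ borel_measurable_exp] borel_measurable_sum borel_measurable_const W)
       (use J in auto)
  have i: "integrable P (\<lambda>\<omega>. exp (L2_inner g g / 2) * (Z \<omega> * WE g \<omega>))"
    using g[OF J, of c] unfolding g_def[symmetric] by (rule integrable_mult_right)
  show "integrable P (\<lambda>\<omega>. Z \<omega> * exp (\<Sum>t\<in>J. c t * W t \<omega>))"
    by (rule iffD1[OF integrable_cong_AE[OF m m' AE] i])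
  have "expectation (\<lambda>\<omega>. Z \<omega> * exp (\<Sum>t\<in>J. c t * W t \<omega>)) = expectation (\<lambda>\<omega>. exp (L2_inner g g / 2) * (Z \<omega> * WE g \<omega>))"
    by (rule integral_cong_AE[OF m m' AE, symmetric])
  also have "\<dots> = 0" using zero[OF J, of c] unfolding g_def[symmetric] by simp
  finally show "expectation (\<lambda>\<omega>. Z \<omega> * exp (\<Sum>t\<in>J. c t * W t \<omega>)) = 0" .
qed

lemma WI_zero: "AE \<omega> in P. WI (\<lambda>_. 0) \<omega> = 0"
  using WI_sum[of "{}" "\<lambda>_ _. 0" "\<lambda>_. 0"] by simp

lemma WE_zero: "AE \<omega> in P. WE (\<lambda>_. 0) \<omega> = 1"
  using WI_zero by eventually_elim (simp add: WE_eq L2_inner_def)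

text \<open>I(f) is the functional with \<sigma> = 0 whose only coefficient sits at k = 1.\<close>

lemma WI_S_transform:
  assumes f: "L2_unit f" and g: "L2_unit g"
  shows "expectation (\<lambda>\<omega>. WI f \<omega> * WE g \<omega>) = L2_inner f g"
proof -
  let ?a = "\<lambda>i. if i = 1 then fact 1 else 0 :: real"
  have a: "geom_bounded ?a" by (rule geom_bounded_finite_support[of 2]) auto
  have h1: "hermite v x 1 = x" for v x
    by (simp add: hermite_def gauss_coeff_def)
  have "hermite_series ?a v x = x" for v x
  proof -
    have "(\<lambda>k. ?a k * hermite v x k / fact k) = (\<lambda>k. if k = 1 then hermite v x k else 0)" by auto
    thus ?thesis using sums_unique[OF sums_single[of 1 "hermite v x"]] h1 by (simp add: hermite_series_def)
  qed
  hence "AE \<omega> in P. wick_functional ?a f (\<lambda>_. 0) \<omega> = WI f \<omega>"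
    using WE_zero by (auto simp: wick_functional_def L2_inner_def elim!: AE_mp)
  hence "AE \<omega> in P. wick_functional ?a f (\<lambda>_. 0) \<omega> * WE g \<omega> = WI f \<omega> * WE g \<omega>" by eventually_elim simp
  hence "expectation (\<lambda>\<omega>. WI f \<omega> * WE g \<omega>) = expectation (\<lambda>\<omega>. wick_functional ?a f (\<lambda>_. 0) \<omega> * WE g \<omega>)"
    by (intro integral_cong_AE[symmetric] borel_measurable_times wick_functional_measurable WE_measurable WI_measurable f g square_integrable_zero)
  also have "\<dots> = exp (L2_inner (\<lambda>_. 0) g) * egf ?a (L2_inner f g)"
    by (rule wick_functional_S_transform[OF f square_integrable_zero a g])
  also have "\<dots> = L2_inner f g" unfolding egf_power by (simp add: L2_inner_def)
  finally show ?thesis .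
qed

end

section \<open>Identification of Wick products, powers and series by S-transforms\<close>

context brownian_space
begin

text \<open>Integrability against Wick exponentials takes the place of square integrability, because
  it is what the equation directly provides for X_1.\<close>

lemma wick_exp_total:
  assumes Z: "Z \<in> borel_measurable P"
    and int: "\<And>g. L2_unit g \<Longrightarrow> integrable P (\<lambda>\<omega>. Z \<omega> * WE g \<omega>)"
    and zero: "\<And>g. L2_unit g \<Longrightarrow> expectation (\<lambda>\<omega>. Z \<omega> * WE g \<omega>) = 0"
  shows "AE \<omega> in P. Z \<omega> = 0"
proof (rule AE_zero_if_generated_integrals_zero[OF _ sets_generated])
  show "subalgebra P (generated_algebra P W {0..1})" by (rule generated_algebra_subalgebra[OF measurable_W])
  have L: "L2_unit (\<lambda>s. \<Sum>t\<in>J. c t * indicator {0<..t} s)" for J c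
    by (intro square_integrable_sum square_integrable_scale L2_unit_indicator)
  show "expectation (\<lambda>\<omega>. Z \<omega> * indicator B \<omega>) = 0" if "B \<in> sets (generated_algebra P W {0..1})" for B
    by (rule generated_integrals_zero[OF order_refl Z int[OF L] zero[OF L] that])
  have "AE \<omega> in P. Z \<omega> * WE (\<lambda>_. 0) \<omega> = Z \<omega>" using WE_zero by eventually_elim simp
  from iffD1[OF integrable_cong_AE[OF _ Z this] int[OF square_integrable_zero]]
  show "integrable P Z" using borel_measurable_integrable[OF int[OF square_integrable_zero]] by blast
qed

lemma S_transform_unique:
  assumes X: "square_integrable P X" and Y: "square_integrable P Y"
    and eq: "\<And>g. L2_unit g \<Longrightarrow> expectation (\<lambda>\<omega>. X \<omega> * WE g \<omega>) = expectation (\<lambda>\<omega>. Y \<omega> * WE g \<omega>)"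
  shows "AE \<omega> in P. X \<omega> = Y \<omega>"
proof -
  have i: "integrable P (\<lambda>\<omega>. X \<omega> * WE g \<omega>)" "integrable P (\<lambda>\<omega>. Y \<omega> * WE g \<omega>)" if "L2_unit g" for g
    by (rule square_integrable_mult_integrable[OF X WE_L2[OF that]] square_integrable_mult_integrable[OF Y WE_L2[OF that]])+
  have "AE \<omega> in P. X \<omega> - Y \<omega> = 0"
  proof (rule wick_exp_total)
    show "(\<lambda>\<omega>. X \<omega> - Y \<omega>) \<in> borel_measurable P"
      by (rule square_integrable_measurable[OF square_integrable_diff[OF X Y]])
    fix g assume g: "L2_unit g"
    show "integrable P (\<lambda>\<omega>. (X \<omega> - Y \<omega>) * WE g \<omega>)" "expectation (\<lambda>\<omega>. (X \<omega> - Y \<omega>) * WE g \<omega>) = 0"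
      using i[OF g] eq[OF g] by (auto simp: left_diff_distrib)
  qed
  thus ?thesis by eventually_elim simp
qed

text \<open>One explicit product shows that \<open>SOME\<close> in \<open>wick_prod\<close> has
  something to choose, and the S-transform identifies the chosen version with it.\<close>

lemma wick_prod_AE:
  assumes "is_wick_prod P W X Y Z"
  shows "is_wick_prod P W X Y (wick_prod P W X Y)" "AE \<omega> in P. wick_prod P W X Y \<omega> = Z \<omega>"
proof -
  show *: "is_wick_prod P W X Y (wick_prod P W X Y)"
    unfolding wick_prod_def using assms by (rule someI[of "is_wick_prod P W X Y"])
  show "AE \<omega> in P. wick_prod P W X Y \<omega> = Z \<omega>"
    by (rule S_transform_unique) (use * assms in \<open>auto simp: is_wick_prod_def\<close>)
qed

text \<open>Each step of the induction has to exhibit a Wick product; the functional with the single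
  coefficient (k + 1)! at k + 1 is one.\<close>

lemma wick_power_S_transform:
  assumes f: "L2_unit f"
  shows "square_integrable P (wick_power P W (WI f) k) \<and>
    (\<forall>g. L2_unit g \<longrightarrow> expectation (\<lambda>\<omega>. wick_power P W (WI f) k \<omega> * WE g \<omega>) = L2_inner f g ^ k)"
proof (induction k)
  case 0
  show ?case using bounded_square_integrable[of "\<lambda>_. 1" 1] by (simp add: WE_expectation)
next
  case (Suc k)
  let ?a = "\<lambda>i. if i = Suc k then fact (Suc k) else 0 :: real"
  have a: "geom_bounded ?a" by (rule geom_bounded_finite_support[of "Suc (Suc k)"]) auto
  have "is_wick_prod P W (WI f) (wick_power P W (WI f) k) (wick_functional ?a f (\<lambda>_. 0))"
    unfolding is_wick_prod_def
  proof (intro conjI allI impI)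
    fix g assume g: "L2_unit g"
    have "expectation (\<lambda>\<omega>. wick_functional ?a f (\<lambda>_. 0) \<omega> * WE g \<omega>) = exp (L2_inner (\<lambda>_. 0) g) * egf ?a (L2_inner f g)"
      by (rule wick_functional_S_transform[OF f square_integrable_zero a g])
    also have "\<dots> = L2_inner f g * L2_inner f g ^ k" unfolding egf_power by (simp add: L2_inner_def)
    finally show "expectation (\<lambda>\<omega>. wick_functional ?a f (\<lambda>_. 0) \<omega> * WE g \<omega>) =
        expectation (\<lambda>\<omega>. WI f \<omega> * WE g \<omega>) * expectation (\<lambda>\<omega>. wick_power P W (WI f) k \<omega> * WE g \<omega>)"
      using Suc g WI_S_transform[OF f g] by simp
  qed (use Suc WI_L2[OF f] wick_functional_L2[OF f square_integrable_zero a] in auto)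
  from wick_prod_AE(1)[OF this] show ?case
    using Suc WI_S_transform[OF f] by (simp add: is_wick_prod_def)
qed

text \<open>Partial sums are functionals with truncated coefficients. Wick powers of different
  degree are orthogonal, so the squared distance to the full functional is the tail of a convergent
  series.\<close>

lemma wick_series_AE:
  assumes f: "L2_unit f" and c: "geom_bounded (\<lambda>k. fact k * c k)"
  shows "square_integrable P (wick_series P W c f)"
    and "AE \<omega> in P. wick_series P W c f \<omega> = wick_functional (\<lambda>k. fact k * c k) f (\<lambda>_. 0) \<omega>"
proof -
  define a where "a k = fact k * c k" for k
  have a: "geom_bounded a" using c by (simp add: a_def[abs_def])
  define b where "b n k = (if k < n then a k else 0)" for n k
  have b: "geom_bounded (b n)" for n by (rule geom_bounded_finite_support[of n]) (auto simp: b_def)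
  let ?o = "\<lambda>_::real. 0::real"
  note z = square_integrable_zero[of unit_leb]
  let ?Z = "wick_functional a f ?o" and ?Y = "\<lambda>n. wick_functional (b n) f ?o"
  let ?S = "\<lambda>n \<omega>. \<Sum>k<n. c k * wick_power P W (WI f) k \<omega>"
  have pw: "square_integrable P (wick_power P W (WI f) k)" for k using wick_power_S_transform[OF f] by blast
  have S: "square_integrable P (?S n)" for n by (intro square_integrable_sum square_integrable_scale pw)
  have SY: "AE \<omega> in P. ?Y n \<omega> = ?S n \<omega>" for n
  proof (rule S_transform_unique[OF wick_functional_L2[OF f z b] S])
    fix g assume g: "L2_unit g"
    have "egf (b n) (L2_inner f g) = (\<Sum>k<n. b n k * L2_inner f g ^ k / fact k)"
      unfolding egf_def by (rule suminf_finite) (auto simp: b_def)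
    also have "\<dots> = (\<Sum>k<n. c k * L2_inner f g ^ k)" by (intro sum.cong) (auto simp: b_def a_def)
    also have "\<dots> = expectation (\<lambda>\<omega>. \<Sum>k<n. c k * (wick_power P W (WI f) k \<omega> * WE g \<omega>))"
      using wick_power_S_transform[OF f] g square_integrable_mult_integrable[OF pw WE_L2[OF g]] by simp
    also have "\<dots> = expectation (\<lambda>\<omega>. ?S n \<omega> * WE g \<omega>)" by (simp add: sum_distrib_right mult.assoc)
    finally show "expectation (\<lambda>\<omega>. ?Y n \<omega> * WE g \<omega>) = expectation (\<lambda>\<omega>. ?S n \<omega> * WE g \<omega>)"
      unfolding wick_functional_S_transform[OF f z b g] by (simp add: L2_inner_def)
  qed
  \<comment> \<open>Without a Girsanov shift both generating functions are evaluated at 0, so only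
    terms of equal degree are paired.\<close>
  have pair: "fock_pairing p q v 0 0 = (\<Sum>j. v ^ j / fact j * (p j * q j))" for p q v
    by (simp add: fock_pairing_def egf_zero)
  have inner: "expectation (\<lambda>\<omega>. wick_functional p f ?o \<omega> * wick_functional q f ?o \<omega>) =
      (\<Sum>j. L2_inner f f ^ j / fact j * (p j * q j))" if "geom_bounded p" "geom_bounded q" for p q
    using wick_functional_inner[OF f z that(1) f z that(2)] by (simp add: L2_inner_def pair)
  define q where "q j = L2_inner f f ^ j / fact j * (a j * a j)" for j
  have fin: "(\<Sum>j. L2_inner f f ^ j / fact j * (p j * p' j)) = (\<Sum>j<n. q j)"
    if "\<And>j. p j * p' j = (if j < n then a j * a j else 0)" for p p' n
    by (subst suminf_finite[of "{..<n}"]) (auto simp: that q_def)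
  have qs: "q sums expectation (\<lambda>\<omega>. ?Z \<omega> * ?Z \<omega>)"
    using summable_sums[OF fock_pairing_summable[OF a a, of "L2_inner f f" 0 0]]
    unfolding inner[OF a a] q_def by (simp add: egf_zero)
  have dist: "expectation (\<lambda>\<omega>. (?Y n \<omega> - ?Z \<omega>)\<^sup>2) = expectation (\<lambda>\<omega>. ?Z \<omega> * ?Z \<omega>) - (\<Sum>j<n. q j)" for n
  proof -
    note LL = wick_functional_L2[OF f z b, of n] wick_functional_L2[OF f z a]
    have "expectation (\<lambda>\<omega>. (?Y n \<omega> - ?Z \<omega>)\<^sup>2) = expectation (\<lambda>\<omega>. ?Y n \<omega> * ?Y n \<omega> - 2 * (?Y n \<omega> * ?Z \<omega>) + ?Z \<omega> * ?Z \<omega>)"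
      by (rule Bochner_Integration.integral_cong) (auto simp: power2_eq_square algebra_simps)
    also have "\<dots> = expectation (\<lambda>\<omega>. ?Y n \<omega> * ?Y n \<omega>) - 2 * expectation (\<lambda>\<omega>. ?Y n \<omega> * ?Z \<omega>) + expectation (\<lambda>\<omega>. ?Z \<omega> * ?Z \<omega>)"
      using square_integrable_mult_integrable[OF LL(1) LL(1)] square_integrable_mult_integrable[OF LL(1) LL(2)]
        square_integrable_mult_integrable[OF LL(2) LL(2)] by simp
    also have "expectation (\<lambda>\<omega>. ?Y n \<omega> * ?Y n \<omega>) = (\<Sum>j<n. q j)"
      unfolding inner[OF b b] by (rule fin) (simp add: b_def)
    also have "expectation (\<lambda>\<omega>. ?Y n \<omega> * ?Z \<omega>) = (\<Sum>j<n. q j)"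
      unfolding inner[OF b a] by (rule fin) (simp add: b_def)
    finally show ?thesis by simp
  qed
  have "(\<lambda>n. expectation (\<lambda>\<omega>. (?Y n \<omega> - ?Z \<omega>)\<^sup>2)) \<longlonglongrightarrow> expectation (\<lambda>\<omega>. ?Z \<omega> * ?Z \<omega>) - expectation (\<lambda>\<omega>. ?Z \<omega> * ?Z \<omega>)"
    unfolding dist using qs by (intro tendsto_intros) (simp add: sums_def)
  hence "L2_tendsto P ?Y ?Z" using wick_functional_L2[OF f z b] wick_functional_L2[OF f z a] by (simp add: L2_tendsto_def)
  hence lim: "L2_tendsto P ?S ?Z" by (rule L2_tendsto_cong_AE[OF _ SY square_integrable_measurable[OF S]])
  hence lim': "L2_tendsto P ?S (wick_series P W c f)"
    unfolding wick_series_def by (rule someI[of "L2_tendsto P ?S"])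
  thus "square_integrable P (wick_series P W c f)" by (simp add: L2_tendsto_def)
  from L2_tendsto_unique[OF lim' lim]
  show "AE \<omega> in P. wick_series P W c f \<omega> = wick_functional (\<lambda>k. fact k * c k) f (\<lambda>_. 0) \<omega>"
    by (simp add: a_def[abs_def])
qed

lemma wick_series_S_transform:
  assumes f: "L2_unit f" and c: "geom_bounded (\<lambda>k. fact k * c k)" and g: "L2_unit g"
  shows "expectation (\<lambda>\<omega>. wick_series P W c f \<omega> * WE g \<omega>) = egf (\<lambda>k. fact k * c k) (L2_inner f g)"
proof -
  let ?Z = "wick_functional (\<lambda>k. fact k * c k) f (\<lambda>_. 0)"
  have "expectation (\<lambda>\<omega>. wick_series P W c f \<omega> * WE g \<omega>) = expectation (\<lambda>\<omega>. ?Z \<omega> * WE g \<omega>)"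
  proof (rule integral_cong_AE)
    show "AE \<omega> in P. wick_series P W c f \<omega> * WE g \<omega> = ?Z \<omega> * WE g \<omega>"
      using wick_series_AE(2)[OF f c] by eventually_elim simp
  qed (intro borel_measurable_times square_integrable_measurable[OF wick_series_AE(1)[OF f c]] WE_measurable g
      wick_functional_measurable f square_integrable_zero)+
  also have "\<dots> = egf (\<lambda>k. fact k * c k) (L2_inner f g)"
    using wick_functional_S_transform[OF f square_integrable_zero c g] by (simp add: L2_inner_def)
  finally show ?thesis .
qed

end

subsection \<open>The equation and its optimal approximation\<close>

lemma wick_analytic_geom_bounded:
  assumes "wick_analytic_coeffs c"
  shows "geom_bounded (\<lambda>k. fact k * c k)"
proof -
  obtain B where B: "\<And>k. k \<ge> 1 \<Longrightarrow> root k (fact k * \<bar>c k\<bar>) \<le> B"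
    using assms unfolding wick_analytic_coeffs_def bdd_above_def by auto
  define R where "R = max B 0"
  \<comment> \<open>The root condition starts at k = 1, so the constant term enters through C, while
    C >= 1 covers the other k.\<close>
  define C where "C = max 1 \<bar>c 0\<bar>"
  have "\<bar>fact k * c k\<bar> \<le> C * R ^ k" for k
  proof (cases "k = 0")
    case True
    thus ?thesis by (simp add: C_def)
  next
    case False
    have "\<bar>fact k * c k\<bar> = (root k (fact k * \<bar>c k\<bar>)) ^ k" using False by (simp add: abs_mult)
    also have "\<dots> \<le> R ^ k"
      using B[of k] False by (intro power_mono) (auto simp: R_def)
    also have "\<dots> \<le> C * R ^ k" using mult_right_mono[of 1 C "R ^ k"] by (simp add: C_def R_def)
    finally show ?thesis .
  qed
  thus ?thesis unfolding geom_bounded_def by (intro exI[of _ C] exI[of _ R]) (auto simp: C_def R_def)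
qed

lemma fact_wick_deriv: "fact k * wick_deriv c k = fact (k + 1) * c (k + 1)"
  by (simp add: wick_deriv_def algebra_simps)

text \<open>Multiplication by 1 / n^2 forces the difference itself to 0.\<close>

lemma tendsto_of_scaled_difference:
  assumes "(\<lambda>n. (real n)\<^sup>2 * (x0 - x n)) \<longlonglongrightarrow> l"
  shows "x \<longlonglongrightarrow> x0"
proof -
  have "(\<lambda>n. 1 / real n) \<longlonglongrightarrow> 0" by (rule lim_const_over_n)
  from tendsto_mult[OF tendsto_power[OF this, of 2] assms]
  have "(\<lambda>n. (1 / real n)\<^sup>2 * ((real n)\<^sup>2 * (x0 - x n))) \<longlonglongrightarrow> 0" by simp
  moreover have "eventually (\<lambda>n. (1 / real n)\<^sup>2 * ((real n)\<^sup>2 * (x0 - x n)) = x0 - x n) sequentially"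
    using eventually_gt_at_top[of 0] by eventually_elim (simp add: power_divide)
  ultimately have "(\<lambda>n. x0 - x n) \<longlonglongrightarrow> 0" by (rule Lim_transform_eventually)
  from tendsto_diff[OF tendsto_const this, of x0] show ?thesis by simp
qed

lemma L2_inner_grid_indicator:
  assumes n: "n > 0" and k: "k \<le> n" and f: "L2_unit f"
  shows "L2_inner (grid_proj n f) (indicator {0<..real k / real n}) = L2_inner f (indicator {0<..real k / real n})"
proof -
  have "indicator {0<..real k / real n} s = (\<Sum>i<n. (if i < k then 1 else 0) * grid_ind n i s)" for s
  proof -
    have "(\<Sum>i<n. (if i < k then 1 else 0) * grid_ind n i s) = (\<Sum>i<n. if i < k then grid_ind n i s else 0)"
      by (intro sum.cong) auto
    also have "\<dots> = (\<Sum>i<k. grid_ind n i s)"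
      using k by (intro sum.mono_neutral_cong_right) auto
    also have "\<dots> = indicator {0<..real k / real n} s" by (rule sum_grid_ind_lessThan)
    finally show ?thesis ..
  qed
  thus ?thesis using L2_inner_grid_step[OF f, of n "\<lambda>i. if i < k then 1 else 0"] by presburger
qed

lemma L2_inner_grid_sum_indicator:
  assumes n: "n > 0" and J: "J \<subseteq> (\<lambda>i. real i / real n) ` {1..n}" and f: "L2_unit f"
  shows "L2_inner (grid_proj n f) (\<lambda>s. \<Sum>t\<in>J. c t * indicator {0<..t} s) = L2_inner f (\<lambda>s. \<Sum>t\<in>J. c t * indicator {0<..t} s)"
proof -
  have "L2_inner u (\<lambda>s. \<Sum>t\<in>J. c t * indicator {0<..t} s) = (\<Sum>t\<in>J. c t * L2_inner u (indicator {0<..t}))" if "L2_unit u" for u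
    by (subst (1 2) L2_inner_commute, subst L2_inner_sum_left)
       (auto simp: L2_inner_scale_left L2_unit_indicator that intro!: square_integrable_scale)
  moreover have "L2_inner (grid_proj n f) (indicator {0<..t}) = L2_inner f (indicator {0<..t})" if "t \<in> J" for t
  proof -
    from that J obtain k where "k \<in> {1..n}" "t = real k / real n" by auto
    thus ?thesis using L2_inner_grid_indicator[OF n _ f, of k] by simp
  qed
  ultimately show ?thesis using f L2_unit_grid_proj by simp
qed

section \<open>Conditioning on the grid, and the S-transform of the equation\<close>

context brownian_motion
begin

lemma WI_grid_ind:
  assumes i: "i < n"
  shows "AE \<omega> in P. WI (grid_ind n i) \<omega> = W (real (Suc i) / real n) \<omega> - W (real i / real n) \<omega>"
proof -
  let ?s = "real i / real n" and ?t = "real (Suc i) / real n"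
  have st: "0 \<le> ?s" "?s \<le> ?t" "?s \<in> {0..1}" "?t \<in> {0..1}"
    using i by (auto simp: divide_right_mono divide_le_eq)
  have eq: "grid_ind n i = (\<lambda>s. indicator {0<..?t} s + (-1) * indicator {0<..?s} s)"
    using indicator_Ioc_add[OF st(1,2)] by (auto simp: fun_eq_iff grid_ind_def algebra_simps)
  show ?thesis unfolding eq
    using WI_add[OF L2_unit_indicator square_integrable_scale[OF L2_unit_indicator], of 0 ?t "-1" 0 ?s]
      WI_scale[OF L2_unit_indicator, of "-1" 0 ?s] WI_indicator[OF st(3)] WI_indicator[OF st(4)]
    by eventually_elim simp
qed

text \<open>\<open>W 0\<close> vanishes only almost surely and is not observed on the grid, so it is replaced by 0 to make
  this version of \<open>I(f\<^sub>n)\<close> measurable with respect to the grid.\<close>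

definition grid_int :: "nat \<Rightarrow> (real \<Rightarrow> real) \<Rightarrow> 'a \<Rightarrow> real" where
  "grid_int n f \<omega> = (\<Sum>i<n. grid_avg n f i *
     (W (real (Suc i) / real n) \<omega> - (if i = 0 then 0 else W (real i / real n) \<omega>)))"

lemma grid_int_AE: "AE \<omega> in P. WI (grid_proj n f) \<omega> = grid_int n f \<omega>"
proof -
  have "AE \<omega> in P. \<forall>i\<in>{..<n}. WI (grid_ind n i) \<omega> = W (real (Suc i) / real n) \<omega> - W (real i / real n) \<omega>"
    by (rule AE_finite_allI[OF finite_lessThan]) (rule WI_grid_ind, simp)
  moreover have "AE \<omega> in P. WI (grid_proj n f) \<omega> = (\<Sum>i<n. grid_avg n f i * WI (grid_ind n i) \<omega>)"
    unfolding grid_proj_def[abs_def] by (rule WI_sum[OF finite_lessThan L2_unit_grid_ind])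
  ultimately show ?thesis using start_zero
    by eventually_elim (auto simp: grid_int_def intro!: sum.cong)
qed

lemma grid_int_measurable:
  assumes "n > 0"
  shows "grid_int n f \<in> borel_measurable (generated_algebra P W ((\<lambda>i. real i / real n) ` {1..n}))"
proof -
  let ?F = "generated_algebra P W ((\<lambda>i. real i / real n) ` {1..n})"
  have W: "W (real i / real n) \<in> borel_measurable ?F" if "1 \<le> i" "i \<le> n" for i
    using that by (intro generated_algebra_measurable imageI) auto
  have "(\<lambda>\<omega>. grid_avg n f i * (W (real (Suc i) / real n) \<omega> - (if i = 0 then 0 else W (real i / real n) \<omega>)))
      \<in> borel_measurable ?F" if i: "i < n" for i
  proof -
    have "(\<lambda>\<omega>. if i = 0 then 0 else W (real i / real n) \<omega>) \<in> borel_measurable ?F"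
      using W[of i] i by (cases "i = 0") auto
    moreover have "W (real (Suc i) / real n) \<in> borel_measurable ?F" by (rule W) (use i in auto)
    ultimately show ?thesis by (intro borel_measurable_times borel_measurable_diff borel_measurable_const)
  qed
  thus ?thesis unfolding grid_int_def[abs_def] by (intro borel_measurable_sum) auto
qed

text \<open>Replacing \<open>f\<close> and \<open>\<sigma>\<close> by their averages over the grid does not change their inner products
  with the step functions that generate the information of the grid.\<close>

lemma optimal_approx_AE:
  assumes n: "n > 0" and f: "L2_unit f" and \<sigma>: "L2_unit \<sigma>" and a: "geom_bounded a"
    and X: "X \<in> borel_measurable P" "AE \<omega> in P. X \<omega> = r * wick_functional a f \<sigma> \<omega>"
  shows "AE \<omega> in P. optimal_approx P W n X \<omega> = r * wick_functional a (grid_proj n f) (grid_proj n \<sigma>) \<omega>"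
proof -
  define T where "T = (\<lambda>i. real i / real n) ` {1..n}"
  let ?F = "generated_algebra P W T"
  let ?f = "grid_proj n f" and ?\<sigma> = "grid_proj n \<sigma>"
  have T: "T \<subseteq> {0..1}" by (auto simp: T_def divide_le_eq)
  have sub: "subalgebra P ?F" using T measurable_W by (intro generated_algebra_subalgebra) auto
  interpret F: finite_measure_subalgebra P ?F by unfold_locales (rule sub)
  \<comment> \<open>The functional of the projected integrands, rewritten with
    \<open>grid_int\<close> so that it is a function of the observed values of W.\<close>
  define Z where "Z \<omega> = r * (exp (grid_int n \<sigma> \<omega> - L2_inner ?\<sigma> ?\<sigma> / 2) *
      hermite_series a (L2_inner ?f ?f) (grid_int n f \<omega> - L2_inner ?f ?\<sigma>))" for \<omega>
  note [measurable] = grid_int_measurable[OF n, folded T_def]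
  have ZF: "Z \<in> borel_measurable ?F" unfolding Z_def[abs_def] by measurable
  have Zm: "Z \<in> borel_measurable P" by (rule measurable_from_subalg[OF sub ZF])
  have ZAE: "AE \<omega> in P. Z \<omega> = r * wick_functional a ?f ?\<sigma> \<omega>"
    using grid_int_AE[of n f] grid_int_AE[of n \<sigma>]
    by eventually_elim (simp add: Z_def wick_functional_def WE_eq)
  note L = wick_functional_L2[OF f \<sigma> a] wick_functional_L2[OF L2_unit_grid_proj L2_unit_grid_proj a, of n f n \<sigma>]
  have ZL: "square_integrable P Z"
    by (rule square_integrable_cong_AE[OF square_integrable_scale[OF L(2)] _ Zm]) (use ZAE in \<open>auto elim: AE_mp\<close>)
  have XL: "square_integrable P X"
    by (rule square_integrable_cong_AE[OF square_integrable_scale[OF L(1)] _ X(1)]) (use X(2) in \<open>auto elim: AE_mp\<close>)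
  have one: "square_integrable P (\<lambda>_. 1)" by (rule bounded_square_integrable[of _ 1]) auto
  have iZ: "integrable P Z" and iX: "integrable P X"
    using square_integrable_mult_integrable[OF ZL one] square_integrable_mult_integrable[OF XL one] by auto
  have "AE \<omega> in P. real_cond_exp P ?F X \<omega> = Z \<omega>"
  proof (rule F.real_cond_exp_charact[OF _ iX iZ ZF])
    fix B assume B: "B \<in> sets ?F"
    hence BP: "B \<in> sets P" using sub by (auto simp: subalgebra_def)
    have D: "square_integrable P (\<lambda>\<omega>. X \<omega> - Z \<omega>)" by (rule square_integrable_diff[OF XL ZL])
    have "expectation (\<lambda>\<omega>. (X \<omega> - Z \<omega>) * indicator B \<omega>) = 0"
    proof (rule generated_integrals_zero[OF T square_integrable_measurable[OF D] _ _ B])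
      fix J :: "real set" and c :: "real \<Rightarrow> real" assume J: "finite J" "J \<subseteq> T"
      let ?g = "\<lambda>s. \<Sum>t\<in>J. c t * indicator {0<..t} s"
      have g: "L2_unit ?g" by (intro square_integrable_sum square_integrable_scale L2_unit_indicator)
      show "integrable P (\<lambda>\<omega>. (X \<omega> - Z \<omega>) * WE ?g \<omega>)" by (rule square_integrable_mult_integrable[OF D WE_L2[OF g]])
      have "AE \<omega> in P. (X \<omega> - Z \<omega>) * WE ?g \<omega> = r * (wick_functional a f \<sigma> \<omega> * WE ?g \<omega>) - r * (wick_functional a ?f ?\<sigma> \<omega> * WE ?g \<omega>)"
        using X(2) ZAE by eventually_elim (simp add: algebra_simps)
      hence "expectation (\<lambda>\<omega>. (X \<omega> - Z \<omega>) * WE ?g \<omega>) =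
          expectation (\<lambda>\<omega>. r * (wick_functional a f \<sigma> \<omega> * WE ?g \<omega>) - r * (wick_functional a ?f ?\<sigma> \<omega> * WE ?g \<omega>))"
        by (intro integral_cong_AE borel_measurable_times borel_measurable_diff borel_measurable_const
            square_integrable_measurable[OF XL] Zm WE_measurable[OF g] square_integrable_measurable[OF L(1)] square_integrable_measurable[OF L(2)])
      also have "\<dots> = r * expectation (\<lambda>\<omega>. wick_functional a f \<sigma> \<omega> * WE ?g \<omega>) - r * expectation (\<lambda>\<omega>. wick_functional a ?f ?\<sigma> \<omega> * WE ?g \<omega>)"
        using square_integrable_mult_integrable[OF L(1) WE_L2[OF g]] square_integrable_mult_integrable[OF L(2) WE_L2[OF g]] by simp
      \<comment> \<open>At a step function of the grid both S-transforms depend on the integrands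
        only through inner products that the projection preserves.\<close>
      also have "\<dots> = 0"
        using L2_inner_grid_sum_indicator[OF n J(2)[unfolded T_def] f, of c] L2_inner_grid_sum_indicator[OF n J(2)[unfolded T_def] \<sigma>, of c]
        by (simp add: wick_functional_S_transform[OF f \<sigma> a g] wick_functional_S_transform[OF L2_unit_grid_proj L2_unit_grid_proj a g])
      finally show "expectation (\<lambda>\<omega>. (X \<omega> - Z \<omega>) * WE ?g \<omega>) = 0" .
    qed
    moreover have "integrable P (\<lambda>\<omega>. X \<omega> * indicator B \<omega>)" "integrable P (\<lambda>\<omega>. Z \<omega> * indicator B \<omega>)"
      using integrable_mult_indicator[OF BP iX] integrable_mult_indicator[OF BP iZ] by (simp_all add: mult.commute)
    ultimately show "(LINT \<omega>:B|P. X \<omega>) = (LINT \<omega>:B|P. Z \<omega>)"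
      by (simp add: set_lebesgue_integral_def mult.commute left_diff_distrib right_diff_distrib)
  qed
  with ZAE show ?thesis unfolding optimal_approx_def T_def[symmetric] by eventually_elim simp
qed

text \<open>Orthogonality takes the form E[Z Z'] = E[Z' Z'], because inner products of f and
  \<sigma> with projected functions equal those of the projections. The error is thus a difference
  of second moments.\<close>

lemma optimal_approx_error:
  assumes n: "n > 0" and f: "L2_unit f" and \<sigma>: "L2_unit \<sigma>" and a: "geom_bounded a"
    and X: "X \<in> borel_measurable P" "AE \<omega> in P. X \<omega> = r * wick_functional a f \<sigma> \<omega>"
  defines "f' \<equiv> grid_proj n f" and "\<sigma>' \<equiv> grid_proj n \<sigma>"
  shows "expectation (\<lambda>\<omega>. (X \<omega> - optimal_approx P W n X \<omega>)\<^sup>2) = r\<^sup>2 *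
     (exp (L2_inner \<sigma> \<sigma>) * fock_pairing a a (L2_inner f f) (L2_inner f \<sigma>) (L2_inner f \<sigma>) -
      exp (L2_inner \<sigma>' \<sigma>') * fock_pairing a a (L2_inner f' f') (L2_inner f' \<sigma>') (L2_inner f' \<sigma>'))"
proof -
  let ?Z = "wick_functional a f \<sigma>" and ?Z' = "wick_functional a f' \<sigma>'"
  have f': "L2_unit f'" and \<sigma>': "L2_unit \<sigma>'" unfolding f'_def \<sigma>'_def by (rule L2_unit_grid_proj)+
  note L = wick_functional_L2[OF f \<sigma> a] wick_functional_L2[OF f' \<sigma>' a]
  have T: "(\<lambda>i. real i / real n) ` {1..n} \<subseteq> {0..1}" by (auto simp: divide_le_eq)
  have sub: "subalgebra P (generated_algebra P W ((\<lambda>i. real i / real n) ` {1..n}))"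
    using T measurable_W by (intro generated_algebra_subalgebra) auto
  have om: "optimal_approx P W n X \<in> borel_measurable P"
    unfolding optimal_approx_def by (rule measurable_from_subalg[OF sub borel_measurable_cond_exp])
  have "AE \<omega> in P. (X \<omega> - optimal_approx P W n X \<omega>)\<^sup>2 =
      r\<^sup>2 * (?Z \<omega> * ?Z \<omega> - 2 * (?Z \<omega> * ?Z' \<omega>) + ?Z' \<omega> * ?Z' \<omega>)"
    using X(2) optimal_approx_AE[OF n f \<sigma> a X]
    by eventually_elim (simp add: f'_def \<sigma>'_def power2_eq_square algebra_simps)
  hence "expectation (\<lambda>\<omega>. (X \<omega> - optimal_approx P W n X \<omega>)\<^sup>2) =
      expectation (\<lambda>\<omega>. r\<^sup>2 * (?Z \<omega> * ?Z \<omega> - 2 * (?Z \<omega> * ?Z' \<omega>) + ?Z' \<omega> * ?Z' \<omega>))"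
    by (intro integral_cong_AE borel_measurable_power borel_measurable_times borel_measurable_diff borel_measurable_add
        borel_measurable_const X(1) om square_integrable_measurable[OF L(1)] square_integrable_measurable[OF L(2)])
  also have "\<dots> = r\<^sup>2 * (expectation (\<lambda>\<omega>. ?Z \<omega> * ?Z \<omega>) - 2 * expectation (\<lambda>\<omega>. ?Z \<omega> * ?Z' \<omega>) + expectation (\<lambda>\<omega>. ?Z' \<omega> * ?Z' \<omega>))"
    using square_integrable_mult_integrable[OF L(1) L(1)] square_integrable_mult_integrable[OF L(1) L(2)]
      square_integrable_mult_integrable[OF L(2) L(2)] by simp
  also have "expectation (\<lambda>\<omega>. ?Z \<omega> * ?Z' \<omega>) = expectation (\<lambda>\<omega>. ?Z' \<omega> * ?Z' \<omega>)"
    using L2_inner_grid_proj[OF \<sigma>, of n \<sigma>] L2_inner_grid_proj[OF f, of n f] L2_inner_grid_proj[OF f, of n \<sigma>] L2_inner_grid_proj[OF \<sigma>, of n f]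
    unfolding wick_functional_inner[OF f \<sigma> a f' \<sigma>' a] wick_functional_inner[OF f' \<sigma>' a f' \<sigma>' a]
    by (simp add: f'_def \<sigma>'_def L2_inner_commute[of "grid_proj n f" \<sigma>] L2_inner_commute[of "grid_proj n \<sigma>" "grid_proj n f"])
  finally show ?thesis
    by (simp add: wick_functional_inner[OF f \<sigma> a f \<sigma> a] wick_functional_inner[OF f' \<sigma>' a f' \<sigma>' a])
qed

text \<open>Let x(s) be the S-transform of X_s at g. The Skorohod integral becomes the integral of
  \<sigma> g x by definition, and the drift that of a x by Fubini, so x solves a linear integral
  equation driven by a + \<sigma> g.\<close>

lemma skorohod_sde_S_transform:
  assumes a: "integrable unit_leb a" and \<sigma>: "\<sigma> \<in> borel_measurable unit_leb" "\<forall>s\<in>{0..1}. \<bar>\<sigma> s\<bar> \<le> K"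
    and X0: "square_integrable P X0" and sol: "skorohod_sde_solution P W a \<sigma> X0 X" and g: "L2_unit g"
  shows "X 1 \<in> borel_measurable P" "integrable P (\<lambda>\<omega>. X 1 \<omega> * WE g \<omega>)"
    "expectation (\<lambda>\<omega>. X 1 \<omega> * WE g \<omega>) =
      expectation (\<lambda>\<omega>. X0 \<omega> * WE g \<omega>) * exp ((\<integral>s. a s \<partial>unit_leb) + L2_inner \<sigma> g)"
proof -
  note measurable_expectation = borel_measurable_lebesgue_integral
  interpret pair_sigma_finite unit_leb P
    by (intro pair_sigma_finite.intro unit_leb.sigma_finite_measure_axioms sigma_finite_measure_axioms)
  have proc: "square_integrable (unit_leb \<Otimes>\<^sub>M P) (\<lambda>(s, \<omega>). X s \<omega>)"
    and aN: "integrable unit_leb (\<lambda>s. a s * sqrt (expectation (\<lambda>\<omega>. (X s \<omega>)\<^sup>2)))"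
    using sol by (auto simp: skorohod_sde_solution_def square_integrable_process_def)
  have Xm: "(\<lambda>(s, \<omega>). X s \<omega>) \<in> borel_measurable (unit_leb \<Otimes>\<^sub>M P)" by (rule square_integrable_measurable[OF proc])
  have Xt: "X t \<in> borel_measurable P" if "t \<in> {0..1}" for t
    using measurable_Pair2[OF Xm, of t] that by simp
  have Xsq: "integrable (unit_leb \<Otimes>\<^sub>M P) (\<lambda>(s, \<omega>). (X s \<omega>)\<^sup>2)"
    using square_integrable_integrable[OF proc] by (simp add: case_prod_unfold)
  have Wm: "WE g \<in> borel_measurable P" by (rule WE_measurable[OF g])
  have XW: "(\<lambda>(s, \<omega>). X s \<omega> * WE g \<omega>) \<in> borel_measurable (unit_leb \<Otimes>\<^sub>M P)"
    using borel_measurable_times[OF Xm measurable_compose[OF measurable_snd Wm]] by (simp add: case_prod_unfold)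
  \<comment> \<open>The L2 norm of X_s. By Cauchy-Schwarz |x s| <= w N s for almost every s, so
    integrability of \<open>a s * N s\<close>, part of being a solution, yields that of
    \<open>a s * x s\<close>.\<close>
  define N where "N s = sqrt (expectation (\<lambda>\<omega>. (X s \<omega>)\<^sup>2))" for s
  define w where "w = sqrt (expectation (\<lambda>\<omega>. (WE g \<omega>)\<^sup>2))"
  define x where "x s = expectation (\<lambda>\<omega>. X s \<omega> * WE g \<omega>)" for s
  have w0: "w \<ge> 0" by (simp add: w_def)
  have N0: "N s \<ge> 0" for s by (simp add: N_def)
  have N2: "integrable unit_leb (\<lambda>s. (N s)\<^sup>2)"
    using integrable_fst[OF Xsq] by (simp add: N_def)
  have AEL: "AE s in unit_leb. square_integrable P (X s)"
    using AE_integrable_fst[OF Xsq] AE_space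
    by eventually_elim (use Xt in \<open>auto simp: square_integrable_def\<close>)
  have xm: "x \<in> borel_measurable unit_leb"
    unfolding x_def[abs_def] using XW by (rule measurable_expectation)
  have absint: "square_integrable P (\<lambda>\<omega>. \<bar>X s \<omega>\<bar>)" if "square_integrable P (X s)" for s
    using that by (auto simp: square_integrable_def)
  have absb: "expectation (\<lambda>\<omega>. \<bar>X s \<omega>\<bar> * WE g \<omega>) \<le> N s * w" if "square_integrable P (X s)" for s
    using L2_Cauchy_Schwarz_abs[OF absint[OF that] WE_L2[OF g]] by (simp add: N_def w_def)
  have xb: "AE s in unit_leb. \<bar>x s\<bar> \<le> N s * w"
    using AEL by eventually_elim (use L2_Cauchy_Schwarz_abs[OF _ WE_L2[OF g]] in \<open>simp add: x_def N_def w_def\<close>)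
  have am: "a \<in> borel_measurable unit_leb" by (rule borel_measurable_integrable[OF a])
  have aNw: "integrable unit_leb (\<lambda>s. (a s * N s) * w)"
    using aN unfolding N_def by (rule integrable_mult_left)
  have ax: "integrable unit_leb (\<lambda>s. a s * x s)"
  proof (rule Bochner_Integration.integrable_bound[OF aNw])
    show "AE s in unit_leb. norm (a s * x s) \<le> norm ((a s * N s) * w)"
      using xb
    proof eventually_elim
      case (elim s)
      from mult_left_mono[OF this, of "\<bar>a s\<bar>"] show ?case using w0 N0[of s] by (simp add: abs_mult mult.assoc)
    qed
  qed (intro borel_measurable_times am xm)
  have x2: "L2_unit x"
  proof -
    have "integrable unit_leb (\<lambda>s. (x s)\<^sup>2)"
    proof (rule Bochner_Integration.integrable_bound[OF integrable_mult_left[OF N2, of "w\<^sup>2"]])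
      show "AE s in unit_leb. norm ((x s)\<^sup>2) \<le> norm ((N s)\<^sup>2 * w\<^sup>2)"
        using xb
      proof eventually_elim
        case (elim s)
        from power_mono[OF this, of 2] show ?case by (simp add: power_mult_distrib)
      qed
    qed (intro borel_measurable_power xm)
    with xm show ?thesis by (simp add: square_integrable_def)
  qed
  have \<sigma>x: "integrable unit_leb (\<lambda>s. \<sigma> s * g s * x s)"
  proof (rule Bochner_Integration.integrable_bound[OF integrable_mult_right[OF square_integrable_mult_integrable[OF g x2], of K]])
    show "AE s in unit_leb. norm (\<sigma> s * g s * x s) \<le> norm (K * (g s * x s))"
    proof (rule AE_I2)
      fix s assume "s \<in> space unit_leb"
      hence "\<bar>\<sigma> s\<bar> * \<bar>g s * x s\<bar> \<le> \<bar>K\<bar> * \<bar>g s * x s\<bar>" by (intro mult_right_mono order_trans[OF \<sigma>(2)[rule_format] abs_ge_self]) auto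
      thus "norm (\<sigma> s * g s * x s) \<le> norm (K * (g s * x s))" by (simp add: abs_mult)
    qed
  qed (intro borel_measurable_times \<sigma>(1) xm square_integrable_measurable[OF g])
  have \<sigma>L: "L2_unit \<sigma>" by (rule unit_leb.bounded_square_integrable[OF \<sigma>(1), of K]) (use \<sigma>(2) in auto)
  have main: "integrable P (\<lambda>\<omega>. X t \<omega> * WE g \<omega>) \<and> x t = expectation (\<lambda>\<omega>. X0 \<omega> * WE g \<omega>) +
      (\<integral>s. indicator {0..t} s * ((a s + \<sigma> s * g s) * x s) \<partial>unit_leb)" if t: "t \<in> {0..1}" for t
  proof -
    obtain Y where Y: "has_skorohod_integral P W (\<lambda>s \<omega>. indicator {0..t} s * \<sigma> s * X s \<omega>) Y"
      "AE \<omega> in P. X t \<omega> = X0 \<omega> + (\<integral>s. a s * X s \<omega> \<partial>lebesgue_on {0..t}) + Y \<omega>"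
      using sol t unfolding skorohod_sde_solution_def by blast
    have YL: "square_integrable P Y" using Y(1) by (simp add: has_skorohod_integral_def)
    have "expectation (\<lambda>\<omega>. Y \<omega> * WE g \<omega>) =
        (\<integral>s. expectation (\<lambda>\<omega>. indicator {0..t} s * \<sigma> s * X s \<omega> * WE g \<omega>) * g s \<partial>unit_leb)"
      using Y(1) g unfolding has_skorohod_integral_def by blast
    also have "\<dots> = (\<integral>s. indicator {0..t} s * (\<sigma> s * g s * x s) \<partial>unit_leb)"
    proof -
      have "expectation (\<lambda>\<omega>. indicator {0..t} s * \<sigma> s * X s \<omega> * WE g \<omega>) = indicator {0..t} s * \<sigma> s * x s" for s
        unfolding x_def by (subst integral_mult_right_zero[symmetric]) (simp only: mult.assoc)
      thus ?thesis by (simp only:) (simp only: mult_ac)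
    qed
    finally have YE: "expectation (\<lambda>\<omega>. Y \<omega> * WE g \<omega>) = (\<integral>s. indicator {0..t} s * (\<sigma> s * g s * x s) \<partial>unit_leb)" .
    define D where "D \<omega> = (\<integral>s. a s * X s \<omega> \<partial>lebesgue_on {0..t})" for \<omega>
    have D: "D \<omega> = (\<integral>s. indicator {0..t} s * (a s * X s \<omega>) \<partial>unit_leb)" for \<omega>
    proof -
      have "lebesgue_on {0..t} = restrict_space unit_leb {0..t}"
        using t by (simp add: restrict_restrict_space min_absorb2)
      moreover have "{0..t} \<inter> space unit_leb \<in> sets unit_leb" using t by (simp add: sets_restrict_space_iff)
      ultimately show ?thesis unfolding D_def by (simp add: integral_restrict_space)
    qed
    define F where "F s \<omega> = indicator {0..t} s * (a s * (X s \<omega> * WE g \<omega>))" for s \<omega>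
    have im: "(\<lambda>s. indicator {0..t} s * a s) \<in> borel_measurable unit_leb"
      by (rule borel_measurable_integrable[OF integrable_indicator_mult[OF a]]) simp
    have Fm: "(\<lambda>(s, \<omega>). F s \<omega>) \<in> borel_measurable (unit_leb \<Otimes>\<^sub>M P)"
      using borel_measurable_times[OF measurable_compose[OF measurable_fst im] XW]
      by (simp add: F_def[abs_def] case_prod_unfold mult.assoc)
    \<comment> \<open>Fubini for the drift: the inner L1 norms are at most |a| N w.\<close>
    have Fint: "integrable (unit_leb \<Otimes>\<^sub>M P) (\<lambda>(s, \<omega>). F s \<omega>)"
    proof (rule Fubini_integrable[OF Fm])
      show "integrable unit_leb (\<lambda>s. expectation (\<lambda>\<omega>. norm (case (s, \<omega>) of (s, \<omega>) \<Rightarrow> F s \<omega>)))"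
      proof (rule Bochner_Integration.integrable_bound[OF aNw])
        show "(\<lambda>s. expectation (\<lambda>\<omega>. norm (case (s, \<omega>) of (s, \<omega>) \<Rightarrow> F s \<omega>))) \<in> borel_measurable unit_leb"
          by (rule measurable_expectation) (use Fm in \<open>simp add: case_prod_unfold\<close>)
        show "AE s in unit_leb. norm (expectation (\<lambda>\<omega>. norm (case (s, \<omega>) of (s, \<omega>) \<Rightarrow> F s \<omega>))) \<le> norm (a s * N s * w)"
          using AEL
        proof eventually_elim
          case (elim s)
          have "expectation (\<lambda>\<omega>. norm (F s \<omega>)) = indicator {0..t} s * \<bar>a s\<bar> * expectation (\<lambda>\<omega>. \<bar>X s \<omega>\<bar> * WE g \<omega>)"
            by (simp add: F_def abs_mult WE_eq mult.assoc)
          also have "\<dots> \<le> indicator {0..t} s * \<bar>a s\<bar> * (N s * w)"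
            by (intro mult_left_mono absb[OF elim]) auto
          also have "\<dots> \<le> 1 * \<bar>a s\<bar> * (N s * w)"
            using w0 N0[of s] by (intro mult_right_mono) (auto simp: indicator_def)
          finally have "expectation (\<lambda>\<omega>. norm (F s \<omega>)) \<le> norm (a s * N s * w)"
            using w0 N0[of s] by (simp add: abs_mult mult.assoc)
          moreover have "0 \<le> expectation (\<lambda>\<omega>. norm (F s \<omega>))" by (rule Bochner_Integration.integral_nonneg) simp
          ultimately show ?case by simp
        qed
      qed
      show "AE s in unit_leb. integrable P (\<lambda>\<omega>. case (s, \<omega>) of (s, \<omega>) \<Rightarrow> F s \<omega>)"
        using AEL by eventually_elim (simp add: F_def square_integrable_mult_integrable[OF _ WE_L2[OF g]])
    qed
    have DW: "D \<omega> * WE g \<omega> = (\<integral>s. F s \<omega> \<partial>unit_leb)" for \<omega>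
      unfolding D F_def by (subst integral_mult_left_zero[symmetric]) (simp add: mult.assoc)
    have iD: "integrable P (\<lambda>\<omega>. D \<omega> * WE g \<omega>)" unfolding DW by (rule integrable_snd[OF Fint])
    have "expectation (\<lambda>\<omega>. D \<omega> * WE g \<omega>) = (\<integral>s. expectation (F s) \<partial>unit_leb)"
      unfolding DW using Fubini_integral[OF Fint] by simp
    also have "\<dots> = (\<integral>s. indicator {0..t} s * (a s * x s) \<partial>unit_leb)"
      by (simp add: F_def[abs_def] x_def)
    finally have DE: "expectation (\<lambda>\<omega>. D \<omega> * WE g \<omega>) = (\<integral>s. indicator {0..t} s * (a s * x s) \<partial>unit_leb)" .
    note i0 = square_integrable_mult_integrable[OF X0 WE_L2[OF g]]
    note iY = square_integrable_mult_integrable[OF YL WE_L2[OF g]]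
    have AE: "AE \<omega> in P. X0 \<omega> * WE g \<omega> + D \<omega> * WE g \<omega> + Y \<omega> * WE g \<omega> = X t \<omega> * WE g \<omega>"
      using Y(2) by eventually_elim (simp add: D_def algebra_simps)
    have isum: "integrable P (\<lambda>\<omega>. X0 \<omega> * WE g \<omega> + D \<omega> * WE g \<omega> + Y \<omega> * WE g \<omega>)" using i0 iD iY by simp
    have m: "(\<lambda>\<omega>. X t \<omega> * WE g \<omega>) \<in> borel_measurable P" by (intro borel_measurable_times Xt t Wm)
    have "integrable P (\<lambda>\<omega>. X t \<omega> * WE g \<omega>)"
      using integrable_cong_AE[OF borel_measurable_integrable[OF isum] m AE] isum by blast
    moreover have "x t = expectation (\<lambda>\<omega>. X0 \<omega> * WE g \<omega> + D \<omega> * WE g \<omega> + Y \<omega> * WE g \<omega>)"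
      unfolding x_def by (rule integral_cong_AE[OF borel_measurable_integrable[OF isum] m AE, symmetric])
    moreover have "(\<integral>s. indicator {0..t} s * (a s * x s) \<partial>unit_leb) + (\<integral>s. indicator {0..t} s * (\<sigma> s * g s * x s) \<partial>unit_leb) =
        (\<integral>s. indicator {0..t} s * ((a s + \<sigma> s * g s) * x s) \<partial>unit_leb)"
      using integrable_indicator_mult[OF ax, of "{0..t}"] integrable_indicator_mult[OF \<sigma>x, of "{0..t}"]
      by (subst Bochner_Integration.integral_add[symmetric]) (simp_all add: algebra_simps)
    ultimately show ?thesis using i0 iD iY by (simp add: DE YE)
  qed
  show "X 1 \<in> borel_measurable P" by (rule Xt) simp
  show "integrable P (\<lambda>\<omega>. X 1 \<omega> * WE g \<omega>)" using main[of 1] by simp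
  have "x 1 = expectation (\<lambda>\<omega>. X0 \<omega> * WE g \<omega>) * exp (\<integral>s. a s + \<sigma> s * g s \<partial>unit_leb)"
  proof (rule linear_integral_equation)
    show "integrable unit_leb (\<lambda>s. a s + \<sigma> s * g s)"
      by (intro Bochner_Integration.integrable_add a square_integrable_mult_integrable[OF \<sigma>L g])
    show "integrable unit_leb (\<lambda>s. (a s + \<sigma> s * g s) * x s)"
      using Bochner_Integration.integrable_add[OF ax \<sigma>x] by (simp add: distrib_right)
  qed (use main in blast)
  also have "(\<integral>s. a s + \<sigma> s * g s \<partial>unit_leb) = (\<integral>s. a s \<partial>unit_leb) + L2_inner \<sigma> g"
    using a square_integrable_mult_integrable[OF \<sigma>L g] by (simp add: L2_inner_def)
  finally show "expectation (\<lambda>\<omega>. X 1 \<omega> * WE g \<omega>) =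
      expectation (\<lambda>\<omega>. X0 \<omega> * WE g \<omega>) * exp ((\<integral>s. a s \<partial>unit_leb) + L2_inner \<sigma> g)" by (simp add: x_def)
qed

end

lemma BV_derivative_L2:
  assumes "BV_derivative f f'"
  shows "L2_unit f" "L2_unit f'"
proof -
  show "L2_unit f" using assms by (simp add: BV_derivative_def)
  obtain K where K: "\<And>s. s \<in> {0..1} \<Longrightarrow> \<bar>f' s\<bar> \<le> K"
    using bounded_variation_on_bounded assms unfolding BV_derivative_def by metis
  have "f' \<in> borel_measurable unit_leb"
    using assms by (intro derivative_measurable[of f]) (auto simp: BV_derivative_def)
  thus "L2_unit f'" by (rule unit_leb.bounded_square_integrable[where B = K]) (use K in auto)
qed

section \<open>The solution at time 1 and the second moment in the limit\<close>

context brownian_space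
begin

text \<open>At every g the equation multiplies the S-transform of F(I(f)) by the exponential of the
  integral of a plus <\<sigma>, g>, and the scaled functional has this S-transform too.\<close>

lemma skorohod_sde_solution_AE:
  assumes f: "L2_unit f" and c: "geom_bounded (\<lambda>k. fact k * c k)" and a: "integrable unit_leb a" and \<sigma>: "BV_derivative \<sigma> \<sigma>'"
    and sol: "skorohod_sde_solution P W a \<sigma> (wick_series P W c f) X"
  shows "X 1 \<in> borel_measurable P"
    "AE \<omega> in P. X 1 \<omega> = exp (\<integral>s. a s \<partial>unit_leb) * wick_functional (\<lambda>k. fact k * c k) f \<sigma> \<omega>"
proof -
  have \<sigma>L: "L2_unit \<sigma>" by (rule BV_derivative_L2[OF \<sigma>])
  have "bounded (\<sigma> ` {0..1})"
    by (rule compact_imp_bounded[OF compact_continuous_image[OF BV_derivative_continuous[OF \<sigma>]]]) simp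
  then obtain K where K: "\<forall>s\<in>{0..1}. \<bar>\<sigma> s\<bar> \<le> K" unfolding bounded_iff by auto
  note S = skorohod_sde_S_transform[OF a BV_derivative_measurable[OF \<sigma>] K wick_series_AE(1)[OF f c] sol]
  let ?Z = "\<lambda>\<omega>. exp (\<integral>s. a s \<partial>unit_leb) * wick_functional (\<lambda>k. fact k * c k) f \<sigma> \<omega>"
  have Z: "square_integrable P ?Z" by (intro square_integrable_scale wick_functional_L2 f \<sigma>L c)
  \<comment> \<open>Measurability does not involve g, so the zero function serves as an
    instance.\<close>
  show X1: "X 1 \<in> borel_measurable P" by (rule S(1)[OF square_integrable_zero])
  have "AE \<omega> in P. X 1 \<omega> - ?Z \<omega> = 0"
  proof (rule wick_exp_total)
    show "(\<lambda>\<omega>. X 1 \<omega> - ?Z \<omega>) \<in> borel_measurable P" by (intro borel_measurable_diff X1 square_integrable_measurable[OF Z])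
    fix g assume g: "L2_unit g"
    note i = S(2)[OF g] square_integrable_mult_integrable[OF Z WE_L2[OF g]]
    show "integrable P (\<lambda>\<omega>. (X 1 \<omega> - ?Z \<omega>) * WE g \<omega>)" using i by (simp add: left_diff_distrib)
    have "expectation (\<lambda>\<omega>. ?Z \<omega> * WE g \<omega>) = exp (\<integral>s. a s \<partial>unit_leb) * (exp (L2_inner \<sigma> g) * egf (\<lambda>k. fact k * c k) (L2_inner f g))"
      using wick_functional_S_transform[OF f \<sigma>L c g] by (simp add: mult.assoc)
    thus "expectation (\<lambda>\<omega>. (X 1 \<omega> - ?Z \<omega>) * WE g \<omega>) = 0"
      using i S(3)[OF g] wick_series_S_transform[OF f c g] by (simp add: left_diff_distrib exp_add)
  qed
  thus "AE \<omega> in P. X 1 \<omega> = ?Z \<omega>" by eventually_elim simp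
qed

text \<open>By linearity of the S-transform the Wick product is the functional with coefficients
  \<open>p * a (k + 1) + q * a k\<close>, so its second moment is a quadratic form in p and q. It is
  meant for p = f'(s) and q = \<sigma>'(s).\<close>

lemma wick_prod_derivative_norm:
  assumes f: "L2_unit f" and \<sigma>: "L2_unit \<sigma>" and c: "geom_bounded (\<lambda>k. fact k * c k)"
  defines "a \<equiv> \<lambda>k. fact k * c k" and "x \<equiv> L2_inner f f" and "y \<equiv> L2_inner f \<sigma>"
  shows "expectation (\<lambda>\<omega>. (wick_prod P W (\<lambda>\<omega>. p * wick_series P W (wick_deriv c) f \<omega> + q * wick_series P W c f \<omega>)
      (WE \<sigma>) \<omega>)\<^sup>2) = exp (L2_inner \<sigma> \<sigma>) * (p\<^sup>2 * fock_pairing (\<lambda>k. a (k + 1)) (\<lambda>k. a (k + 1)) x y y +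
      2 * (p * q) * fock_pairing (\<lambda>k. a (k + 1)) a x y y + q\<^sup>2 * fock_pairing a a x y y)"
proof -
  have a: "geom_bounded a" using c by (simp add: a_def)
  have a': "geom_bounded (\<lambda>k. a (k + 1))" by (rule geom_bounded_shift[OF a])
  have d: "(\<lambda>k. fact k * wick_deriv c k) = (\<lambda>k. a (k + 1))" unfolding fact_wick_deriv a_def ..
  have c': "geom_bounded (\<lambda>k. fact k * wick_deriv c k)" unfolding d by (rule a')
  define b where "b = (\<lambda>k. p * a (k + 1) + q * a k)"
  have b: "geom_bounded b" unfolding b_def by (intro geom_bounded_add geom_bounded_scale a a')
  let ?A = "wick_series P W (wick_deriv c) f" and ?B = "wick_series P W c f"
  note L = wick_series_AE(1)[OF f c'] wick_series_AE(1)[OF f c]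
  have "is_wick_prod P W (\<lambda>\<omega>. p * ?A \<omega> + q * ?B \<omega>) (WE \<sigma>) (wick_functional b f \<sigma>)"
    unfolding is_wick_prod_def
  proof (intro conjI allI impI)
    show "square_integrable P (\<lambda>\<omega>. p * ?A \<omega> + q * ?B \<omega>)" by (intro square_integrable_add square_integrable_scale L)
    fix g assume g: "L2_unit g"
    have "expectation (\<lambda>\<omega>. (p * ?A \<omega> + q * ?B \<omega>) * WE g \<omega>) =
        p * expectation (\<lambda>\<omega>. ?A \<omega> * WE g \<omega>) + q * expectation (\<lambda>\<omega>. ?B \<omega> * WE g \<omega>)"
      using square_integrable_mult_integrable[OF L(1) WE_L2[OF g]] square_integrable_mult_integrable[OF L(2) WE_L2[OF g]]
      by (simp add: distrib_right mult.assoc)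
    also have "\<dots> = p * egf (\<lambda>k. a (k + 1)) (L2_inner f g) + q * egf a (L2_inner f g)"
      unfolding wick_series_S_transform[OF f c' g] wick_series_S_transform[OF f c g] d by (simp add: a_def)
    also have "\<dots> = egf b (L2_inner f g)"
      unfolding b_def by (subst egf_add) (simp_all only: egf_scale[OF a] egf_scale[OF a'] geom_bounded_scale[OF a] geom_bounded_scale[OF a'])
    finally show "expectation (\<lambda>\<omega>. wick_functional b f \<sigma> \<omega> * WE g \<omega>) =
        expectation (\<lambda>\<omega>. (p * ?A \<omega> + q * ?B \<omega>) * WE g \<omega>) * expectation (\<lambda>\<omega>. WE \<sigma> \<omega> * WE g \<omega>)"
      using wick_functional_S_transform[OF f \<sigma> b g] WE_inner[OF \<sigma> g] by simp
  qed (intro WE_L2 \<sigma> wick_functional_L2 f b)+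
  note wp = wick_prod_AE[OF this]
  have "square_integrable P (wick_prod P W (\<lambda>\<omega>. p * ?A \<omega> + q * ?B \<omega>) (WE \<sigma>))" using wp(1) by (simp add: is_wick_prod_def)
  note m = square_integrable_measurable[OF this] wick_functional_measurable[OF f \<sigma>, of b]
  have "expectation (\<lambda>\<omega>. (wick_prod P W (\<lambda>\<omega>. p * ?A \<omega> + q * ?B \<omega>) (WE \<sigma>) \<omega>)\<^sup>2) =
      expectation (\<lambda>\<omega>. wick_functional b f \<sigma> \<omega> * wick_functional b f \<sigma> \<omega>)"
    by (rule integral_cong_AE)
       (use wp(2) m in \<open>auto simp: power2_eq_square elim: AE_mp intro!: borel_measurable_times\<close>)
  also have "\<dots> = exp (L2_inner \<sigma> \<sigma>) * fock_pairing b b x y y"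
    unfolding wick_functional_inner[OF f \<sigma> b f \<sigma> b] x_def y_def ..
  also have "fock_pairing b b x y y = p\<^sup>2 * fock_pairing (\<lambda>k. a (k + 1)) (\<lambda>k. a (k + 1)) x y y +
      2 * (p * q) * fock_pairing (\<lambda>k. a (k + 1)) a x y y + q\<^sup>2 * fock_pairing a a x y y"
  proof -
    have e: "fock_pairing b u x y y = p * fock_pairing (\<lambda>k. a (k + 1)) u x y y + q * fock_pairing a u x y y" if u: "geom_bounded u" for u
      unfolding b_def
      by (subst fock_pairing_add_left[OF geom_bounded_scale[OF a'] geom_bounded_scale[OF a] u])
         (simp only: fock_pairing_scale_left[OF a' u] fock_pairing_scale_left[OF a u])
    have "fock_pairing b b x y y = p * fock_pairing b (\<lambda>k. a (k + 1)) x y y + q * fock_pairing b a x y y"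
      unfolding e[OF b] by (simp only: fock_pairing_commute[of _ b])
    also have "\<dots> = p * (p * fock_pairing (\<lambda>k. a (k + 1)) (\<lambda>k. a (k + 1)) x y y + q * fock_pairing (\<lambda>k. a (k + 1)) a x y y) +
        q * (p * fock_pairing (\<lambda>k. a (k + 1)) a x y y + q * fock_pairing a a x y y)"
      unfolding e[OF a'] e[OF a] fock_pairing_commute[of a "\<lambda>k. a (k + 1)"] ..
    finally show ?thesis by (simp add: power2_eq_square algebra_simps)
  qed
  finally show ?thesis .
qed

end

theorem theorem1:
  fixes P :: "'a measure"
    and W :: "real \<Rightarrow> 'a \<Rightarrow> real"
    and f f' \<sigma> \<sigma>' a :: "real \<Rightarrow> real"
    and c :: "nat \<Rightarrow> real"
    and X :: "real \<Rightarrow> 'a \<Rightarrow> real"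
  assumes "brownian_space P W"
    and "BV_derivative f f'"
    and "BV_derivative \<sigma> \<sigma>'"
    and "integrable lebesgue a"
    and "wick_analytic_coeffs c"
    and "skorohod_sde_solution P W a \<sigma> (wick_series P W c f) X"
  shows "(\<lambda>n. (real n)\<^sup>2 * (\<integral>\<omega>. (X 1 \<omega> - optimal_approx P W n (X 1) \<omega>)\<^sup>2 \<partial>P)) \<longlonglongrightarrow>
     exp (2 * (\<integral>s. a s \<partial>lebesgue_on {0..1})) / 12 *
     (\<integral>s. (\<integral>\<omega>. (wick_prod P W
          (\<lambda>\<omega>. f' s * wick_series P W (wick_deriv c) f \<omega> + \<sigma>' s * wick_series P W c f \<omega>)
          (wick_exp P W \<sigma>) \<omega>)\<^sup>2 \<partial>P) \<partial>lebesgue_on {0..1})"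
proof -
  interpret brownian_space P W by (rule assms(1))
  note L = BV_derivative_L2[OF assms(2)] BV_derivative_L2[OF assms(3)]
  have ia: "integrable unit_leb a"
    using integrable_mult_indicator[OF _ assms(4), of "{0..1}"] by (subst integrable_restrict_space) auto
  define r where "r = exp (\<integral>s. a s \<partial>unit_leb)"
  define b where "b = (\<lambda>k. fact k * c k)"
  have gb: "geom_bounded (\<lambda>k. fact k * c k)" by (rule wick_analytic_geom_bounded[OF assms(5)])
  hence b: "geom_bounded b" by (simp add: b_def)
  note X = skorohod_sde_solution_AE[OF L(1) gb ia assms(3,6)]
  define x y z where "x = L2_inner f f" and "y = L2_inner f \<sigma>" and "z = L2_inner \<sigma> \<sigma>"
  define xn yn zn where "xn n = L2_inner (grid_proj n f) (grid_proj n f)" and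
    "yn n = L2_inner (grid_proj n f) (grid_proj n \<sigma>)" and "zn n = L2_inner (grid_proj n \<sigma>) (grid_proj n \<sigma>)" for n
  define A where "A = fock_pairing (\<lambda>k. b (k + 1)) (\<lambda>k. b (k + 1)) x y y"
  define B where "B = fock_pairing (\<lambda>k. b (k + 1)) b x y y"
  define C where "C = fock_pairing b b x y y"
  have lims: "(\<lambda>n. (real n)\<^sup>2 * (x - xn n)) \<longlonglongrightarrow> L2_inner f' f' / 12"
    "(\<lambda>n. (real n)\<^sup>2 * (y - yn n)) \<longlonglongrightarrow> L2_inner f' \<sigma>' / 12"
    "(\<lambda>n. (real n)\<^sup>2 * (z - zn n)) \<longlonglongrightarrow> L2_inner \<sigma>' \<sigma>' / 12"
    unfolding x_def y_def z_def xn_def yn_def zn_def by (intro grid_residual_limit assms)+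
  note conv = tendsto_of_scaled_difference[OF lims(1)] tendsto_of_scaled_difference[OF lims(2)]
    tendsto_of_scaled_difference[OF lims(3)]
  \<comment> \<open>The discrete product rule for exp z times the pairing: one difference keeps the
    pairing at its limit, the other keeps \<open>exp (zn n)\<close>.\<close>
  have "(\<lambda>n. (real n)\<^sup>2 * (exp z - exp (zn n)) * C +
      exp (zn n) * ((real n)\<^sup>2 * (C - fock_pairing b b (xn n) (yn n) (yn n)))) \<longlonglongrightarrow>
      L2_inner \<sigma>' \<sigma>' / 12 * exp z * C + exp z * (L2_inner f' f' / 12 * A + 2 * (L2_inner f' \<sigma>' / 12) * B)"
    unfolding A_def B_def C_def
    by (intro tendsto_add tendsto_mult tendsto_const tendsto_exp conv(3) fock_pairing_limit[OF b lims(1,2) conv(1,2)]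
        scaled_difference_limit[OF DERIV_exp conv(3) lims(3)])
  from tendsto_mult[OF tendsto_const[of "r\<^sup>2"] this]
  have lim: "(\<lambda>n. r\<^sup>2 * ((real n)\<^sup>2 * (exp z - exp (zn n)) * C +
      exp (zn n) * ((real n)\<^sup>2 * (C - fock_pairing b b (xn n) (yn n) (yn n))))) \<longlonglongrightarrow>
      r\<^sup>2 / 12 * (exp z * (L2_inner f' f' * A + 2 * L2_inner f' \<sigma>' * B + L2_inner \<sigma>' \<sigma>' * C))"
    by (simp add: algebra_simps add_divide_distrib)
  have "eventually (\<lambda>n. r\<^sup>2 * ((real n)\<^sup>2 * (exp z - exp (zn n)) * C +
      exp (zn n) * ((real n)\<^sup>2 * (C - fock_pairing b b (xn n) (yn n) (yn n)))) =
      (real n)\<^sup>2 * expectation (\<lambda>\<omega>. (X 1 \<omega> - optimal_approx P W n (X 1) \<omega>)\<^sup>2)) sequentially"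
    using eventually_gt_at_top[of 0]
  proof eventually_elim
    case (elim n)
    show ?case
      unfolding optimal_approx_error[OF elim L(1,3) gb X, folded b_def r_def]
      by (simp add: C_def x_def y_def z_def xn_def yn_def zn_def algebra_simps)
  qed
  from Lim_transform_eventually[OF lim this]
  have main: "(\<lambda>n. (real n)\<^sup>2 * expectation (\<lambda>\<omega>. (X 1 \<omega> - optimal_approx P W n (X 1) \<omega>)\<^sup>2)) \<longlonglongrightarrow>
      r\<^sup>2 / 12 * (exp z * (L2_inner f' f' * A + 2 * L2_inner f' \<sigma>' * B + L2_inner \<sigma>' \<sigma>' * C))" .
  \<comment> \<open>For each s the second moment is a quadratic form in f'(s) and \<sigma>'(s);
    integration over s yields the same three inner products as in the limit of the errors.\<close>
  have "(\<integral>s. expectation (\<lambda>\<omega>. (wick_prod P W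
          (\<lambda>\<omega>. f' s * wick_series P W (wick_deriv c) f \<omega> + \<sigma>' s * wick_series P W c f \<omega>)
          (wick_exp P W \<sigma>) \<omega>)\<^sup>2) \<partial>unit_leb) =
      (\<integral>s. exp z * ((f' s * f' s) * A + 2 * (f' s * \<sigma>' s) * B + (\<sigma>' s * \<sigma>' s) * C) \<partial>unit_leb)"
    unfolding wick_prod_derivative_norm[OF L(1,3) gb] A_def B_def C_def x_def y_def z_def b_def
    by (simp add: power2_eq_square)
  also have "\<dots> = exp z * (L2_inner f' f' * A + 2 * L2_inner f' \<sigma>' * B + L2_inner \<sigma>' \<sigma>' * C)"
    using square_integrable_mult_integrable[OF L(2) L(2)] square_integrable_mult_integrable[OF L(2) L(4)]
      square_integrable_mult_integrable[OF L(4) L(4)] by (simp add: L2_inner_def)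
  finally have "(\<integral>s. expectation (\<lambda>\<omega>. (wick_prod P W
          (\<lambda>\<omega>. f' s * wick_series P W (wick_deriv c) f \<omega> + \<sigma>' s * wick_series P W c f \<omega>)
          (wick_exp P W \<sigma>) \<omega>)\<^sup>2) \<partial>unit_leb) =
      exp z * (L2_inner f' f' * A + 2 * L2_inner f' \<sigma>' * B + L2_inner \<sigma>' \<sigma>' * C)" .
  moreover have "r\<^sup>2 = exp (2 * (\<integral>s. a s \<partial>unit_leb))" by (simp add: r_def exp_double)
  ultimately show ?thesis using main by simp
qed

end
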